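(* Let $(M^m,g)$ be a connected complex manifold of complex dimension $m$ with a Hermitian metric $g$, and let $\nabla$ be a Hermitian connection on $M$. Assume that the restricted holonomy group $G$ of $\nabla$ acts irreducibly on $T^{1,0}M$. Assume further that the Chern Ricci curvature $\mathrm{Ric}^1$ of $\nabla$ is not identically zero and that the torsion $T$ of $\nabla$ is parallel, i.e. $\nabla T=0$. Then $(M^m,g)$ is Kähler. Equivalently, if $(M^m,g)$ is a non-Kähler Hermitian manifold with a Hermitian connection $\nabla$ whose torsion is parallel and whose restricted holonomy group acts irreducibly on $T^{1,0}M$, then $\mathrm{Ric}^1$ vanishes identically (i.e. $(M,g,\nabla)$ is a generalized Calabi-Yau).
   Context: Let $J$ be the (integrable) almost complex structure of $M$. A connection $\nabla$ on $TM$ is Hermitian if $\nabla g=0$ and $\nabla J=0$. No other condition is imposed on $\nabla$ (it need not be the Chern or Bismut connection). Its torsion is $T(X,Y)=\nabla_XY-\nabla_YX-[X,Y]$ and its curvature operator is $R_{X,Y}$. The restricted holonomy group $G$ at $p$ is the group of $\nabla$-parallel transports along contractible loops based at $p$; since $\nabla J=0$ it acts complex linearly on $T^{1,0}_pM$. Extend $g=\langle\cdot,\cdot\rangle$ complex bilinearly to $TM\otimes\mathbb{C}$. The Chern Ricci curvature (first Ricci curvature) of $\nabla$ is $\mathrm{Ric}^1(X,Y)=\sum_{i=1}^m\langle R_{X,Y}e_i,\overline{e_i}\rangle$, where $\{e_i\}_{i=1}^m$ is a unitary frame of $T^{1,0}_pM$. *)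

theory Defs
  imports "HOL-Analysis.Analysis"
begin

section \<open>Smooth and holomorphic maps\<close>

text \<open>\<^term>\<open>Ck_on k S f\<close>: \<open>f\<close> is of class \<open>C\<^sup>k\<close> on \<open>S\<close>, meaningful for open \<open>S\<close> in a
  finite-dimensional space.\<close>

primrec Ck_on ::
  "nat \<Rightarrow> 'a::real_normed_vector set \<Rightarrow> ('a \<Rightarrow> 'b::real_normed_vector) \<Rightarrow> bool" where
  "Ck_on 0 S f \<longleftrightarrow> continuous_on S f"
| "Ck_on (Suc k) S f \<longleftrightarrow>
     (\<forall>x\<in>S. f differentiable (at x)) \<and> (\<forall>v. Ck_on k S (\<lambda>x. frechet_derivative f (at x) v))"

definition smooth_on ::
  "'a::real_normed_vector set \<Rightarrow> ('a \<Rightarrow> 'b::real_normed_vector) \<Rightarrow> bool" where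
  "smooth_on S f \<longleftrightarrow> (\<forall>k. Ck_on k S f)"

text \<open>Holomorphic maps of several variables: smooth, with complex linear differential (the
  Cauchy-Riemann equations).\<close>

definition holomorphic_map_on ::
  "(complex^'m) set \<Rightarrow> (complex^'m \<Rightarrow> complex^'n) \<Rightarrow> bool" where
  "holomorphic_map_on S f \<longleftrightarrow> smooth_on S f \<and>
     (\<forall>x\<in>S. \<forall>a v. frechet_derivative f (at x) (a *s v) = a *s frechet_derivative f (at x) v)"

section \<open>Complex manifolds\<close>

text \<open>The underlying space \<open>M\<close> of a manifold is a whole type \<open>'a\<close>; a chart is a pair of an open
  domain and a coordinate map.\<close>

type_synonym ('a, 'm) chart = "'a set \<times> ('a \<Rightarrow> complex^'m)"

abbreviation chart_inv :: "('a, 'm) chart \<Rightarrow> complex^'m \<Rightarrow> 'a" where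
  "chart_inv c \<equiv> inv_into (fst c) (snd c)"

definition complex_atlas ::
  "('a::{t2_space,second_countable_topology}, 'm::finite) chart set \<Rightarrow> bool" where
  "complex_atlas A \<longleftrightarrow>
     (\<Union>c\<in>A. fst c) = UNIV \<and>
     (\<forall>c\<in>A. open (fst c) \<and> open (snd c ` fst c) \<and>
        homeomorphism (fst c) (snd c ` fst c) (snd c) (chart_inv c)) \<and>
     (\<forall>c\<in>A. \<forall>d\<in>A. holomorphic_map_on (snd c ` (fst c \<inter> fst d)) (snd d \<circ> chart_inv c))"

definition smooth_fun ::
  "('a, 'm::finite) chart set \<Rightarrow> ('a \<Rightarrow> real) \<Rightarrow> bool" where
  "smooth_fun A f \<longleftrightarrow> (\<forall>c\<in>A. smooth_on (snd c ` fst c) (f \<circ> chart_inv c))"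

text \<open>For every point \<open>p\<close> a chart around \<open>p\<close> is chosen once and for all. The real tangent space
  \<open>T\<^sub>pM\<close> is the real vector space \<open>complex^'m\<close>, a tangent vector being given by its components in
  the chosen chart at \<open>p\<close>. As coordinate changes have complex linear differential, the almost
  complex structure \<open>J\<close> of \<open>M\<close> is multiplication by the imaginary unit in each tangent space,
  whatever the chart. \<^term>\<open>in_chart A c p v\<close> gives the components in another chart \<open>c\<close> around \<open>p\<close>
  of the tangent vector \<open>v\<close> at \<open>p\<close>.\<close>

definition chart_at :: "('a, 'm) chart set \<Rightarrow> 'a \<Rightarrow> ('a, 'm) chart" where
  "chart_at A p = (SOME c. c \<in> A \<and> p \<in> fst c)"

definition in_chart ::
  "('a, 'm::finite) chart set \<Rightarrow> ('a, 'm) chart \<Rightarrow> 'a \<Rightarrow> complex^'m \<Rightarrow> complex^'m" where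
  "in_chart A c p v =
     frechet_derivative (snd c \<circ> chart_inv (chart_at A p)) (at (snd (chart_at A p) p)) v"

definition J :: "complex^'m \<Rightarrow> complex^'m" where
  "J v = \<i> *s v"

section \<open>Vector fields\<close>

text \<open>A vector field assigns to \<open>p\<close> an element of \<open>T\<^sub>pM\<close>, that is, components in the chart chosen
  at \<open>p\<close>. Smoothness concerns the components in a fixed chart.\<close>

type_synonym ('a, 'm) vfield = "'a \<Rightarrow> complex^'m"

definition local_rep ::
  "('a, 'm::finite) chart set \<Rightarrow> ('a, 'm) chart \<Rightarrow> ('a, 'm) vfield \<Rightarrow> complex^'m \<Rightarrow> complex^'m" where
  "local_rep A c X x = in_chart A c (chart_inv c x) (X (chart_inv c x))"

definition VF :: "('a, 'm::finite) chart set \<Rightarrow> ('a, 'm) vfield set" where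
  "VF A = {X. \<forall>c\<in>A. smooth_on (snd c ` fst c) (local_rep A c X)}"

text \<open>The function \<open>X(f)\<close>.\<close>

definition deriv_along ::
  "('a, 'm::finite) chart set \<Rightarrow> ('a, 'm) vfield \<Rightarrow> ('a \<Rightarrow> real) \<Rightarrow> 'a \<Rightarrow> real" where
  "deriv_along A X f p =
     frechet_derivative (f \<circ> chart_inv (chart_at A p)) (at (snd (chart_at A p) p)) (X p)"

definition lie_bracket ::
  "('a, 'm::finite) chart set \<Rightarrow> ('a, 'm) vfield \<Rightarrow> ('a, 'm) vfield \<Rightarrow> ('a, 'm) vfield" where
  "lie_bracket A X Y p = (let c = chart_at A p in
     frechet_derivative (local_rep A c Y) (at (snd c p)) (X p) -
     frechet_derivative (local_rep A c X) (at (snd c p)) (Y p))"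

section \<open>Hermitian metrics and the Kaehler condition\<close>

type_synonym ('a, 'm) metric = "'a \<Rightarrow> complex^'m \<Rightarrow> complex^'m \<Rightarrow> real"

definition hermitian_metric ::
  "('a, 'm::finite) chart set \<Rightarrow> ('a, 'm) metric \<Rightarrow> bool" where
  "hermitian_metric A g \<longleftrightarrow>
     (\<forall>p. bilinear (g p)) \<and>
     (\<forall>p u v. g p u v = g p v u) \<and>
     (\<forall>p u. u \<noteq> 0 \<longrightarrow> g p u u > 0) \<and>
     (\<forall>p u v. g p (J u) (J v) = g p u v) \<and>
     (\<forall>X\<in>VF A. \<forall>Y\<in>VF A. smooth_fun A (\<lambda>p. g p (X p) (Y p)))"

definition fundamental_form ::
  "('a, 'm::finite) metric \<Rightarrow> ('a, 'm) vfield \<Rightarrow> ('a, 'm) vfield \<Rightarrow> 'a \<Rightarrow> real" where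
  "fundamental_form g X Y p = g p (J (X p)) (Y p)"

text \<open>Exterior derivative of a 2-form, given as an operation on vector fields.\<close>

definition ext_deriv2 ::
  "('a, 'm::finite) chart set \<Rightarrow> (('a, 'm) vfield \<Rightarrow> ('a, 'm) vfield \<Rightarrow> 'a \<Rightarrow> real) \<Rightarrow>
   ('a, 'm) vfield \<Rightarrow> ('a, 'm) vfield \<Rightarrow> ('a, 'm) vfield \<Rightarrow> 'a \<Rightarrow> real" where
  "ext_deriv2 A \<omega> X Y Z p =
     deriv_along A X (\<omega> Y Z) p - deriv_along A Y (\<omega> X Z) p + deriv_along A Z (\<omega> X Y) p
     - \<omega> (lie_bracket A X Y) Z p + \<omega> (lie_bracket A X Z) Y p - \<omega> (lie_bracket A Y Z) X p"

definition kaehler :: "('a, 'm::finite) chart set \<Rightarrow> ('a, 'm) metric \<Rightarrow> bool" where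
  "kaehler A g \<longleftrightarrow>
     (\<forall>X\<in>VF A. \<forall>Y\<in>VF A. \<forall>Z\<in>VF A. \<forall>p. ext_deriv2 A (fundamental_form g) X Y Z p = 0)"

section \<open>Hermitian connections, torsion and curvature\<close>

type_synonym ('a, 'm) connection = "('a, 'm) vfield \<Rightarrow> ('a, 'm) vfield \<Rightarrow> ('a, 'm) vfield"

definition affine_connection ::
  "('a, 'm::finite) chart set \<Rightarrow> ('a, 'm) connection \<Rightarrow> bool" where
  "affine_connection A nabla \<longleftrightarrow>
     (\<forall>X\<in>VF A. \<forall>Y\<in>VF A. nabla X Y \<in> VF A) \<and>
     (\<forall>X\<in>VF A. \<forall>X'\<in>VF A. \<forall>Y\<in>VF A. \<forall>p.
        nabla (\<lambda>q. X q + X' q) Y p = nabla X Y p + nabla X' Y p) \<and>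
     (\<forall>f X Y p. smooth_fun A f \<longrightarrow> X \<in> VF A \<longrightarrow> Y \<in> VF A \<longrightarrow>
        nabla (\<lambda>q. f q *\<^sub>R X q) Y p = f p *\<^sub>R nabla X Y p) \<and>
     (\<forall>X\<in>VF A. \<forall>Y\<in>VF A. \<forall>Y'\<in>VF A. \<forall>p.
        nabla X (\<lambda>q. Y q + Y' q) p = nabla X Y p + nabla X Y' p) \<and>
     (\<forall>f X Y p. smooth_fun A f \<longrightarrow> X \<in> VF A \<longrightarrow> Y \<in> VF A \<longrightarrow>
        nabla X (\<lambda>q. f q *\<^sub>R Y q) p = deriv_along A X f p *\<^sub>R Y p + f p *\<^sub>R nabla X Y p)"

definition hermitian_connection ::
  "('a, 'm::finite) chart set \<Rightarrow> ('a, 'm) metric \<Rightarrow> ('a, 'm) connection \<Rightarrow> bool" where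
  "hermitian_connection A g nabla \<longleftrightarrow>
     affine_connection A nabla \<and>
     (\<forall>X\<in>VF A. \<forall>Y\<in>VF A. \<forall>Z\<in>VF A. \<forall>p.
        deriv_along A X (\<lambda>q. g q (Y q) (Z q)) p
          = g p (nabla X Y p) (Z p) + g p (Y p) (nabla X Z p)) \<and>
     (\<forall>X\<in>VF A. \<forall>Y\<in>VF A. \<forall>p. nabla X (\<lambda>q. J (Y q)) p = J (nabla X Y p))"

definition torsion ::
  "('a, 'm::finite) chart set \<Rightarrow> ('a, 'm) connection \<Rightarrow> ('a, 'm) vfield \<Rightarrow> ('a, 'm) vfield \<Rightarrow>
   ('a, 'm) vfield" where
  "torsion A nabla X Y p = nabla X Y p - nabla Y X p - lie_bracket A X Y p"

definition parallel_torsion ::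
  "('a, 'm::finite) chart set \<Rightarrow> ('a, 'm) connection \<Rightarrow> bool" where
  "parallel_torsion A nabla \<longleftrightarrow>
     (\<forall>X\<in>VF A. \<forall>Y\<in>VF A. \<forall>Z\<in>VF A. \<forall>p.
        nabla X (torsion A nabla Y Z) p
          - torsion A nabla (nabla X Y) Z p - torsion A nabla Y (nabla X Z) p = 0)"

definition curvature ::
  "('a, 'm::finite) chart set \<Rightarrow> ('a, 'm) connection \<Rightarrow>
   ('a, 'm) vfield \<Rightarrow> ('a, 'm) vfield \<Rightarrow> ('a, 'm) vfield \<Rightarrow> ('a, 'm) vfield" where
  "curvature A nabla X Y Z p =
     nabla X (nabla Y Z) p - nabla Y (nabla X Z) p - nabla (lie_bracket A X Y) Z p"

text \<open>The curvature is a tensor: its value at \<open>p\<close> depends only on the values of the three fields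
  at \<open>p\<close>. Likewise \<open>nabla X Y p\<close> depends on \<open>X\<close> only through \<open>X p\<close>. This makes the following
  pointwise versions well defined.\<close>

definition curvature_at ::
  "('a, 'm::finite) chart set \<Rightarrow> ('a, 'm) connection \<Rightarrow> 'a \<Rightarrow>
   complex^'m \<Rightarrow> complex^'m \<Rightarrow> complex^'m \<Rightarrow> complex^'m" where
  "curvature_at A nabla p u v w =
     (THE z. \<forall>X\<in>VF A. \<forall>Y\<in>VF A. \<forall>Z\<in>VF A.
        X p = u \<longrightarrow> Y p = v \<longrightarrow> Z p = w \<longrightarrow> curvature A nabla X Y Z p = z)"

definition nabla_at ::
  "('a, 'm::finite) chart set \<Rightarrow> ('a, 'm) connection \<Rightarrow> 'a \<Rightarrow>
   complex^'m \<Rightarrow> ('a, 'm) vfield \<Rightarrow> complex^'m" where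
  "nabla_at A nabla p v Y = (THE z. \<forall>X\<in>VF A. X p = v \<longrightarrow> nabla X Y p = z)"

section \<open>The complexified tangent space and the Chern Ricci curvature\<close>

text \<open>The pair \<open>(u, v)\<close> stands for the element \<open>u + iv\<close> of the complexification of \<open>T\<^sub>pM\<close>. The
  complex scalar multiplication \<open>cscale\<close> is not to be confused with the almost complex structure.
  The complex linear extension of a real linear map \<open>L\<close> is \<open>map_prod L L\<close>.\<close>

type_synonym 'm ctangent = "(complex^'m) \<times> (complex^'m)"

definition cscale :: "complex \<Rightarrow> 'm::finite ctangent \<Rightarrow> 'm ctangent" where
  "cscale a z = (Re a *\<^sub>R fst z - Im a *\<^sub>R snd z, Re a *\<^sub>R snd z + Im a *\<^sub>R fst z)"

definition conjugate :: "'m::finite ctangent \<Rightarrow> 'm ctangent" where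
  "conjugate z = (fst z, - snd z)"

definition T10 :: "'m::finite ctangent set" where
  "T10 = {z. map_prod J J z = cscale \<i> z}"

text \<open>Complex bilinear extension of the metric.\<close>

definition metricC ::
  "('a, 'm::finite) metric \<Rightarrow> 'a \<Rightarrow> 'm ctangent \<Rightarrow> 'm ctangent \<Rightarrow> complex" where
  "metricC g p z w =
     Complex (g p (fst z) (fst w) - g p (snd z) (snd w)) (g p (fst z) (snd w) + g p (snd z) (fst w))"

definition unitary_frame ::
  "('a, 'm::finite) metric \<Rightarrow> 'a \<Rightarrow> ('m \<Rightarrow> 'm ctangent) \<Rightarrow> bool" where
  "unitary_frame g p e \<longleftrightarrow>
     (\<forall>i. e i \<in> T10) \<and> (\<forall>i j. metricC g p (e i) (conjugate (e j)) = (if i = j then 1 else 0))"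

text \<open>The sum does not depend on the unitary frame.\<close>

definition chern_ricci ::
  "('a, 'm::finite) chart set \<Rightarrow> ('a, 'm) metric \<Rightarrow> ('a, 'm) connection \<Rightarrow> 'a \<Rightarrow>
   complex^'m \<Rightarrow> complex^'m \<Rightarrow> complex" where
  "chern_ricci A g nabla p u v =
     (let e = (SOME e. unitary_frame g p e); R = curvature_at A nabla p u v
      in \<Sum>i\<in>UNIV. metricC g p (map_prod R R (e i)) (conjugate (e i)))"

section \<open>Parallel transport and holonomy\<close>

definition smooth_curve_on ::
  "('a::topological_space, 'm::finite) chart set \<Rightarrow> real set \<Rightarrow> (real \<Rightarrow> 'a) \<Rightarrow> bool" where
  "smooth_curve_on A I \<gamma> \<longleftrightarrow>
     continuous_on I \<gamma> \<and> (\<forall>c\<in>A. smooth_on (I \<inter> \<gamma> -` fst c) (snd c \<circ> \<gamma>))"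

text \<open>A smooth curve on a closed interval is the restriction of a smooth curve on an open set.\<close>

definition smooth_arc ::
  "('a::topological_space, 'm::finite) chart set \<Rightarrow> real \<Rightarrow> real \<Rightarrow> (real \<Rightarrow> 'a) \<Rightarrow> bool" where
  "smooth_arc A a b \<gamma> \<longleftrightarrow>
     (\<exists>I \<delta>. open I \<and> {a..b} \<subseteq> I \<and> smooth_curve_on A I \<delta> \<and> (\<forall>t\<in>{a..b}. \<gamma> t = \<delta> t))"

definition velocity ::
  "('a, 'm::finite) chart set \<Rightarrow> real set \<Rightarrow> (real \<Rightarrow> 'a) \<Rightarrow> real \<Rightarrow> complex^'m" where
  "velocity A I \<gamma> t = vector_derivative (snd (chart_at A (\<gamma> t)) \<circ> \<gamma>) (at t within I)"

text \<open>\<^term>\<open>has_cov_deriv A nabla I \<gamma> V W t\<close>: the field \<open>V\<close> along \<open>\<gamma>\<close> has covariant derivative \<open>W\<close>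
  at time \<open>t\<close> of the interval \<open>I\<close>. Near \<open>t\<close> the field \<open>V\<close> is expanded as a combination of
  restrictions of vector fields \<open>E i\<close> on \<open>M\<close>, and
  \<open>D/dt (\<Sum>i. f i \<cdot> E i) = (\<Sum>i. f i' \<cdot> E i + f i \<cdot> nabla\<^bsub>\<gamma>'\<^esub> (E i))\<close>.
  The result does not depend on the expansion.\<close>

definition has_cov_deriv ::
  "('a, 'm::finite) chart set \<Rightarrow> ('a, 'm) connection \<Rightarrow> real set \<Rightarrow> (real \<Rightarrow> 'a) \<Rightarrow>
   (real \<Rightarrow> complex^'m) \<Rightarrow> complex^'m \<Rightarrow> real \<Rightarrow> bool" where
  "has_cov_deriv A nabla I \<gamma> V W t \<longleftrightarrow>
     (\<exists>(k::nat) E f f' N.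
        (\<forall>i<k. E i \<in> VF A) \<and>
        open N \<and> t \<in> N \<and> (\<forall>s\<in>N \<inter> I. V s = (\<Sum>i<k. f i s *\<^sub>R E i (\<gamma> s))) \<and>
        (\<forall>i<k. (f i has_real_derivative f' i) (at t within I)) \<and>
        W = (\<Sum>i<k. f' i *\<^sub>R E i (\<gamma> t)
                     + f i t *\<^sub>R nabla_at A nabla (\<gamma> t) (velocity A I \<gamma> t) (E i)))"

definition parallel_on ::
  "('a, 'm::finite) chart set \<Rightarrow> ('a, 'm) connection \<Rightarrow> real set \<Rightarrow> (real \<Rightarrow> 'a) \<Rightarrow>
   (real \<Rightarrow> complex^'m) \<Rightarrow> bool" where
  "parallel_on A nabla I \<gamma> V \<longleftrightarrow> (\<forall>t\<in>I. has_cov_deriv A nabla I \<gamma> V 0 t)"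

text \<open>\<open>P\<close> is the parallel transport from \<open>\<gamma> 0\<close> to \<open>\<gamma> 1\<close> along the piecewise smooth curve \<open>\<gamma>\<close>
  on the unit interval.\<close>

definition parallel_transport ::
  "('a::topological_space, 'm::finite) chart set \<Rightarrow> ('a, 'm) connection \<Rightarrow> (real \<Rightarrow> 'a) \<Rightarrow>
   (complex^'m \<Rightarrow> complex^'m) \<Rightarrow> bool" where
  "parallel_transport A nabla \<gamma> P \<longleftrightarrow>
     (\<exists>n (\<tau>::nat \<Rightarrow> real). \<tau> 0 = 0 \<and> \<tau> n = 1 \<and>
        (\<forall>k<n. \<tau> k < \<tau> (Suc k) \<and> smooth_arc A (\<tau> k) (\<tau> (Suc k)) \<gamma>) \<and>
        (\<forall>u. \<exists>V. V 0 = u \<and> V 1 = P u \<and>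
           (\<forall>k<n. parallel_on A nabla {\<tau> k..\<tau> (Suc k)} \<gamma> V)))"

definition restricted_holonomy ::
  "('a::topological_space, 'm::finite) chart set \<Rightarrow> ('a, 'm) connection \<Rightarrow> 'a \<Rightarrow>
   (complex^'m \<Rightarrow> complex^'m) set" where
  "restricted_holonomy A nabla p =
     {P. \<exists>\<gamma>. pathstart \<gamma> = p \<and> pathfinish \<gamma> = p \<and> homotopic_paths UNIV \<gamma> (\<lambda>_. p) \<and>
             parallel_transport A nabla \<gamma> P}"

definition complex_subspace :: "'m::finite ctangent set \<Rightarrow> bool" where
  "complex_subspace W \<longleftrightarrow>
     0 \<in> W \<and> (\<forall>z\<in>W. \<forall>w\<in>W. z + w \<in> W) \<and> (\<forall>a. \<forall>z\<in>W. cscale a z \<in> W)"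

definition irreducible_on_T10 :: "(complex^'m::finite \<Rightarrow> complex^'m) set \<Rightarrow> bool" where
  "irreducible_on_T10 G \<longleftrightarrow>
     (\<forall>W. complex_subspace W \<and> W \<subseteq> T10 \<and> (\<forall>P\<in>G. map_prod P P ` W \<subseteq> W) \<longrightarrow>
        W = {0} \<or> W = T10)"

end

(* Let k_q be the space of skew-Hermitian endomorphisms of the tangent space at q that act on
   the torsion T_q by derivations as zero. As T is parallel, k_q contains all curvature operators,
   and parallel transport identifies the spaces k_q for different q. Suppose that some
   curvature operator has nonzero trace, and let Z be the orthogonal projection of J to k_p. Then
   Z is nonzero, and it commutes with the holonomy group at p, because this group preserves the
   inner product on endomorphisms, J and k_p. By Schur's lemma Z is a real multiple of J, so J lies
   in k_p. But T(Ju,v) + T(u,Jv) = J T(u,v) for all u, v forces T = 0, and a torsion free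
   Hermitian connection makes the fundamental form closed. *)

theory Submission
  imports Defs "HOL-Computational_Algebra.Polynomial"
begin

text \<open>The projection is nonzero because the real inner product of J with a skew-Hermitian B is
  Im tr B, so an operator in k_p with nonzero trace keeps J from being orthogonal to k_p. A
  projection is taken because J itself is not known to lie in k_p; what irreducibility can use is an
  element of k_p that commutes with the holonomy. The point q at which the Ricci curvature is
  nonzero may differ from the point p at which the holonomy is considered. Both tangent spaces are
  identified with C^m by unitary frames related by a transport from q to p, so that the argument
  concerns a single bilinear map on C^m. The transport has to be shown to exist; short coordinate
  segments suffice, since M is connected. A field along a curve is a non-unique combination of
  vector fields on M, and T is given as an operation on vector fields. Parallelism is therefore
  tested against families of covectors: the metric, J and T can be absorbed into the covectors,
  where their parallelism on vector fields applies.\<close>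

section \<open>Irreducible unitary groups and invariant bilinear maps\<close>

text \<open>The quadratic form attains its maximum \<open>c\<close> on the unit sphere at some
  \<open>z0\<close>. Then c<z,z> - <Sz,z> is a nonnegative form that vanishes at \<open>z0\<close>,
  and this puts \<open>z0\<close> into its kernel.\<close>

lemma selfadjoint_has_eigenvector:
  fixes S :: "'a::euclidean_space \<Rightarrow> 'a"
  assumes lin: "linear S" and sa: "\<And>z w. inner (S z) w = inner z (S w)"
  obtains c z where "z \<noteq> 0" "S z = c *\<^sub>R z"
proof -
  obtain e :: 'a where e: "norm e = 1" using vector_choose_size[of 1] by auto
  have "continuous_on (sphere 0 1) (\<lambda>z. inner (S z) z)"
    using lin by (intro continuous_intros linear_continuous_on) (simp add: linear_conv_bounded_linear)
  moreover have "sphere (0::'a) 1 \<noteq> {}" using e by (auto simp: dist_norm)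
  ultimately obtain z0 where z0: "norm z0 = 1" and max: "\<And>z. norm z = 1 \<Longrightarrow> inner (S z) z \<le> inner (S z0) z0"
    using continuous_attains_sup[OF compact_sphere, of "0::'a" 1 "\<lambda>z. inner (S z) z"]
    by (auto simp: dist_norm)
  define c where "c = inner (S z0) z0"
  have le: "inner (S z) z \<le> c * inner z z" for z
  proof (cases "z = 0")
    case False
    have "inner (S (sgn z)) (sgn z) \<le> c" using max[of "sgn z"] False by (simp add: c_def norm_sgn)
    then have "inner (S z) z / (norm z * norm z) \<le> c"
      by (simp add: sgn_div_norm linear_scale[OF lin] divide_simps)
    then show ?thesis using False
      by (simp add: pos_divide_le_eq power2_norm_eq_inner[symmetric] power2_eq_square)
  qed (simp add: linear_0[OF lin])
  \<comment> \<open>\<open>w\<close> is the residual at \<open>z0\<close>, and \<open>F\<close> is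
    the nonnegative form at \<open>w\<close>. On the line \<open>z0 + t *\<^sub>R w\<close> the form
    is t^2 F + 2t<w,w>, without constant term; a polynomial of this kind that is nonnegative for all
    t has no linear term.\<close>
  define w where "w = c *\<^sub>R z0 - S z0"
  define F where "F = c * inner w w - inner (S w) w"
  have F: "F \<ge> 0" using le[of w] by (simp add: F_def)
  have quad: "0 \<le> t * t * F + 2 * t * inner w w" for t
  proof -
    have a1: "inner (S (z0 + t *\<^sub>R w)) (z0 + t *\<^sub>R w) \<le> c * inner (z0 + t *\<^sub>R w) (z0 + t *\<^sub>R w)" by (rule le)
    have a2: "inner (S (z0 + t *\<^sub>R w)) (z0 + t *\<^sub>R w) = c + 2 * t * inner (S z0) w + t * t * inner (S w) w"
      using sa[of w z0] by (simp add: linear_add[OF lin] linear_scale[OF lin] inner_add_left inner_add_right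
          c_def inner_commute algebra_simps)
    have a3: "inner (z0 + t *\<^sub>R w) (z0 + t *\<^sub>R w) = 1 + 2 * t * inner z0 w + t * t * inner w w"
    proof -
      have "inner z0 z0 = 1" using z0 by (simp add: norm_eq_1)
      then show ?thesis
        by (simp add: inner_add_left inner_add_right inner_commute[of w z0] algebra_simps)
    qed
    have a4: "inner w w = c * inner z0 w - inner (S z0) w"
      by (subst w_def) (simp add: inner_diff_left)
    have "2 * t * inner w w = 2 * t * (c * inner z0 w - inner (S z0) w)" by (simp only: a4)
    with a1[unfolded a2 a3] show ?thesis by (simp add: F_def algebra_simps)
  qed
  have "inner w w = 0"
  proof (cases "F = 0")
    case True
    with quad[of "-1"] have "inner w w \<le> 0" by simp
    then show ?thesis using inner_ge_zero[of w] by linarith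
  next
    case False
    with F have "F > 0" by simp
    \<comment> \<open>This t is the minimum point of the parabola.\<close>
    with quad[of "- inner w w / F"] have "inner w w * inner w w \<le> 0"
      by (simp add: field_simps)
    then show ?thesis by (metis mult_nonneg_nonneg inner_ge_zero antisym mult_eq_0_iff)
  qed
  then have "S z0 = c *\<^sub>R z0" by (simp add: w_def)
  moreover have "z0 \<noteq> 0" using z0 by auto
  ultimately show thesis using that by blast
qed

section \<open>Adjoint matrices and the real inner product on complex matrices\<close>

definition adj :: "complex^'n^'m \<Rightarrow> complex^'m^'n" where
  "adj A = (\<chi> i j. cnj (A $ j $ i))"

lemma adj_adj [simp]: "adj (adj A) = A"
  by (simp add: adj_def vec_eq_iff)

lemma adj_mult: "adj (A ** B) = adj B ** adj A"
  by (simp add: adj_def matrix_matrix_mult_def vec_eq_iff mult.commute)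

lemma inner_cnj: "inner (cnj a) (cnj b) = inner a b"
  by (simp add: inner_complex_def)

lemma inner_adj: "inner (adj A) (adj B) = inner A B"
  by (simp add: inner_vec_def adj_def inner_cnj) (rule sum.swap)

lemma inner_mult_cnj: "inner (a * b) c = inner b (cnj a * c)" for a b c :: complex
  by (simp add: inner_complex_def algebra_simps)

lemma inner_matrix_vector_adj: "inner (A *v x) y = inner x (adj A *v y)"
proof -
  have "inner (A *v x) y = (\<Sum>i\<in>UNIV. \<Sum>j\<in>UNIV. inner (A $ i $ j * x $ j) (y $ i))"
    by (simp add: inner_vec_def matrix_vector_mult_def inner_sum_left)
  also have "\<dots> = (\<Sum>i\<in>UNIV. \<Sum>j\<in>UNIV. inner (x $ j) (cnj (A $ i $ j) * y $ i))"
    by (simp only: inner_mult_cnj)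
  also have "\<dots> = (\<Sum>j\<in>UNIV. \<Sum>i\<in>UNIV. inner (x $ j) (cnj (A $ i $ j) * y $ i))"
    by (rule sum.swap)
  also have "\<dots> = inner x (adj A *v y)"
    by (simp add: inner_vec_def matrix_vector_mult_def inner_sum_right adj_def)
  finally show ?thesis .
qed

lemma inner_columns: "inner A B = (\<Sum>j\<in>UNIV. inner (column j A) (column j B))"
  by (simp add: inner_vec_def column_def) (rule sum.swap)

lemma column_matrix_mult: "column j (A ** B) = A *v column j B"
  by (simp add: vec_eq_iff column_def matrix_matrix_mult_def matrix_vector_mult_def)

text \<open>On matrices \<open>inner\<close> is the real part of the trace form, the sum of the
  inner products of the columns, and \<open>M\<close> acts on each column separately. With the
  companion for right factors this moves a unitary conjugation from one side of the inner product to
  the other.\<close>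

lemma inner_matrix_mult_left_adj: "inner (M ** A) B = inner A (adj M ** B)"
  by (simp add: inner_columns column_matrix_mult inner_matrix_vector_adj)

lemma inner_matrix_mult_right_adj: "inner (A ** M) B = inner A (B ** adj M)"
proof -
  have "inner (A ** M) B = inner (adj M ** adj A) (adj B)"
    by (simp add: adj_mult[symmetric] inner_adj)
  also have "\<dots> = inner (adj A) (adj (B ** adj M))"
    by (simp add: inner_matrix_mult_left_adj adj_mult)
  finally show ?thesis by (simp add: inner_adj)
qed

lemma inner_vector_scalar: "inner (a *s z) w = inner z (cnj a *s w)" for z :: "complex^'m"
  by (simp only: inner_vec_def vector_smult_component inner_mult_cnj)

lemma scaleR_eq_vector_scalar: "r *\<^sub>R z = complex_of_real r *s z" for z :: "complex^'m"
  by (simp add: vec_eq_iff complex_eq_iff)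

lemma adj_unique:
  assumes "\<And>z w. inner (A *v z) w = inner z (B *v w)"
  shows "adj A = B"
proof -
  have "inner z (adj A *v w) = inner z (B *v w)" for z w
    using assms by (simp add: inner_matrix_vector_adj)
  then have "adj A *v w = B *v w" for w by (metis vector_eq_ldot)
  then show ?thesis by (simp add: matrix_eq)
qed

text \<open>Multiplication by -i makes the matrix self-adjoint; a real eigenvalue \<open>c\<close>
  of the product is an eigenvalue ic of \<open>Z\<close>.\<close>

lemma skew_has_eigenvector:
  fixes Z :: "complex^'m^'m"
  assumes "adj Z = - Z"
  obtains c z where "z \<noteq> 0" "Z *v z = (\<i> * complex_of_real c) *s z"
proof -
  define S where "S z = (- \<i>) *s (Z *v z)" for z
  have "linear S"
    by (rule linearI) (simp_all add: S_def matrix_vector_right_distrib vector_add_ldistrib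
        scaleR_eq_vector_scalar vector_scalar_commute mult.commute)
  moreover have "inner (S z) w = inner z (S w)" for z w
    unfolding S_def inner_vector_scalar inner_matrix_vector_adj assms
    by (simp add: vec_eq_iff matrix_vector_mult_def sum_negf inner_vec_def vector_scalar_commute sum_distrib_left algebra_simps)
  ultimately obtain c z where "z \<noteq> 0" "S z = c *\<^sub>R z"
    using selfadjoint_has_eigenvector by blast
  then have "\<i> *s S z = (\<i> * complex_of_real c) *s z" by (simp add: scaleR_eq_vector_scalar)
  then have "Z *v z = (\<i> * complex_of_real c) *s z" by (simp add: S_def)
  with \<open>z \<noteq> 0\<close> that show thesis by blast
qed

text \<open>The assumption is infinitesimal equivariance under the scalars of modulus one, which act with
  weight \<open>1\<close> on the values of \<open>\<tau>\<close> but only with weights \<open>2\<close>, \<open>0\<close>, \<open>-2\<close> on pairs of arguments.\<close>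

lemma bilinear_zero_if_i_derivation:
  fixes \<tau> :: "complex^'m \<Rightarrow> complex^'m \<Rightarrow> complex^'m"
  assumes bil: "bilinear \<tau>" and i: "\<And>z w. \<i> *s \<tau> z w = \<tau> (\<i> *s z) w + \<tau> z (\<i> *s w)"
  shows "\<tau> z w = 0"
proof -
  have ii: "\<i> *s (\<i> *s v) = - v" for v :: "complex^'m" by (simp add: vec_eq_iff)
  have neg: "\<tau> (- z) w = - \<tau> z w" "\<tau> z (- w) = - \<tau> z w" for z w
    using bilinear_lneg[OF bil] bilinear_rneg[OF bil] by auto
  \<comment> \<open>The hypothesis at (iz, w) and at (z, iw) has the same right-hand side in both
    cases, namely \<tau>(iz, iw) - \<tau>(z, w).\<close>
  have "\<i> *s \<tau> (\<i> *s z) w = \<i> *s \<tau> z (\<i> *s w)" for z w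
    using i[of "\<i> *s z" w] i[of z "\<i> *s w"] unfolding ii neg by simp
  then have eq: "\<tau> (\<i> *s z) w = \<tau> z (\<i> *s w)" for z w
    by (metis ii neg_equal_iff_equal)
  have half: "\<i> *s \<tau> z w = 2 *s \<tau> (\<i> *s z) w" for z w
    using i[of z w] eq[of z w] by (simp add: vec_eq_iff)
  \<comment> \<open>Applying \<open>half\<close> twice turns -\<tau>(z, w) into -4\<tau>(z,
    w).\<close>
  have "\<i> *s (\<i> *s \<tau> z w) = 2 *s (\<i> *s \<tau> (\<i> *s z) w)"
    by (subst half) simp
  also have "\<dots> = 2 *s (2 *s \<tau> (\<i> *s (\<i> *s z)) w)" by (subst half) simp
  finally have "- \<tau> z w = - (4 *s \<tau> z w)" unfolding ii neg by (simp add: vec_eq_iff)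
  then show ?thesis by (simp add: vec_eq_iff)
qed

text \<open>The linear algebra of the whole argument, in coordinates: \<open>\<tau>\<close> stands
  for the torsion, \<open>G\<close> for the holonomy group and \<open>b\<close> for a curvature
  operator. The sum in the last hypothesis is the pairing of \<open>b\<close> with multiplication by
  i, that is, the imaginary part of its trace.\<close>

theorem irreducible_unitary_invariant_bilinear_zero:
  fixes \<tau> :: "complex^'m \<Rightarrow> complex^'m \<Rightarrow> complex^'m" and G :: "(complex^'m \<Rightarrow> complex^'m) set"
    and b :: "complex^'m \<Rightarrow> complex^'m"
  assumes bil: "bilinear \<tau>"
    and Glin: "\<And>Q. Q \<in> G \<Longrightarrow> Vector_Spaces.linear (*s) (*s) Q"
    and Giso: "\<And>Q z w. Q \<in> G \<Longrightarrow> inner (Q z) (Q w) = inner z w"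
    and G\<tau>: "\<And>Q z w. Q \<in> G \<Longrightarrow> Q (\<tau> z w) = \<tau> (Q z) (Q w)"
    and irr: "\<And>W. vec.subspace W \<Longrightarrow> (\<And>Q. Q \<in> G \<Longrightarrow> Q ` W \<subseteq> W) \<Longrightarrow> W = {0} \<or> W = UNIV"
    and blin: "Vector_Spaces.linear (*s) (*s) b"
    and bskew: "\<And>z w. inner (b z) w = - inner z (b w)"
    and b\<tau>: "\<And>z w. b (\<tau> z w) = \<tau> (b z) w + \<tau> z (b w)"
    and tr: "(\<Sum>j\<in>UNIV. inner (b (axis j 1)) (\<i> *s axis j 1)) \<noteq> 0"
  shows "\<tau> z w = 0"
proof -
  \<comment> \<open>\<open>K\<close> is only a real vector space, since i times a skew-Hermitian
    matrix is Hermitian. This is why the inner product and the projection below are the real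
    ones.\<close>
  define K where "K = {B. adj B = - B \<and> (\<forall>z w. B *v \<tau> z w = \<tau> (B *v z) w + \<tau> z (B *v w))}"
  have sub: "subspace K"
  proof (rule subspaceI)
    show "0 \<in> K"
      by (simp add: K_def adj_def vec_eq_iff bilinear_lzero[OF bil] bilinear_rzero[OF bil])
    show "C + D \<in> K" if "C \<in> K" "D \<in> K" for C D
    proof -
      have "adj (C + D) = adj C + adj D" by (simp add: adj_def vec_eq_iff)
      with that show ?thesis
        by (simp add: K_def matrix_vector_mult_add_rdistrib bilinear_ladd[OF bil] bilinear_radd[OF bil])
    qed
    show "r *\<^sub>R C \<in> K" if "C \<in> K" for r C
    proof -
      have "adj (r *\<^sub>R C) = r *\<^sub>R adj C" by (simp add: adj_def vec_eq_iff)
      moreover have "(r *\<^sub>R C) *v x = r *\<^sub>R (C *v x)" for x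
        by (simp add: vec_eq_iff matrix_vector_mult_def scaleR_sum_right)
      ultimately show ?thesis using that
        by (simp add: K_def scaleR_matrix_vector_assoc[symmetric] bilinear_lmul[OF bil] bilinear_rmul[OF bil] scaleR_add_right)
    qed
  qed
  \<comment> \<open>\<open>mat \<i>\<close> is J. Its projection \<open>Z\<close> enters only as an
    element of \<open>K\<close> that has the same inner product as J with every element of
    \<open>K\<close>.\<close>
  obtain Z N where ZN: "Z \<in> span K" "\<And>B. B \<in> span K \<Longrightarrow> orthogonal N B" "mat \<i> = Z + N"
    using orthogonal_subspace_decomp_exists[of K "mat \<i> :: complex^'m^'m"] by metis
  have spK: "span K = K" using sub by (simp add: span_eq_iff)
  have ZK: "Z \<in> K" and orth: "\<And>B. B \<in> K \<Longrightarrow> inner (mat \<i>) B = inner Z B"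
    using ZN unfolding spK by (auto simp: orthogonal_def inner_add_left)
  have Zskew: "adj Z = - Z" using ZK by (simp add: K_def)

  define B where "B = matrix b"
  have Bv: "B *v z = b z" for z by (simp add: B_def matrix_works[OF blin])
  have "adj B = - B"
  proof (rule adj_unique)
    have "(- B) *v w = - (B *v w)" for w
      by (simp add: vec_eq_iff matrix_vector_mult_def sum_negf)
    then show "inner (B *v z) w = inner z ((- B) *v w)" for z w
      by (simp add: Bv bskew)
  qed
  then have BK: "B \<in> K" by (simp add: K_def Bv b\<tau>)
  have "column j (mat \<i> :: complex^'m^'m) = \<i> *s axis j 1" for j
    by (simp add: column_def mat_def axis_def vec_eq_iff)
  moreover have "column j B = b (axis j 1)" for j
    by (simp add: Bv[symmetric] vec_eq_iff column_def matrix_vector_mult_def axis_def if_distrib[of "\<lambda>x. _ * x"] cong: if_cong)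
  ultimately have "inner (mat \<i>) B \<noteq> 0"
    using tr by (simp add: inner_columns inner_commute)
  then have Z0: "Z \<noteq> 0" using orth[OF BK] by auto

  \<comment> \<open>Formulated for a mutually adjoint pair, so that it applies to conjugation by a
    group element and by its inverse alike.\<close>
  have conj: "X ** C ** Y \<in> K"
    if "adj X = Y" "adj Y = X" "X ** Y = mat 1"
      and X: "\<And>z w. X *v \<tau> z w = \<tau> (X *v z) (X *v w)" and Y: "\<And>z w. Y *v \<tau> z w = \<tau> (Y *v z) (Y *v w)"
      and C: "C \<in> K" for X Y C
  proof -
    have "adj (X ** C ** Y) = X ** (- C) ** Y"
      using that by (simp add: adj_mult matrix_mul_assoc K_def)
    moreover have "X ** (- C) ** Y = - (X ** C ** Y)"
      by (simp add: vec_eq_iff matrix_matrix_mult_def sum_negf)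
    moreover have "(X ** C ** Y) *v \<tau> z w = \<tau> ((X ** C ** Y) *v z) w + \<tau> z ((X ** C ** Y) *v w)" for z w
    proof -
      have "X *v (Y *v z) = z" for z by (simp add: matrix_vector_mul_assoc \<open>X ** Y = mat 1\<close>)
      moreover have "C *v \<tau> (Y *v z) (Y *v w) = \<tau> (C *v (Y *v z)) (Y *v w) + \<tau> (Y *v z) (C *v (Y *v w))"
        using C by (simp add: K_def)
      ultimately show ?thesis
        by (simp only: matrix_vector_mul_assoc[symmetric] Y X matrix_vector_right_distrib)
    qed
    ultimately show ?thesis by (simp add: K_def)
  qed

  have comm: "M ** Z = Z ** M" if "Q \<in> G" and M: "M = matrix Q" for Q M
  proof -
    have Mv: "M *v z = Q z" for z by (simp add: M matrix_works[OF Glin[OF \<open>Q \<in> G\<close>]])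
    have "inner z ((adj M ** M) *v w) = inner z w" for z w
      using inner_matrix_vector_adj[of M z "M *v w"]
      unfolding matrix_vector_mul_assoc[symmetric] Mv Giso[OF \<open>Q \<in> G\<close>] by simp
    then have u1: "adj M ** M = mat 1"
      by (metis matrix_eq matrix_vector_mul_lid vector_eq_ldot)
    then have u2: "M ** adj M = mat 1" using matrix_left_right_inverse by blast
    have M': "adj M *v \<tau> z w = \<tau> (adj M *v z) (adj M *v w)" for z w
    proof -
      have "M *v \<tau> (adj M *v z) (adj M *v w) = \<tau> z w"
        by (simp add: Mv G\<tau>[OF \<open>Q \<in> G\<close>]) (simp add: Mv[symmetric] matrix_vector_mul_assoc u2)
      then show ?thesis by (metis matrix_vector_mul_assoc matrix_vector_mul_lid u1)
    qed
    have M\<tau>: "M *v \<tau> z w = \<tau> (M *v z) (M *v w)" for z w by (simp add: Mv G\<tau>[OF \<open>Q \<in> G\<close>])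
    have conjK: "adj M ** C ** M \<in> K" and conjK': "M ** C ** adj M \<in> K" if "C \<in> K" for C
      using conj[of "adj M" M, OF _ _ u1 M' M\<tau> that] conj[of M "adj M", OF _ _ u2 M\<tau> M' that] by simp_all
    let ?Z = "M ** Z ** adj M"
    \<comment> \<open>The conjugation is moved to \<open>C\<close>, which stays in \<open>K\<close>;
      there \<open>Z\<close> may be exchanged for \<open>mat \<i>\<close>, which is fixed by
      conjugation because it commutes with every complex matrix.\<close>
    have "inner (Z - ?Z) C = 0" if "C \<in> K" for C
    proof -
      have "inner ?Z C = inner Z (adj M ** C ** M)"
        by (subst inner_matrix_mult_right_adj, subst inner_matrix_mult_left_adj) (simp add: matrix_mul_assoc)
      also have "\<dots> = inner (mat \<i>) (adj M ** C ** M)" by (rule orth[OF conjK[OF that], symmetric])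
      also have "\<dots> = inner (M ** mat \<i> ** adj M) C"
        by (subst inner_matrix_mult_right_adj, subst inner_matrix_mult_left_adj) (simp add: matrix_mul_assoc)
      also have "M ** mat \<i> ** adj M = mat \<i> ** (M ** adj M)"
      proof -
        have "M ** mat \<i> = mat \<i> ** M"
          by (simp add: vec_eq_iff matrix_matrix_mult_def mat_def if_distrib if_distribR cong: if_cong)
        then show ?thesis by (simp add: matrix_mul_assoc)
      qed
      also have "\<dots> = mat \<i>" by (simp add: u2)
      also have "inner (mat \<i>) C = inner Z C" by (rule orth[OF that])
      finally show ?thesis by (simp add: inner_diff_left)
    qed
    \<comment> \<open>The difference lies in \<open>K\<close> and is orthogonal to \<open>K\<close>,
      hence to itself.\<close>
    from this[of "Z - ?Z"] have "Z = ?Z"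
      using subspace_diff[OF sub ZK conjK'[OF ZK]] by simp
    then have "Z ** M = M ** Z ** (adj M ** M)" by (metis matrix_mul_assoc)
    then show ?thesis by (simp add: u1)
  qed

  \<comment> \<open>Schur's lemma: the eigenspace \<open>W\<close> is a nonzero complex subspace
    that is invariant under all that commutes with \<open>Z\<close>, so it is everything.\<close>
  obtain c z0 where z0: "z0 \<noteq> 0" "Z *v z0 = (\<i> * complex_of_real c) *s z0"
    using skew_has_eigenvector[OF Zskew] by blast
  define W where "W = {z. Z *v z = (\<i> * complex_of_real c) *s z}"
  have "vec.subspace W"
    unfolding W_def by (rule vec.subspaceI)
      (auto simp: matrix_vector_right_distrib vector_add_ldistrib vector_scalar_commute mult.commute)
  moreover have "Q ` W \<subseteq> W" if "Q \<in> G" for Q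
  proof
    fix y assume "y \<in> Q ` W"
    then obtain z where z: "y = Q z" "Z *v z = (\<i> * complex_of_real c) *s z" by (auto simp: W_def)
    have Mv: "matrix Q *v z = Q z" for z by (simp add: matrix_works[OF Glin[OF that]])
    have "Z *v y = Z *v (matrix Q *v z)" by (simp only: z(1) Mv)
    also have "\<dots> = matrix Q *v (Z *v z)"
      by (simp only: matrix_vector_mul_assoc comm[OF that refl])
    also have "\<dots> = (\<i> * complex_of_real c) *s y"
      by (simp only: z vector_scalar_commute Mv)
    finally show "y \<in> W" by (simp add: W_def)
  qed
  ultimately have "W = UNIV" using irr[of W] z0 by (auto simp: W_def)
  then have Zc: "Z *v z = (\<i> * complex_of_real c) *s z" for z by (auto simp: W_def)
  have "c \<noteq> 0"
  proof
    assume "c = 0"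
    then have "Z *v z = 0 *v z" for z by (simp add: Zc)
    then have "Z = 0" by (simp add: matrix_eq)
    with Z0 show False by simp
  qed
  \<comment> \<open>As \<open>\<tau>\<close> is only real bilinear, ic is split into the real factor
    \<open>c\<close>, which can be pulled out and cancelled, and i, which has to stay
    inside.\<close>
  have "(\<i> * complex_of_real c) *s \<tau> z w = \<tau> ((\<i> * complex_of_real c) *s z) w + \<tau> z ((\<i> * complex_of_real c) *s w)" for z w
    using ZK by (auto simp: K_def Zc)
  moreover have "(\<i> * complex_of_real c) *s z = c *\<^sub>R (\<i> *s z)" for z :: "complex^'m"
    by (simp add: scaleR_eq_vector_scalar mult.commute)
  ultimately have "c *\<^sub>R (\<i> *s \<tau> z w) = c *\<^sub>R (\<tau> (\<i> *s z) w + \<tau> z (\<i> *s w))" for z w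
    by (simp add: bilinear_lmul[OF bil] bilinear_rmul[OF bil] scaleR_add_right)
  then have "\<i> *s \<tau> z w = \<tau> (\<i> *s z) w + \<tau> z (\<i> *s w)" for z w
    using \<open>c \<noteq> 0\<close> by simp
  then show ?thesis by (rule bilinear_zero_if_i_derivation[OF bil])
qed

section \<open>Calculus of smooth maps\<close>

lemma frechet_derivative_cong_open:
  assumes "f differentiable at x" "open S" "x \<in> S" "\<And>y. y \<in> S \<Longrightarrow> f y = g y"
  shows "frechet_derivative f (at x) = frechet_derivative g (at x)"
  by (rule frechet_derivative_at, rule has_derivative_transform_within_open[where f = f, OF _ assms(2,3,4)])
    (use assms(1) frechet_derivative_works in auto)

lemma Ck_on_cong:
  "open S \<Longrightarrow> Ck_on k S f \<Longrightarrow> (\<And>x. x \<in> S \<Longrightarrow> f x = g x) \<Longrightarrow> Ck_on k S g"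
proof (induction k arbitrary: f g)
  case 0
  then show ?case using continuous_on_cong by (metis Ck_on.simps(1))
next
  case (Suc k)
  have df: "f differentiable at x" if "x \<in> S" for x
    using Suc.prems(2) that by simp
  have "g differentiable at x" if "x \<in> S" for x
    using df[OF that] Suc.prems(1,3) that
    by (metis differentiable_def has_derivative_transform_within_open)
  moreover have "Ck_on k S (\<lambda>x. frechet_derivative g (at x) v)" for v
    by (rule Suc.IH[OF Suc.prems(1), where f = "\<lambda>x. frechet_derivative f (at x) v"])
      (use Suc.prems df frechet_derivative_cong_open[OF df Suc.prems(1)] in auto)
  ultimately show ?case by auto
qed

text \<open>The definition speaks of \<open>frechet_derivative\<close>; by uniqueness of derivatives
  any explicit derivative on the open set may take its place. The closure properties below all
  follow this pattern.\<close>

lemma Ck_on_SucI: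
  assumes "open S" "\<And>x. x \<in> S \<Longrightarrow> (f has_derivative f' x) (at x)" "\<And>v. Ck_on k S (\<lambda>x. f' x v)"
  shows "Ck_on (Suc k) S f"
proof -
  have eq: "f' x = frechet_derivative f (at x)" if "x \<in> S" for x
    using assms(2)[OF that] by (rule frechet_derivative_at)
  have "Ck_on k S (\<lambda>x. frechet_derivative f (at x) v)" for v
    by (rule Ck_on_cong[OF assms(1) assms(3)[of v]]) (simp add: eq)
  then show ?thesis
    using assms(2) by (auto simp: differentiable_def)
qed

lemma Ck_on_SucD:
  assumes "Ck_on (Suc k) S f" "x \<in> S"
  shows "(f has_derivative frechet_derivative f (at x)) (at x)"
  using assms by (auto simp: frechet_derivative_works[symmetric])

lemma Ck_on_Suc_imp: "Ck_on (Suc k) S f \<Longrightarrow> Ck_on k S f"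
proof (induction k arbitrary: f)
  case 0
  then show ?case
    by (auto intro!: differentiable_imp_continuous_on simp: differentiable_on_def differentiable_at_withinI)
qed auto

lemma Ck_on_subset: "Ck_on k S f \<Longrightarrow> T \<subseteq> S \<Longrightarrow> Ck_on k T f"
  by (induction k arbitrary: f) (auto intro: continuous_on_subset)

lemma Ck_on_local:
  assumes "\<And>x. x \<in> S \<Longrightarrow> \<exists>U. open U \<and> x \<in> U \<and> Ck_on k U f"
  shows "Ck_on k S f"
  using assms
proof (induction k arbitrary: f)
  case 0
  show ?case
  proof (unfold Ck_on.simps, rule continuous_at_imp_continuous_on, rule ballI)
    fix x assume "x \<in> S"
    with 0 obtain U where "open U" "x \<in> U" "continuous_on U f" by auto
    then show "isCont f x" using continuous_on_eq_continuous_at by blast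
  qed
next
  case (Suc k)
  have "Ck_on k S (\<lambda>x. frechet_derivative f (at x) v)" for v
    by (rule Suc.IH) (use Suc.prems in fastforce)
  moreover have "f differentiable at x" if "x \<in> S" for x
    using Suc.prems[OF that] by auto
  ultimately show ?case by auto
qed

lemma Ck_on_const: "open S \<Longrightarrow> Ck_on k S (\<lambda>x. c)"
proof (induction k arbitrary: c)
  case (Suc k)
  show ?case
    by (rule Ck_on_SucI[where f' = "\<lambda>x v. 0"]) (use Suc in auto)
qed auto

lemma Ck_on_linear:
  assumes "bounded_linear L" "open S" shows "Ck_on k S L"
proof (cases k)
  case 0
  then show ?thesis using assms by (simp add: linear_continuous_on)
next
  case (Suc n)
  show ?thesis unfolding Suc
    by (rule Ck_on_SucI[where f' = "\<lambda>x. L"])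
      (use assms bounded_linear_imp_has_derivative Ck_on_const in auto)
qed

lemma Ck_on_add:
  "open S \<Longrightarrow> Ck_on k S f \<Longrightarrow> Ck_on k S g \<Longrightarrow> Ck_on k S (\<lambda>x. f x + g x)"
proof (induction k arbitrary: f g)
  case 0
  then show ?case by (auto intro: continuous_intros)
next
  case (Suc k)
  show ?case
    by (rule Ck_on_SucI[where f' = "\<lambda>x v. frechet_derivative f (at x) v + frechet_derivative g (at x) v"])
      (use Suc in \<open>auto intro!: has_derivative_add Ck_on_SucD\<close>)
qed

lemma Ck_on_sum:
  assumes "open S" "\<And>i. i \<in> I \<Longrightarrow> Ck_on k S (f i)"
  shows "Ck_on k S (\<lambda>x. \<Sum>i\<in>I. f i x)"
  using assms(2)
  by (induction I rule: infinite_finite_induct) (auto simp: Ck_on_const[OF assms(1)] intro!: Ck_on_add[OF assms(1)])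

text \<open>By the product rule the derivative is a sum of two products of the same kind with one
  factor differentiated, so the induction runs over all pairs \<open>f\<close>, \<open>g\<close>
  simultaneously.\<close>

lemma Ck_on_bilinear:
  assumes B: "bounded_bilinear B" and S: "open S"
  shows "Ck_on k S f \<Longrightarrow> Ck_on k S g \<Longrightarrow> Ck_on k S (\<lambda>x. B (f x) (g x))"
proof (induction k arbitrary: f g)
  case 0
  then show ?case using bounded_bilinear.continuous_on[OF B] by auto
next
  case (Suc k)
  show ?case
  proof (rule Ck_on_SucI[where f' = "\<lambda>x v. B (f x) (frechet_derivative g (at x) v)
        + B (frechet_derivative f (at x) v) (g x)"])
    show "((\<lambda>x. B (f x) (g x)) has_derivative (\<lambda>v. B (f x) (frechet_derivative g (at x) v)
        + B (frechet_derivative f (at x) v) (g x))) (at x)" if "x \<in> S" for x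
      by (rule bounded_bilinear.FDERIV[OF B]; rule Ck_on_SucD[OF _ that]; fact Suc.prems)
    show "Ck_on k S (\<lambda>x. B (f x) (frechet_derivative g (at x) v)
        + B (frechet_derivative f (at x) v) (g x))" for v
      using Suc.prems by (intro Ck_on_add S Suc.IH) (auto intro: Ck_on_Suc_imp[unfolded Ck_on.simps])
  qed fact
qed

lemma Ck_on_linear_compose:
  assumes L: "bounded_linear L" and S: "open S"
  shows "Ck_on k S f \<Longrightarrow> Ck_on k S (\<lambda>x. L (f x))"
proof (induction k arbitrary: f)
  case 0
  then show ?case using bounded_linear.continuous_on[OF L] by auto
next
  case (Suc k)
  show ?case
    by (rule Ck_on_SucI[where f' = "\<lambda>x v. L (frechet_derivative f (at x) v)"])
      (use S Suc in \<open>auto intro!: bounded_linear.has_derivative[OF L] Ck_on_SucD\<close>)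
qed

lemma linear_euclidean_expand:
  fixes L :: "'a::euclidean_space \<Rightarrow> 'b::real_vector"
  assumes "linear L"
  shows "L x = (\<Sum>b\<in>Basis. (x \<bullet> b) *\<^sub>R L b)"
proof -
  have "L x = L (\<Sum>b\<in>Basis. (x \<bullet> b) *\<^sub>R b)" by (simp add: euclidean_representation)
  then show ?thesis by (simp add: linear_sum[OF assms] linear_scale[OF assms])
qed

text \<open>The definition differentiates in fixed directions, but the chain rule evaluates the
  derivative of \<open>g\<close> in a direction that moves with the point. Expanding that direction
  in a basis of the Euclidean middle space leaves derivatives of \<open>g\<close> in fixed
  directions, to which the induction hypothesis applies.\<close>

lemma Ck_on_compose:
  fixes f :: "'a::real_normed_vector \<Rightarrow> 'b::euclidean_space" and g :: "'b \<Rightarrow> 'c::real_normed_vector"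
  assumes S: "open S" and T: "open T" and "f ` S \<subseteq> T"
  shows "Ck_on k T g \<Longrightarrow> Ck_on k S f \<Longrightarrow> Ck_on k S (\<lambda>x. g (f x))"
proof (induction k arbitrary: g)
  case 0
  then show ?case using \<open>f ` S \<subseteq> T\<close> by (auto intro: continuous_on_compose2)
next
  case (Suc k)
  have inT: "f x \<in> T" if "x \<in> S" for x using that \<open>f ` S \<subseteq> T\<close> by auto
  have dg: "(g has_derivative frechet_derivative g (at y)) (at y)" if "y \<in> T" for y
    using Ck_on_SucD[OF Suc.prems(1) that] .
  show ?case
  proof (rule Ck_on_SucI[OF S, where f' = "\<lambda>x v. \<Sum>b\<in>Basis. (frechet_derivative f (at x) v \<bullet> b) *\<^sub>R
        frechet_derivative g (at (f x)) b"])
    show "((\<lambda>x. g (f x)) has_derivative (\<lambda>v. \<Sum>b\<in>Basis. (frechet_derivative f (at x) v \<bullet> b) *\<^sub>R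
        frechet_derivative g (at (f x)) b)) (at x)" if "x \<in> S" for x
      unfolding linear_euclidean_expand[OF has_derivative_linear[OF dg[OF inT[OF that]]], symmetric]
      by (rule has_derivative_compose[OF Ck_on_SucD[OF Suc.prems(2) that] dg[OF inT[OF that]]])
    show "Ck_on k S (\<lambda>x. \<Sum>b\<in>Basis. (frechet_derivative f (at x) v \<bullet> b) *\<^sub>R
        frechet_derivative g (at (f x)) b)" for v
      using Suc.prems Ck_on_Suc_imp[OF Suc.prems(2)]
      by (intro Ck_on_sum S Ck_on_bilinear[OF bounded_bilinear_scaleR]
          Ck_on_linear_compose[OF bounded_linear_inner_left] Suc.IH) auto
  qed
qed

lemma smooth_on_cong:
  "open S \<Longrightarrow> smooth_on S f \<Longrightarrow> (\<And>x. x \<in> S \<Longrightarrow> f x = g x) \<Longrightarrow> smooth_on S g"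
  using Ck_on_cong unfolding smooth_on_def by blast

lemma smooth_on_subset: "smooth_on S f \<Longrightarrow> T \<subseteq> S \<Longrightarrow> smooth_on T f"
  using Ck_on_subset unfolding smooth_on_def by blast

lemma smooth_on_local:
  assumes "\<And>x. x \<in> S \<Longrightarrow> \<exists>U. open U \<and> x \<in> U \<and> smooth_on U f"
  shows "smooth_on S f"
  using assms unfolding smooth_on_def by (meson Ck_on_local)

lemma smooth_on_const [intro]: "open S \<Longrightarrow> smooth_on S (\<lambda>x. c)"
  by (simp add: smooth_on_def Ck_on_const)

lemma smooth_on_linear: "bounded_linear L \<Longrightarrow> open S \<Longrightarrow> smooth_on S L"
  by (simp add: smooth_on_def Ck_on_linear)

lemma smooth_on_add: "open S \<Longrightarrow> smooth_on S f \<Longrightarrow> smooth_on S g \<Longrightarrow> smooth_on S (\<lambda>x. f x + g x)"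
  by (simp add: smooth_on_def Ck_on_add)

lemma smooth_on_sum:
  "open S \<Longrightarrow> (\<And>i. i \<in> I \<Longrightarrow> smooth_on S (f i)) \<Longrightarrow> smooth_on S (\<lambda>x. \<Sum>i\<in>I. f i x)"
  by (simp add: smooth_on_def Ck_on_sum)

lemma smooth_on_bilinear:
  "bounded_bilinear B \<Longrightarrow> open S \<Longrightarrow> smooth_on S f \<Longrightarrow> smooth_on S g \<Longrightarrow> smooth_on S (\<lambda>x. B (f x) (g x))"
  by (simp add: smooth_on_def Ck_on_bilinear)

lemmas smooth_on_scaleR = smooth_on_bilinear[OF bounded_bilinear_scaleR]
lemmas smooth_on_mult = smooth_on_bilinear[OF bounded_bilinear_mult]

lemma smooth_on_linear_compose:
  "bounded_linear L \<Longrightarrow> open S \<Longrightarrow> smooth_on S f \<Longrightarrow> smooth_on S (\<lambda>x. L (f x))"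
  by (simp add: smooth_on_def Ck_on_linear_compose)

lemma smooth_on_minus:
  "open S \<Longrightarrow> smooth_on S f \<Longrightarrow> smooth_on S (\<lambda>x. - f x)"
  by (rule smooth_on_linear_compose[OF bounded_linear_minus[OF bounded_linear_ident]])

lemma smooth_on_diff:
  "open S \<Longrightarrow> smooth_on S f \<Longrightarrow> smooth_on S g \<Longrightarrow> smooth_on S (\<lambda>x. f x - g x)"
  using smooth_on_add[of S f "\<lambda>x. - g x"] by (simp add: smooth_on_minus)

lemma smooth_on_compose:
  fixes f :: "'a::real_normed_vector \<Rightarrow> 'b::euclidean_space" and g :: "'b \<Rightarrow> 'c::real_normed_vector"
  shows "open S \<Longrightarrow> open T \<Longrightarrow> (\<And>x. x \<in> S \<Longrightarrow> f x \<in> T) \<Longrightarrow> smooth_on T g \<Longrightarrow> smooth_on S f \<Longrightarrow>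
    smooth_on S (\<lambda>x. g (f x))"
  unfolding smooth_on_def by (metis Ck_on_compose image_subsetI)

lemma smooth_on_componentwise:
  fixes f :: "'a::real_normed_vector \<Rightarrow> 'b::euclidean_space"
  assumes "open S" "\<And>b. b \<in> Basis \<Longrightarrow> smooth_on S (\<lambda>x. f x \<bullet> b)"
  shows "smooth_on S f"
proof -
  have "smooth_on S (\<lambda>x. \<Sum>b\<in>Basis. (f x \<bullet> b) *\<^sub>R b)"
    by (intro smooth_on_sum smooth_on_scaleR assms smooth_on_const)
  then show ?thesis by (simp add: euclidean_representation)
qed

lemma smooth_on_imp_has_derivative:
  "smooth_on S f \<Longrightarrow> x \<in> S \<Longrightarrow> (f has_derivative frechet_derivative f (at x)) (at x)"
  unfolding smooth_on_def using Ck_on_SucD by blast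

lemma smooth_on_imp_differentiable: "smooth_on S f \<Longrightarrow> x \<in> S \<Longrightarrow> f differentiable at x"
  using smooth_on_imp_has_derivative differentiableI by blast

lemma smooth_on_imp_continuous_on: "smooth_on S f \<Longrightarrow> continuous_on S f"
  unfolding smooth_on_def by (metis Ck_on.simps(1))

lemma smooth_on_frechet: "smooth_on S f \<Longrightarrow> smooth_on S (\<lambda>x. frechet_derivative f (at x) v)"
  unfolding smooth_on_def by (metis Ck_on.simps(2))

lemma smooth_on_frechet_field:
  fixes f :: "'a::euclidean_space \<Rightarrow> 'b::real_normed_vector"
  assumes "open S" "smooth_on S f" "smooth_on S w"
  shows "smooth_on S (\<lambda>x. frechet_derivative f (at x) (w x))"
proof -
  have "smooth_on S (\<lambda>x. \<Sum>b\<in>Basis. (w x \<bullet> b) *\<^sub>R frechet_derivative f (at x) b)"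
    by (intro smooth_on_sum smooth_on_scaleR smooth_on_linear_compose[OF bounded_linear_inner_left]
        smooth_on_frechet assms)
  then show ?thesis
    by (rule smooth_on_cong[OF assms(1)])
      (simp add: linear_euclidean_expand[symmetric] linear_frechet_derivative
        smooth_on_imp_differentiable[OF assms(2)])
qed

section \<open>Symmetry of second derivatives and bump functions\<close>

lemma has_real_derivative_compose_line:
  assumes "(f has_derivative f') (at (x + s *\<^sub>R u))"
  shows "((\<lambda>s. f (x + s *\<^sub>R u)) has_real_derivative f' u) (at s)"
proof -
  have "((\<lambda>s. x + s *\<^sub>R u) has_derivative (\<lambda>s. s *\<^sub>R u)) (at s)"
    by (auto intro!: derivative_eq_intros)
  from has_derivative_compose[OF this assms]
  have "((\<lambda>s. f (x + s *\<^sub>R u)) has_derivative (\<lambda>s. f' (s *\<^sub>R u))) (at s)" .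
  then show ?thesis
    by (simp add: has_field_derivative_def linear_scale[OF has_derivative_linear[OF assms]] mult_commute_abs)
qed

text \<open>The mean value theorem is applied to s |-> f(x + su + hv) - f(x + su), and then in the
  direction \<open>v\<close> to the derivative of \<open>f\<close> along \<open>u\<close>.\<close>

lemma mixed_difference_mean_value:
  fixes f :: "'a::real_normed_vector \<Rightarrow> real"
  assumes f: "smooth_on (ball x d) f" and h: "0 < h" "h * (norm u + norm v) < d"
  shows "\<exists>y\<in>ball x d. f (x + h *\<^sub>R u + h *\<^sub>R v) - f (x + h *\<^sub>R u) - f (x + h *\<^sub>R v) + f x
    = h * (h * frechet_derivative (\<lambda>y. frechet_derivative f (at y) u) (at y) v)"
proof -
  let ?fu = "\<lambda>y. frechet_derivative f (at y) u"
  have inb: "x + s *\<^sub>R u + t *\<^sub>R v \<in> ball x d" if "0 \<le> s" "s \<le> h" "0 \<le> t" "t \<le> h" for s t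
  proof -
    have "norm (s *\<^sub>R u + t *\<^sub>R v) \<le> s * norm u + t * norm v"
      using norm_triangle_ineq[of "s *\<^sub>R u" "t *\<^sub>R v"] that by simp
    also have "\<dots> \<le> h * norm u + h * norm v"
      using that by (intro add_mono mult_right_mono) auto
    finally have "norm (s *\<^sub>R u + t *\<^sub>R v) < d" using h by (simp add: distrib_left)
    moreover have "dist x (x + (s *\<^sub>R u + t *\<^sub>R v)) = norm (s *\<^sub>R u + t *\<^sub>R v)"
      by (metis add_diff_cancel_left' dist_commute dist_norm)
    ultimately show ?thesis by (simp add: add.assoc)
  qed
  have d1: "((\<lambda>s. f (x + s *\<^sub>R u + h *\<^sub>R v) - f (x + s *\<^sub>R u)) has_real_derivative
      ?fu (x + s *\<^sub>R u + h *\<^sub>R v) - ?fu (x + s *\<^sub>R u)) (at s)" if "0 \<le> s" "s \<le> h" for s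
  proof (rule DERIV_diff)
    have "((\<lambda>s. f ((x + h *\<^sub>R v) + s *\<^sub>R u)) has_real_derivative ?fu ((x + h *\<^sub>R v) + s *\<^sub>R u)) (at s)"
      by (rule has_real_derivative_compose_line, rule smooth_on_imp_has_derivative[OF f])
        (use inb[of s h] that h in \<open>simp add: add_ac\<close>)
    then show "((\<lambda>s. f (x + s *\<^sub>R u + h *\<^sub>R v)) has_real_derivative ?fu (x + s *\<^sub>R u + h *\<^sub>R v)) (at s)"
      by (simp add: add_ac)
    show "((\<lambda>s. f (x + s *\<^sub>R u)) has_real_derivative ?fu (x + s *\<^sub>R u)) (at s)"
      by (rule has_real_derivative_compose_line, rule smooth_on_imp_has_derivative[OF f])
        (use inb[of s 0] that h in simp)
  qed
  obtain s where s: "0 < s" "s < h"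
    "f (x + h *\<^sub>R u + h *\<^sub>R v) - f (x + h *\<^sub>R u) - (f (x + 0 *\<^sub>R u + h *\<^sub>R v) - f (x + 0 *\<^sub>R u))
     = (h - 0) * (?fu (x + s *\<^sub>R u + h *\<^sub>R v) - ?fu (x + s *\<^sub>R u))"
    using MVT2[OF h(1) d1] by metis
  have d2: "((\<lambda>t. ?fu (x + s *\<^sub>R u + t *\<^sub>R v)) has_real_derivative
      frechet_derivative ?fu (at (x + s *\<^sub>R u + t *\<^sub>R v)) v) (at t)" if "0 \<le> t" "t \<le> h" for t
    by (rule has_real_derivative_compose_line, rule smooth_on_imp_has_derivative[OF smooth_on_frechet[OF f]])
      (use inb[of s t] that s in simp)
  obtain t where t: "0 < t" "t < h"
    "?fu (x + s *\<^sub>R u + h *\<^sub>R v) - ?fu (x + s *\<^sub>R u + 0 *\<^sub>R v)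
      = (h - 0) * frechet_derivative ?fu (at (x + s *\<^sub>R u + t *\<^sub>R v)) v"
    using MVT2[OF h(1) d2] by metis
  show ?thesis
    by (rule bexI[where x = "x + s *\<^sub>R u + t *\<^sub>R v"]) (use s t inb[of s t] in auto)
qed

text \<open>The mixed difference is symmetric in \<open>u\<close> and \<open>v\<close>, so both
  second derivatives take a common value at points arbitrarily close to \<open>x\<close>; continuity
  does the rest.\<close>

lemma second_derivative_symmetric:
  fixes f :: "'a::real_normed_vector \<Rightarrow> real"
  assumes "open S" "smooth_on S f" "x \<in> S"
  shows "frechet_derivative (\<lambda>y. frechet_derivative f (at y) u) (at x) v
       = frechet_derivative (\<lambda>y. frechet_derivative f (at y) v) (at x) u"
proof -
  define D where "D u v y = frechet_derivative (\<lambda>y. frechet_derivative f (at y) u) (at y) v" for u v y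
  have cont: "isCont (D u v) x" for u v
    using smooth_on_imp_continuous_on[OF smooth_on_frechet[OF smooth_on_frechet[OF assms(2)]]] assms
    unfolding D_def by (simp add: continuous_on_eq_continuous_at)
  have "\<bar>D u v x - D v u x\<bar> \<le> e" if "e > 0" for e
  proof -
    obtain d0 where d0: "d0 > 0" "ball x d0 \<subseteq> S" using assms openE by blast
    obtain d1 where d1: "d1 > 0" "\<And>y. dist y x < d1 \<Longrightarrow> dist (D u v y) (D u v x) < e / 2"
      using cont[of u v] \<open>e > 0\<close> unfolding continuous_at_eps_delta by (metis half_gt_zero)
    obtain d2 where d2: "d2 > 0" "\<And>y. dist y x < d2 \<Longrightarrow> dist (D v u y) (D v u x) < e / 2"
      using cont[of v u] \<open>e > 0\<close> unfolding continuous_at_eps_delta by (metis half_gt_zero)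
    define d where "d = min d0 (min d1 d2)"
    \<comment> \<open>This gives h(|u| + |v|) at most d/2; the summand 1 keeps the denominator
      positive when both directions are zero.\<close>
    define h where "h = d / (2 * (norm u + norm v + 1))"
    have "d > 0" using d0 d1 d2 by (simp add: d_def)
    have pos: "norm u + norm v + 1 > 0" by (simp add: add_nonneg_pos)
    have h: "h > 0" using \<open>d > 0\<close> pos by (simp add: h_def)
    have "h * (norm u + norm v) \<le> h * (norm u + norm v + 1)" using h by simp
    also have "\<dots> = d / 2" using pos by (simp add: h_def field_simps)
    finally have hs: "h * (norm u + norm v) < d" using \<open>d > 0\<close> by simp
    have f: "smooth_on (ball x d) f"
      using smooth_on_subset[OF assms(2)] d0 by (metis d_def dual_order.trans min.cobounded1 subset_ball)
    from mixed_difference_mean_value[OF f h hs] obtain y where y: "y \<in> ball x d"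
      "f (x + h *\<^sub>R u + h *\<^sub>R v) - f (x + h *\<^sub>R u) - f (x + h *\<^sub>R v) + f x = h * (h * D u v y)"
      unfolding D_def by blast
    from mixed_difference_mean_value[OF f h, of v u] hs obtain z where z: "z \<in> ball x d"
      "f (x + h *\<^sub>R v + h *\<^sub>R u) - f (x + h *\<^sub>R v) - f (x + h *\<^sub>R u) + f x = h * (h * D v u z)"
      unfolding D_def by (auto simp: add.commute)
    have "h * (h * D u v y) = h * (h * D v u z)" using y z by (simp add: algebra_simps)
    then have "D u v y = D v u z" using h by simp
    moreover have "dist (D u v y) (D u v x) < e / 2" "dist (D v u z) (D v u x) < e / 2"
      by (rule d1(2), use y in \<open>simp add: d_def dist_commute\<close>,
          rule d2(2), use z in \<open>simp add: d_def dist_commute\<close>)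
    ultimately show ?thesis unfolding dist_real_def by linarith
  qed
  then have "D u v x = D v u x"
    by (metis abs_le_zero_iff dense_ge right_minus_eq)
  then show ?thesis by (simp add: D_def)
qed

text \<open>The case p = 1 is the standard function exp(-1/t) that is flat at 0. Admitting
  polynomials in 1/t gives a family closed under differentiation, so that smoothness is a plain
  induction.\<close>

definition flat :: "real poly \<Rightarrow> real \<Rightarrow> real" where
  "flat p t = (if t > 0 then poly p (1 / t) * exp (- (1 / t)) else 0)"

lemma tendsto_poly_exp_0: "((\<lambda>x::real. poly p x * exp (- x)) \<longlongrightarrow> 0) at_top"
proof -
  have "((\<lambda>x. \<Sum>i\<le>degree p. coeff p i * (x ^ i / exp x)) \<longlongrightarrow> (\<Sum>i\<le>degree p. coeff p i * 0)) at_top"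
    by (intro tendsto_sum tendsto_mult tendsto_const tendsto_power_div_exp_0)
  then show ?thesis
    by (simp add: poly_altdef exp_minus sum_distrib_right field_simps sum_divide_distrib)
qed

text \<open>With x = 1/t one has dx/dt = -x^2, and p(x) exp(-x) has the x-derivative (p' - p)
  exp(-x); hence the polynomial x^2 (p - p').\<close>

lemma flat_has_derivative:
  "(flat p has_real_derivative flat ([:0, 0, 1:] * (p - pderiv p)) t) (at t)"
proof (cases t "0::real" rule: linorder_cases)
  case less
  have "((\<lambda>_. 0) has_real_derivative 0) (at t)" by simp
  then have "(flat p has_real_derivative 0) (at t)"
    by (rule has_field_derivative_transform_within_open[where S = "{..<0}"]) (use less in \<open>auto simp: flat_def\<close>)
  then show ?thesis using less by (simp add: flat_def)
next
  case equal
  have "((\<lambda>y. flat p y / y) \<longlongrightarrow> 0) (at_right 0)"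
  proof -
    \<comment> \<open>Dividing by y multiplies by 1/y, which is the shift \<open>pCons 0 p\<close>
      of the polynomial.\<close>
    have "((\<lambda>y. poly (pCons 0 p) (inverse y) * exp (- inverse y)) \<longlongrightarrow> 0) (at_right (0::real))"
      by (rule filterlim_compose[OF tendsto_poly_exp_0 filterlim_inverse_at_top_right])
    then show ?thesis
      by (rule Lim_transform_eventually)
        (auto simp: eventually_at_right_less flat_def field_simps intro!: eventually_at_rightI[of 0 1])
  qed
  moreover have "((\<lambda>y. flat p y / y) \<longlongrightarrow> 0) (at_left 0)"
    by (rule Lim_transform_eventually[OF tendsto_const])
      (auto simp: flat_def intro!: eventually_at_leftI[of "-1"])
  ultimately have "((\<lambda>y. flat p y / y) \<longlongrightarrow> 0) (at 0)"
    by (rule filterlim_split_at[rotated])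
  then show ?thesis using equal by (simp add: has_field_derivative_iff flat_def)
next
  case greater
  have "((\<lambda>t. poly p (1 / t) * exp (- (1 / t))) has_real_derivative
      poly ([:0, 0, 1:] * (p - pderiv p)) (1 / t) * exp (- (1 / t))) (at t)"
  proof -
    have i: "((\<lambda>t. 1 / t) has_real_derivative - (1 / t) * (1 / t)) (at t)"
      using greater by (auto intro!: derivative_eq_intros simp: field_simps)
    have e: "((\<lambda>t. exp (- (1 / t))) has_real_derivative exp (- (1 / t)) * - (- (1 / t) * (1 / t))) (at t)"
      by (rule DERIV_chain2[OF DERIV_exp DERIV_minus[OF i]])
    have "((\<lambda>t. poly p (1 / t)) has_real_derivative poly (pderiv p) (1 / t) * (- (1 / t) * (1 / t))) (at t)"
      by (rule DERIV_chain2[OF poly_DERIV i])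
    from DERIV_mult[OF this e] show ?thesis
      by (rule DERIV_cong) (simp add: algebra_simps)
  qed
  then have "(flat p has_real_derivative poly ([:0, 0, 1:] * (p - pderiv p)) (1 / t) * exp (- (1 / t))) (at t)"
    by (rule has_field_derivative_transform_within_open[where S = "{0<..}"]) (use greater in \<open>auto simp: flat_def\<close>)
  then show ?thesis using greater by (simp add: flat_def)
qed

lemma smooth_on_flat: "smooth_on UNIV (flat p)"
proof -
  have "Ck_on k UNIV (flat p)" for k p
  proof (induction k arbitrary: p)
    case 0
    show ?case
      using flat_has_derivative DERIV_isCont by (metis Ck_on.simps(1) continuous_at_imp_continuous_on)
  next
    case (Suc k)
    show ?case
    proof (rule Ck_on_SucI)
      show "(flat p has_derivative (\<lambda>v. flat ([:0, 0, 1:] * (p - pderiv p)) t * v)) (at t)" for t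
        using flat_has_derivative[of p t] by (simp only: has_field_derivative_def)
      show "Ck_on k UNIV (\<lambda>t. flat ([:0, 0, 1:] * (p - pderiv p)) t * v)" for v
        by (rule Ck_on_linear_compose[OF bounded_linear_mult_left _ Suc]) simp
    qed simp
  qed
  then show ?thesis by (simp add: smooth_on_def)
qed

lemma smooth_on_inverse: "smooth_on {0<..} (inverse :: real \<Rightarrow> real)"
proof -
  have "Ck_on k {0<..} (inverse :: real \<Rightarrow> real)" for k
  proof (induction k)
    case 0
    show ?case by (auto intro!: continuous_intros)
  next
    case (Suc k)
    show ?case
    proof (rule Ck_on_SucI)
      show "(inverse has_derivative (\<lambda>v. - (inverse x * v * inverse x))) (at x)" if "x \<in> {0<..}" for x :: real
        using that by (intro has_derivative_inverse') auto
      show "Ck_on k {0<..} (\<lambda>x::real. - (inverse x * v * inverse x))" for v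
        by (intro Ck_on_linear_compose[OF bounded_linear_minus[OF bounded_linear_ident]]
            Ck_on_bilinear[OF bounded_bilinear_mult] Suc Ck_on_const) auto
    qed simp
  qed
  then show ?thesis by (simp add: smooth_on_def)
qed

lemma flat_1: "flat 1 t > 0 \<longleftrightarrow> t > 0" "flat 1 t \<ge> 0" "t \<le> 0 \<Longrightarrow> flat 1 t = 0"
  by (auto simp: flat_def)

lemma smooth_bump_exists:
  fixes x0 :: "'a::euclidean_space"
  assumes "r > 0"
  obtains \<phi> :: "'a \<Rightarrow> real" where "smooth_on UNIV \<phi>" "\<And>x. x \<in> ball x0 (r / 2) \<Longrightarrow> \<phi> x = 1"
    "\<And>x. x \<notin> cball x0 r \<Longrightarrow> \<phi> x = 0"
proof
  \<comment> \<open>\<open>n\<close> is (2|x - x0|/r)^2, squared to be smooth at the centre: at most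
    1 on the half ball and at least 4 outside the ball. \<open>c\<close> is a smooth step from 1 on
    t \<le> 1 to 0 on t \<ge> 2; its denominator is positive because t < 2 or t > 1.\<close>
  define n where "n x = 4 * ((x - x0) \<bullet> (x - x0)) / r^2" for x
  define c where "c t = flat 1 (2 - t) * inverse (flat 1 (2 - t) + flat 1 (t - 1))" for t
  have pos: "flat 1 (2 - t) + flat 1 (t - 1) > 0" for t
    using flat_1[of "2 - t"] flat_1[of "t - 1"] by (cases "t < 2") auto
  have lin: "smooth_on UNIV (\<lambda>t::real. 2 - t)" "smooth_on UNIV (\<lambda>t::real. t - 1)"
    by (intro smooth_on_diff smooth_on_const smooth_on_linear bounded_linear_ident; simp)+
  have fl: "smooth_on UNIV (\<lambda>t. flat 1 (2 - t))" "smooth_on UNIV (\<lambda>t. flat 1 (t - 1))"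
    by (rule smooth_on_compose[OF _ _ _ smooth_on_flat lin(1)] smooth_on_compose[OF _ _ _ smooth_on_flat lin(2)]; simp)+
  have c: "smooth_on UNIV c"
    unfolding c_def
    by (intro smooth_on_mult smooth_on_compose[OF _ _ _ smooth_on_inverse] smooth_on_add fl) (auto simp: pos)
  have "smooth_on UNIV (\<lambda>x. (4 / r^2) * ((x - x0) \<bullet> (x - x0)))"
    by (intro smooth_on_mult smooth_on_const smooth_on_bilinear[OF bounded_bilinear_inner]
        smooth_on_diff smooth_on_linear bounded_linear_ident) auto
  then have n: "smooth_on UNIV n" by (simp add: n_def[abs_def])
  show "smooth_on UNIV (\<lambda>x. c (n x))"
    by (rule smooth_on_compose[OF _ _ _ c n]) auto
  have nd: "n x = (2 * dist x0 x / r)^2" for x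
    by (simp add: n_def dist_norm norm_minus_commute[of x0] power2_norm_eq_inner[symmetric] power_mult_distrib power_divide)
  show "c (n x) = 1" if "x \<in> ball x0 (r / 2)" for x
  proof -
    have "2 * dist x0 x / r \<le> 1" using that assms by (simp add: field_simps)
    then have "n x \<le> 1" unfolding nd using assms by (simp add: power_le_one)
    then show ?thesis using pos[of "n x"] flat_1(3)[of "n x - 1"] by (simp add: c_def)
  qed
  show "c (n x) = 0" if "x \<notin> cball x0 r" for x
  proof -
    have "2 \<le> 2 * dist x0 x / r" using that assms by (simp add: field_simps)
    then have "2^2 \<le> n x" unfolding nd by (intro power_mono) auto
    then show ?thesis by (simp add: c_def flat_1(3))
  qed
qed

section \<open>Functions and vector fields on a complex manifold\<close>

text \<open>The product rule when point and direction vary together. It splits X(Yf) in a chart into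
  a second-order part, symmetric in X and Y, and a part containing the derivative of the components
  of Y.\<close>

lemma frechet_derivative_along_field:
  fixes f :: "'a::euclidean_space \<Rightarrow> 'b::real_normed_vector"
  assumes S: "open S" and f: "smooth_on S f" and w: "smooth_on S w" and x: "x \<in> S"
  shows "frechet_derivative (\<lambda>x. frechet_derivative f (at x) (w x)) (at x) v
    = frechet_derivative (\<lambda>y. frechet_derivative f (at y) (w x)) (at x) v
      + frechet_derivative f (at x) (frechet_derivative w (at x) v)"
proof -
  let ?f' = "\<lambda>b y. frechet_derivative f (at y) b"
  have lin: "linear (frechet_derivative f (at y))" if "y \<in> S" for y
    using linear_frechet_derivative smooth_on_imp_differentiable[OF f that] by blast
  have exp: "frechet_derivative f (at y) u = (\<Sum>b\<in>Basis. (u \<bullet> b) *\<^sub>R ?f' b y)" if "y \<in> S" for y u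
    by (rule linear_euclidean_expand[OF lin[OF that]])
  have df: "(?f' b has_derivative frechet_derivative (?f' b) (at x)) (at x)" for b
    by (rule smooth_on_imp_has_derivative[OF smooth_on_frechet[OF f] x])
  have dw: "((\<lambda>y. w y \<bullet> b) has_derivative (\<lambda>v. frechet_derivative w (at x) v \<bullet> b)) (at x)" for b
    by (rule bounded_linear.has_derivative[OF bounded_linear_inner_left smooth_on_imp_has_derivative[OF w x]])
  have "((\<lambda>y. \<Sum>b\<in>Basis. (w y \<bullet> b) *\<^sub>R ?f' b y) has_derivative
      (\<lambda>v. \<Sum>b\<in>Basis. (w x \<bullet> b) *\<^sub>R frechet_derivative (?f' b) (at x) v
        + (frechet_derivative w (at x) v \<bullet> b) *\<^sub>R ?f' b x)) (at x)"
    by (intro has_derivative_sum has_derivative_scaleR dw df)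
  then have "((\<lambda>y. frechet_derivative f (at y) (w y)) has_derivative
      (\<lambda>v. \<Sum>b\<in>Basis. (w x \<bullet> b) *\<^sub>R frechet_derivative (?f' b) (at x) v
        + (frechet_derivative w (at x) v \<bullet> b) *\<^sub>R ?f' b x)) (at x)"
    by (rule has_derivative_transform_within_open[OF _ S x]) (simp add: exp[symmetric])
  from frechet_derivative_at[OF this, symmetric]
  have 1: "frechet_derivative (\<lambda>x. frechet_derivative f (at x) (w x)) (at x) v
    = (\<Sum>b\<in>Basis. (w x \<bullet> b) *\<^sub>R frechet_derivative (?f' b) (at x) v)
      + frechet_derivative f (at x) (frechet_derivative w (at x) v)"
    by (simp add: sum.distrib exp[OF x, of "frechet_derivative w (at x) v"])
  have "((\<lambda>y. \<Sum>b\<in>Basis. (w x \<bullet> b) *\<^sub>R ?f' b y) has_derivative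
      (\<lambda>v. \<Sum>b\<in>Basis. (w x \<bullet> b) *\<^sub>R frechet_derivative (?f' b) (at x) v)) (at x)"
    by (intro has_derivative_sum has_derivative_scaleR_right df)
  then have "((\<lambda>y. frechet_derivative f (at y) (w x)) has_derivative
      (\<lambda>v. \<Sum>b\<in>Basis. (w x \<bullet> b) *\<^sub>R frechet_derivative (?f' b) (at x) v)) (at x)"
    by (rule has_derivative_transform_within_open[OF _ S x]) (simp add: exp[symmetric])
  from frechet_derivative_at[OF this, symmetric] 1 show ?thesis by simp
qed

locale complex_manifold =
  fixes A :: "('a::{t2_space,second_countable_topology}, 'm::finite) chart set"
  assumes atlas: "complex_atlas A"
begin

abbreviation img :: "('a, 'm) chart \<Rightarrow> (complex^'m) set" where
  "img c \<equiv> snd c ` fst c"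

text \<open>The Jacobian of a coordinate change. \<open>in_chart\<close> is the special case in
  which \<open>c\<close> is the chart chosen at the point.\<close>

definition trd :: "('a, 'm) chart \<Rightarrow> ('a, 'm) chart \<Rightarrow> complex^'m \<Rightarrow> complex^'m \<Rightarrow> complex^'m" where
  "trd c d x = frechet_derivative (snd d \<circ> chart_inv c) (at x)"

lemma
  assumes "c \<in> A"
  shows open_dom: "open (fst c)" and open_img: "open (img c)"
    and chart_homeomorphism: "homeomorphism (fst c) (img c) (snd c) (chart_inv c)"
  using atlas assms unfolding complex_atlas_def by auto

lemma chart_inv_apply [simp]: "c \<in> A \<Longrightarrow> q \<in> fst c \<Longrightarrow> chart_inv c (snd c q) = q"
  by (meson chart_homeomorphism homeomorphism_apply1)

lemma chart_apply_inv [simp]: "c \<in> A \<Longrightarrow> x \<in> img c \<Longrightarrow> snd c (chart_inv c x) = x"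
  by (meson chart_homeomorphism homeomorphism_apply2)

lemma chart_inv_in_dom [simp]: "x \<in> img c \<Longrightarrow> chart_inv c x \<in> fst c"
  by (rule inv_into_into)

lemma chart_image_open:
  assumes "c \<in> A" "open U" shows "open (snd c ` (fst c \<inter> U))"
proof -
  have "snd c ` (fst c \<inter> U) = img c \<inter> chart_inv c -` U"
    using assms by force
  then show ?thesis
    using continuous_open_preimage[of "img c" "chart_inv c" U] open_img[OF assms(1)] assms(2)
      chart_homeomorphism[OF assms(1)]
    by (simp add: homeomorphism_def)
qed

lemma chart_preimage_open:
  assumes "c \<in> A" "open S" shows "open (fst c \<inter> snd c -` S)"
  using continuous_open_preimage[of "fst c" "snd c" S] open_dom[OF assms(1)] assms(2)
      chart_homeomorphism[OF assms(1)]
  by (simp add: homeomorphism_def)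

lemma chart_at_in [simp]: "chart_at A q \<in> A" and in_chart_at [simp]: "q \<in> fst (chart_at A q)"
proof -
  have "\<exists>c. c \<in> A \<and> q \<in> fst c" using atlas unfolding complex_atlas_def by blast
  from someI_ex[OF this] show "chart_at A q \<in> A" "q \<in> fst (chart_at A q)"
    by (auto simp: chart_at_def)
qed

lemma transition_smooth:
  "c \<in> A \<Longrightarrow> d \<in> A \<Longrightarrow> smooth_on (snd c ` (fst c \<inter> fst d)) (snd d \<circ> chart_inv c)"
  using atlas unfolding complex_atlas_def holomorphic_map_on_def by blast

lemma trd_has_derivative:
  assumes "c \<in> A" "d \<in> A" "q \<in> fst c" "q \<in> fst d"
  shows "((snd d \<circ> chart_inv c) has_derivative trd c d (snd c q)) (at (snd c q))"
  unfolding trd_def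
  by (rule smooth_on_imp_has_derivative[OF transition_smooth]) (use assms in auto)

lemma trd_linear:
  "c \<in> A \<Longrightarrow> d \<in> A \<Longrightarrow> q \<in> fst c \<Longrightarrow> q \<in> fst d \<Longrightarrow> linear (trd c d (snd c q))"
  using trd_has_derivative has_derivative_linear by blast

lemma trd_vector_scalar:
  assumes "c \<in> A" "d \<in> A" "q \<in> fst c" "q \<in> fst d"
  shows "trd c d (snd c q) (a *s v) = a *s trd c d (snd c q) v"
  using atlas assms unfolding complex_atlas_def holomorphic_map_on_def trd_def by blast

lemma trd_same:
  assumes "c \<in> A" "q \<in> fst c"
  shows "trd c c (snd c q) v = v"
proof -
  have "((snd c \<circ> chart_inv c) has_derivative (\<lambda>x. x)) (at (snd c q))"
    by (rule has_derivative_transform_within_open[OF has_derivative_ident open_img[OF assms(1)]])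
      (use assms in auto)
  then show ?thesis
    using trd_has_derivative[OF assms(1) assms(1) assms(2) assms(2)] has_derivative_unique by metis
qed

lemma trd_trd:
  assumes "c \<in> A" "d \<in> A" "e \<in> A" "q \<in> fst c" "q \<in> fst d" "q \<in> fst e"
  shows "trd d e (snd d q) (trd c d (snd c q) v) = trd c e (snd c q) v"
proof -
  have "((\<lambda>x. (snd e \<circ> chart_inv d) ((snd d \<circ> chart_inv c) x)) has_derivative
      (\<lambda>v. trd d e (snd d q) (trd c d (snd c q) v))) (at (snd c q))"
    by (rule has_derivative_compose[OF trd_has_derivative])
      (use assms trd_has_derivative[of d e q] in \<open>simp_all add: comp_def\<close>)
  then have "((snd e \<circ> chart_inv c) has_derivative
      (\<lambda>v. trd d e (snd d q) (trd c d (snd c q) v))) (at (snd c q))"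
    by (rule has_derivative_transform_within_open[OF _ chart_image_open[OF assms(1) open_dom[OF assms(2)]]])
      (use assms in auto)
  then show ?thesis
    using trd_has_derivative[of c e q] has_derivative_unique assms by metis
qed

lemma in_chart_eq: "in_chart A c q v = trd (chart_at A q) c (snd (chart_at A q) q) v"
  by (simp add: in_chart_def trd_def)

lemma in_chart_linear: "c \<in> A \<Longrightarrow> q \<in> fst c \<Longrightarrow> linear (in_chart A c q)"
  using trd_linear[of "chart_at A q" c q] by (simp add: in_chart_eq[abs_def])

lemma in_chart_vector_scalar: "c \<in> A \<Longrightarrow> q \<in> fst c \<Longrightarrow> in_chart A c q (a *s v) = a *s in_chart A c q v"
  by (simp add: in_chart_eq trd_vector_scalar)

lemma in_chart_at_self [simp]: "in_chart A (chart_at A q) q v = v"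
  by (simp add: in_chart_eq trd_same)

lemma trd_in_chart:
  "c \<in> A \<Longrightarrow> d \<in> A \<Longrightarrow> q \<in> fst c \<Longrightarrow> q \<in> fst d \<Longrightarrow> trd c d (snd c q) (in_chart A c q v) = in_chart A d q v"
  by (simp add: in_chart_eq trd_trd)

lemma in_chart_trd:
  "c \<in> A \<Longrightarrow> d \<in> A \<Longrightarrow> q \<in> fst c \<Longrightarrow> q \<in> fst d \<Longrightarrow>
    in_chart A d q (trd c (chart_at A q) (snd c q) v) = trd c d (snd c q) v"
  by (simp add: in_chart_eq trd_trd)

lemma in_chart_inj:
  assumes "c \<in> A" "q \<in> fst c" "in_chart A c q u = in_chart A c q v" shows "u = v"
  using assms trd_in_chart[of c "chart_at A q" q] by (metis chart_at_in in_chart_at in_chart_at_self)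

lemma in_chart_zero [simp]: "c \<in> A \<Longrightarrow> q \<in> fst c \<Longrightarrow> in_chart A c q 0 = 0"
  using in_chart_linear linear_0 by blast

lemma local_rep_chart [simp]: "c \<in> A \<Longrightarrow> q \<in> fst c \<Longrightarrow> local_rep A c X (snd c q) = in_chart A c q (X q)"
  by (simp add: local_rep_def)

lemma smooth_funD: "smooth_fun A f \<Longrightarrow> c \<in> A \<Longrightarrow> smooth_on (img c) (f \<circ> chart_inv c)"
  by (simp add: smooth_fun_def)

lemma VFD: "X \<in> VF A \<Longrightarrow> c \<in> A \<Longrightarrow> smooth_on (img c) (local_rep A c X)"
  by (simp add: VF_def)

text \<open>Transition maps carry smoothness from one chart around each point to all the
  others.\<close>

lemma smooth_funI:
  assumes "\<And>q. \<exists>c U. c \<in> A \<and> open U \<and> q \<in> U \<and> U \<subseteq> fst c \<and> smooth_on (snd c ` U) (f \<circ> chart_inv c)"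
  shows "smooth_fun A f"
  unfolding smooth_fun_def
proof (intro ballI smooth_on_local)
  fix d x assume d: "d \<in> A" "x \<in> img d"
  obtain c U where c: "c \<in> A" "open U" "chart_inv d x \<in> U" "U \<subseteq> fst c" "smooth_on (snd c ` U) (f \<circ> chart_inv c)"
    using assms by blast
  let ?V = "snd d ` (fst d \<inter> U)"
  have V: "open ?V" using chart_image_open d c by blast
  have cU: "open (snd c ` U)" using chart_image_open[of c U] c by (simp add: Int_absorb1)
  have "smooth_on ?V (snd c \<circ> chart_inv d)"
    by (rule smooth_on_subset[OF transition_smooth]) (use c d in auto)
  moreover have "(snd c \<circ> chart_inv d) y \<in> snd c ` U" if "y \<in> ?V" for y
    using c d that by auto
  ultimately have "smooth_on ?V (\<lambda>y. (f \<circ> chart_inv c) ((snd c \<circ> chart_inv d) y))"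
    using smooth_on_compose[OF V cU _ c(5)] by blast
  then have "smooth_on ?V (f \<circ> chart_inv d)"
    by (rule smooth_on_cong[OF V]) (use c d in auto)
  moreover have "x \<in> ?V" using c d by (metis IntI chart_apply_inv chart_inv_in_dom image_eqI)
  ultimately show "\<exists>U. open U \<and> x \<in> U \<and> smooth_on U (f \<circ> chart_inv d)" using V by blast
qed

text \<open>As for functions, but the components also get multiplied by the Jacobian of the
  transition map, which is smooth as a derivative along a smooth field.\<close>

lemma VFI:
  assumes "\<And>q. \<exists>c U. c \<in> A \<and> open U \<and> q \<in> U \<and> U \<subseteq> fst c \<and> smooth_on (snd c ` U) (local_rep A c X)"
  shows "X \<in> VF A"
  unfolding VF_def
proof (intro CollectI ballI smooth_on_local)
  fix d x assume d: "d \<in> A" "x \<in> img d"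
  obtain c U where c: "c \<in> A" "open U" "chart_inv d x \<in> U" "U \<subseteq> fst c" "smooth_on (snd c ` U) (local_rep A c X)"
    using assms by blast
  let ?V = "snd d ` (fst d \<inter> U)" and ?W = "snd c ` (fst d \<inter> U)"
  have V: "open ?V" using chart_image_open d c by blast
  have W: "open ?W" using chart_image_open[of c "fst d \<inter> U"] c d open_dom
    by (metis Int_absorb1 inf.coboundedI2 open_Int)
  have f: "smooth_on ?V (snd c \<circ> chart_inv d)"
    by (rule smooth_on_subset[OF transition_smooth]) (use c d in auto)
  have g: "smooth_on ?W (\<lambda>y. frechet_derivative (snd d \<circ> chart_inv c) (at y) (local_rep A c X y))"
    using c d by (intro smooth_on_frechet_field W smooth_on_subset[OF transition_smooth]
        smooth_on_subset[OF c(5)]) auto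
  have sub: "(snd c \<circ> chart_inv d) y \<in> ?W" if "y \<in> ?V" for y
    using c d that by auto
  have "smooth_on ?V (\<lambda>y. trd c d ((snd c \<circ> chart_inv d) y) (local_rep A c X ((snd c \<circ> chart_inv d) y)))"
    using smooth_on_compose[OF V W sub g f] by (simp only: trd_def)
  then have "smooth_on ?V (local_rep A d X)"
  proof (rule smooth_on_cong[OF V])
    fix y assume "y \<in> ?V"
    then obtain q where "q \<in> fst d" "q \<in> U" "y = snd d q" by blast
    moreover from this c have "q \<in> fst c" by blast
    ultimately show "trd c d ((snd c \<circ> chart_inv d) y) (local_rep A c X ((snd c \<circ> chart_inv d) y)) = local_rep A d X y"
      using c d by (simp add: trd_in_chart)
  qed
  moreover have "x \<in> ?V" using c d by (metis IntI chart_apply_inv chart_inv_in_dom image_eqI)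
  ultimately show "\<exists>U. open U \<and> x \<in> U \<and> smooth_on U (local_rep A d X)" using V by blast
qed

lemma smooth_fun_const: "smooth_fun A (\<lambda>q. r)"
  by (simp add: smooth_fun_def comp_def open_img smooth_on_const)

lemma smooth_fun_mult: "smooth_fun A f \<Longrightarrow> smooth_fun A h \<Longrightarrow> smooth_fun A (\<lambda>q. f q * h q)"
  by (simp add: smooth_fun_def comp_def open_img smooth_on_mult)

lemma smooth_fun_diff: "smooth_fun A f \<Longrightarrow> smooth_fun A h \<Longrightarrow> smooth_fun A (\<lambda>q. f q - h q)"
  by (simp add: smooth_fun_def comp_def open_img smooth_on_diff)

lemma local_rep_img: "c \<in> A \<Longrightarrow> x \<in> img c \<Longrightarrow> local_rep A c X x = in_chart A c (chart_inv c x) (X (chart_inv c x))"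
  by (simp add: local_rep_def)

lemma VF_linear_combination:
  assumes "X \<in> VF A" "Y \<in> VF A" "smooth_fun A f" "smooth_fun A h"
  shows "(\<lambda>q. f q *\<^sub>R X q + h q *\<^sub>R Y q) \<in> VF A"
  unfolding VF_def
proof (intro CollectI ballI)
  fix c assume c: "c \<in> A"
  have "smooth_on (img c) (\<lambda>x. (f \<circ> chart_inv c) x *\<^sub>R local_rep A c X x + (h \<circ> chart_inv c) x *\<^sub>R local_rep A c Y x)"
    by (intro smooth_on_add smooth_on_scaleR open_img c smooth_funD assms VFD)
  then show "smooth_on (img c) (local_rep A c (\<lambda>q. f q *\<^sub>R X q + h q *\<^sub>R Y q))"
    by (rule smooth_on_cong[OF open_img[OF c]])
      (use c in \<open>auto simp: linear_add[OF in_chart_linear] linear_scale[OF in_chart_linear]\<close>)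
qed

lemma VF_add: "X \<in> VF A \<Longrightarrow> Y \<in> VF A \<Longrightarrow> (\<lambda>q. X q + Y q) \<in> VF A"
  using VF_linear_combination[of X Y "\<lambda>_. 1" "\<lambda>_. 1"] by (simp add: smooth_fun_const)

lemma VF_diff: "X \<in> VF A \<Longrightarrow> Y \<in> VF A \<Longrightarrow> (\<lambda>q. X q - Y q) \<in> VF A"
  using VF_linear_combination[of X Y "\<lambda>_. 1" "\<lambda>_. -1"] by (simp add: smooth_fun_const)

lemma VF_scale: "smooth_fun A f \<Longrightarrow> X \<in> VF A \<Longrightarrow> (\<lambda>q. f q *\<^sub>R X q) \<in> VF A"
  using VF_linear_combination[of X X f "\<lambda>_. 0"] by (simp add: smooth_fun_const)

lemma VF_J:
  assumes "X \<in> VF A" shows "(\<lambda>q. J (X q)) \<in> VF A"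
  unfolding VF_def
proof (intro CollectI ballI)
  fix c assume c: "c \<in> A"
  have "bounded_linear (\<lambda>v::complex^'m. \<i> *s v)"
    by (rule linear_conv_bounded_linear[THEN iffD1], rule linearI)
      (simp_all add: vec_eq_iff algebra_simps)
  from smooth_on_linear_compose[OF this open_img[OF c] VFD[OF assms c]]
  show "smooth_on (img c) (local_rep A c (\<lambda>q. J (X q)))"
    by (rule smooth_on_cong[OF open_img[OF c]]) (use c in \<open>auto simp: J_def in_chart_vector_scalar\<close>)
qed

section \<open>Extension by zero of functions and fields given in one chart\<close>

definition ext_fun :: "('a, 'm) chart \<Rightarrow> (complex^'m \<Rightarrow> real) \<Rightarrow> (complex^'m \<Rightarrow> real) \<Rightarrow> 'a \<Rightarrow> real" where
  "ext_fun c \<rho> \<eta> q = (if q \<in> fst c then \<rho> (snd c q) * \<eta> (snd c q) else 0)"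

text \<open>\<open>\<xi>\<close> holds components in the fixed chart \<open>c\<close>, whereas a
  vector field stores components in the chart chosen at each point. These choices may jump from
  point to point, and \<open>trd\<close> compensates for it.\<close>

definition ext_field ::
  "('a, 'm) chart \<Rightarrow> (complex^'m \<Rightarrow> real) \<Rightarrow> (complex^'m \<Rightarrow> complex^'m) \<Rightarrow> ('a, 'm) vfield" where
  "ext_field c \<rho> \<xi> q =
    (if q \<in> fst c then trd c (chart_at A q) (snd c q) (\<rho> (snd c q) *\<^sub>R \<xi> (snd c q)) else 0)"

lemma in_chart_ext_field:
  "c \<in> A \<Longrightarrow> q \<in> fst c \<Longrightarrow> in_chart A c q (ext_field c \<rho> \<xi> q) = \<rho> (snd c q) *\<^sub>R \<xi> (snd c q)"
  by (simp add: ext_field_def in_chart_trd trd_same)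

definition cutoff :: "('a, 'm) chart \<Rightarrow> (complex^'m \<Rightarrow> real) \<Rightarrow> bool" where
  "cutoff c \<rho> \<longleftrightarrow> smooth_on UNIV \<rho> \<and> (\<exists>K. compact K \<and> K \<subseteq> img c \<and> (\<forall>x. x \<notin> K \<longrightarrow> \<rho> x = 0))"

lemma cutoff_smooth: "cutoff c \<rho> \<Longrightarrow> smooth_on S \<rho>"
  unfolding cutoff_def using smooth_on_subset[of UNIV \<rho> S] by blast

text \<open>The part of M over the compact set \<open>K\<close> is compact, hence closed in a
  Hausdorff space; its complement is the neighbourhood sought. This makes extensions by zero smooth
  across the boundary of the chart domain.\<close>

lemma cutoff_vanishes_near:
  assumes "c \<in> A" "cutoff c \<rho>" "q \<notin> fst c"
  obtains U where "open U" "q \<in> U" "\<And>q'. q' \<in> U \<Longrightarrow> q' \<in> fst c \<Longrightarrow> \<rho> (snd c q') = 0"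
proof -
  obtain K where K: "compact K" "K \<subseteq> img c" "\<And>x. x \<notin> K \<Longrightarrow> \<rho> x = 0"
    using assms(2) unfolding cutoff_def by blast
  have "continuous_on K (chart_inv c)"
    by (rule continuous_on_subset[OF _ K(2)])
      (use chart_homeomorphism[OF assms(1)] in \<open>simp add: homeomorphism_def\<close>)
  then have "closed (chart_inv c ` K)"
    using K(1) compact_continuous_image compact_imp_closed by blast
  moreover have "q \<notin> chart_inv c ` K"
    using K(2) assms(3) chart_inv_in_dom by blast
  moreover have "\<rho> (snd c q') = 0" if "q' \<notin> chart_inv c ` K" "q' \<in> fst c" for q'
    using K(3) that assms(1) by (metis chart_inv_apply image_eqI)
  ultimately show thesis
    using that[of "- (chart_inv c ` K)"] by (simp add: open_Compl)
qed

lemma smooth_fun_ext_fun: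
  assumes c: "c \<in> A" "cutoff c \<rho>" and \<eta>: "smooth_on (img c) \<eta>"
  shows "smooth_fun A (ext_fun c \<rho> \<eta>)"
proof (rule smooth_funI)
  fix q
  show "\<exists>c' U. c' \<in> A \<and> open U \<and> q \<in> U \<and> U \<subseteq> fst c' \<and> smooth_on (snd c' ` U) (ext_fun c \<rho> \<eta> \<circ> chart_inv c')"
  proof (cases "q \<in> fst c")
    case True
    have "smooth_on (img c) (\<lambda>x. \<rho> x * \<eta> x)"
      by (rule smooth_on_mult[OF open_img[OF c(1)] cutoff_smooth[OF c(2)] \<eta>])
    then have "smooth_on (img c) (ext_fun c \<rho> \<eta> \<circ> chart_inv c)"
      by (rule smooth_on_cong[OF open_img[OF c(1)]]) (use c in \<open>auto simp: ext_fun_def\<close>)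
    then show ?thesis using True c open_dom by blast
  next
    case False
    obtain U where U: "open U" "q \<in> U" "\<And>q'. q' \<in> U \<Longrightarrow> q' \<in> fst c \<Longrightarrow> \<rho> (snd c q') = 0"
      using cutoff_vanishes_near[OF c False] by metis
    let ?d = "chart_at A q"
    have o: "open (snd ?d ` (fst ?d \<inter> U))" using chart_image_open U by simp
    have "smooth_on (snd ?d ` (fst ?d \<inter> U)) (ext_fun c \<rho> \<eta> \<circ> chart_inv ?d)"
      by (rule smooth_on_cong[OF o smooth_on_const[OF o, of 0]])
        (auto simp: ext_fun_def U(3) chart_inv_apply[OF chart_at_in])
    then show ?thesis using U open_dom[of ?d]
      by (intro exI[of _ ?d] exI[of _ "fst ?d \<inter> U"]) auto
  qed
qed

lemma VF_ext_field:
  assumes c: "c \<in> A" "cutoff c \<rho>" and \<xi>: "smooth_on (img c) \<xi>"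
  shows "ext_field c \<rho> \<xi> \<in> VF A"
proof (rule VFI)
  fix q
  show "\<exists>c' U. c' \<in> A \<and> open U \<and> q \<in> U \<and> U \<subseteq> fst c' \<and> smooth_on (snd c' ` U) (local_rep A c' (ext_field c \<rho> \<xi>))"
  proof (cases "q \<in> fst c")
    case True
    have "smooth_on (img c) (\<lambda>x. \<rho> x *\<^sub>R \<xi> x)"
      by (rule smooth_on_scaleR[OF open_img[OF c(1)] cutoff_smooth[OF c(2)] \<xi>])
    then have "smooth_on (img c) (local_rep A c (ext_field c \<rho> \<xi>))"
      by (rule smooth_on_cong[OF open_img[OF c(1)]]) (use c in \<open>auto simp: in_chart_ext_field\<close>)
    then show ?thesis using True c open_dom by blast
  next
    case False
    obtain U where U: "open U" "q \<in> U" "\<And>q'. q' \<in> U \<Longrightarrow> q' \<in> fst c \<Longrightarrow> \<rho> (snd c q') = 0"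
      using cutoff_vanishes_near[OF c False] by metis
    let ?d = "chart_at A q"
    have o: "open (snd ?d ` (fst ?d \<inter> U))" using chart_image_open U by simp
    have z: "ext_field c \<rho> \<xi> q' = 0" if "q' \<in> U" for q'
      using U(3)[OF that] linear_0[OF trd_linear[OF c(1) chart_at_in _ in_chart_at]] by (simp add: ext_field_def)
    have "smooth_on (snd ?d ` (fst ?d \<inter> U)) (local_rep A ?d (ext_field c \<rho> \<xi>))"
      by (rule smooth_on_cong[OF o smooth_on_const[OF o, of 0]]) (auto simp: z)
    then show ?thesis using U open_dom[of ?d]
      by (intro exI[of _ ?d] exI[of _ "fst ?d \<inter> U"]) auto
  qed
qed

lemma cutoff_exists:
  assumes "c \<in> A" "q \<in> fst c"
  obtains \<rho> r where "cutoff c \<rho>" "r > 0" "ball (snd c q) r \<subseteq> img c" "\<And>x. x \<in> ball (snd c q) r \<Longrightarrow> \<rho> x = 1"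
proof -
  obtain R where R: "R > 0" "cball (snd c q) R \<subseteq> img c"
    using open_img[OF assms(1)] assms(2) open_contains_cball by (metis image_eqI)
  obtain \<rho> :: "complex^'m \<Rightarrow> real" where \<rho>: "smooth_on UNIV \<rho>" "\<And>x. x \<in> ball (snd c q) (R / 2) \<Longrightarrow> \<rho> x = 1"
    "\<And>x. x \<notin> cball (snd c q) R \<Longrightarrow> \<rho> x = 0"
    using smooth_bump_exists[OF R(1)] by blast
  show thesis
  proof (rule that[of \<rho> "R / 2"])
    show "cutoff c \<rho>" using \<rho> R unfolding cutoff_def by (metis compact_cball)
    show "ball (snd c q) (R / 2) \<subseteq> img c"
      using R(1) by (intro subset_trans[OF _ R(2)]) auto
  qed (use R \<rho> in auto)
qed

end

section \<open>Tensoriality and the Lie bracket\<close>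

context complex_manifold
begin

lemma VF_through:
  obtains X where "X \<in> VF A" "X q = v"
proof -
  let ?c = "chart_at A q"
  obtain \<rho> r where \<rho>: "cutoff ?c \<rho>" "r > 0" "\<And>x. x \<in> ball (snd ?c q) r \<Longrightarrow> \<rho> x = 1"
    using cutoff_exists[OF chart_at_in in_chart_at] by metis
  show thesis
  proof (rule that)
    show "ext_field ?c \<rho> (\<lambda>x. v) \<in> VF A"
      by (intro VF_ext_field \<rho> smooth_on_const open_img chart_at_in)
    show "ext_field ?c \<rho> (\<lambda>x. v) q = v"
      using in_chart_ext_field[OF chart_at_in in_chart_at, of q \<rho> "\<lambda>x. v"] \<rho> by simp
  qed
qed

lemma sum_VF:
  assumes "finite I" "\<And>i. i \<in> I \<Longrightarrow> X i \<in> VF A"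
  shows "(\<lambda>q. \<Sum>i\<in>I. X i q) \<in> VF A"
  using assms
proof (induction I)
  case empty
  obtain X where "X \<in> VF A" using VF_through by blast
  from VF_scale[OF smooth_fun_const this, of 0] show ?case by simp
qed (auto intro!: VF_add)

lemma tensorial_sum:
  fixes L :: "('a, 'm) vfield \<Rightarrow> 'b::real_vector"
  assumes add: "\<And>X Y. X \<in> VF A \<Longrightarrow> Y \<in> VF A \<Longrightarrow> L (\<lambda>q. X q + Y q) = L X + L Y"
    and scale: "\<And>f X. smooth_fun A f \<Longrightarrow> X \<in> VF A \<Longrightarrow> L (\<lambda>q. f q *\<^sub>R X q) = f p *\<^sub>R L X"
  shows "finite I \<Longrightarrow> (\<And>i. i \<in> I \<Longrightarrow> X i \<in> VF A) \<Longrightarrow> L (\<lambda>q. \<Sum>i\<in>I. X i q) = (\<Sum>i\<in>I. L (X i))"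
proof (induction I rule: finite_induct)
  case empty
  obtain Z where "Z \<in> VF A" using VF_through by blast
  from scale[OF smooth_fun_const this, of 0] show ?case by simp
next
  case (insert i I)
  then show ?case by (simp add: add sum_VF)
qed

text \<open>By additivity it suffices to treat a field that vanishes at \<open>p\<close>. In a chart
  it is a combination of coordinate fields with coefficients that vanish at \<open>p\<close>;
  cutoffs make this a global identity, which \<open>L\<close> then maps to 0.\<close>

lemma tensorial:
  fixes L :: "('a, 'm) vfield \<Rightarrow> 'b::real_vector"
  assumes add: "\<And>X Y. X \<in> VF A \<Longrightarrow> Y \<in> VF A \<Longrightarrow> L (\<lambda>q. X q + Y q) = L X + L Y"
    and scale: "\<And>f X. smooth_fun A f \<Longrightarrow> X \<in> VF A \<Longrightarrow> L (\<lambda>q. f q *\<^sub>R X q) = f p *\<^sub>R L X"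
    and XY: "X \<in> VF A" "Y \<in> VF A" "X p = Y p"
  shows "L X = L Y"
proof -
  have zero: "L X = 0" if X: "X \<in> VF A" and "X p = 0" for X
  proof -
    let ?c = "chart_at A p"
    obtain \<rho> r where \<rho>: "cutoff ?c \<rho>" "r > 0" "\<And>x. x \<in> ball (snd ?c p) r \<Longrightarrow> \<rho> x = 1"
      using cutoff_exists[OF chart_at_in in_chart_at] by metis
    define a where "a b = ext_fun ?c \<rho> (\<lambda>x. local_rep A ?c X x \<bullet> b)" for b
    define E where "E b = ext_field ?c \<rho> (\<lambda>x. b)" for b
    define h where "h = ext_fun ?c \<rho> (\<lambda>x. 1)"
    have a: "smooth_fun A (a b)" for b
      unfolding a_def
      by (intro smooth_fun_ext_fun \<rho> chart_at_in smooth_on_linear_compose[OF bounded_linear_inner_left]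
          VFD X open_img)
    have E: "E b \<in> VF A" for b
      unfolding E_def by (intro VF_ext_field \<rho> smooth_on_const open_img chart_at_in)
    have h: "smooth_fun A h"
      unfolding h_def by (intro smooth_fun_ext_fun \<rho> chart_at_in smooth_on_const open_img)
    have hp: "h p = 1" using \<rho> by (simp add: h_def ext_fun_def)
    have ap: "a b p = 0" for b using \<open>X p = 0\<close> by (simp add: a_def ext_fun_def)
    \<comment> \<open>One factor \<open>h\<close> comes from the cut-off coefficient
      \<open>a b\<close>, the other from the cut-off frame field \<open>E b\<close>.\<close>
    have eq: "(h q * h q) *\<^sub>R X q = (\<Sum>b\<in>Basis. a b q *\<^sub>R E b q)" for q
    proof (cases "q \<in> fst ?c")
      case True
      note lin = in_chart_linear[OF chart_at_in True]
      have "in_chart A ?c q (\<Sum>b\<in>Basis. a b q *\<^sub>R E b q)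
          = (\<Sum>b\<in>Basis. a b q *\<^sub>R \<rho> (snd ?c q) *\<^sub>R b)"
        by (simp add: linear_sum[OF lin] linear_scale[OF lin] E_def in_chart_ext_field[OF chart_at_in True])
      also have "\<dots> = (\<Sum>b\<in>Basis. (h q * h q) *\<^sub>R (in_chart A ?c q (X q) \<bullet> b) *\<^sub>R b)"
        using True by (intro sum.cong refl) (simp add: a_def h_def ext_fun_def mult_ac)
      also have "\<dots> = (h q * h q) *\<^sub>R in_chart A ?c q (X q)"
        by (simp only: scaleR_sum_right[symmetric] euclidean_representation)
      also have "\<dots> = in_chart A ?c q ((h q * h q) *\<^sub>R X q)"
        by (simp only: linear_scale[OF lin])
      finally show ?thesis using in_chart_inj[OF chart_at_in True] by metis
    qed (simp add: h_def a_def ext_fun_def)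
    have "L X = (h p * h p) *\<^sub>R L X" by (simp add: hp)
    also have "\<dots> = L (\<lambda>q. (h q * h q) *\<^sub>R X q)"
      by (rule scale[symmetric]) (intro smooth_fun_mult h X)+
    also have "\<dots> = (\<Sum>b\<in>Basis. L (\<lambda>q. a b q *\<^sub>R E b q))"
      unfolding eq by (rule tensorial_sum[OF add scale]) (auto intro: VF_scale a E)
    also have "\<dots> = 0" by (simp add: scale[OF a E] ap)
    finally show ?thesis .
  qed
  let ?D = "\<lambda>q. (- 1) *\<^sub>R Y q"
  have D: "?D \<in> VF A" by (rule VF_scale[OF smooth_fun_const XY(2)])
  have "L (\<lambda>q. X q + ?D q) = 0"
    by (rule zero[OF VF_add[OF XY(1) D]]) (simp add: XY)
  then show ?thesis
    using add[OF XY(1) D] scale[OF smooth_fun_const XY(2), of "-1"] by simp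
qed

lemma deriv_along_chart:
  assumes f: "smooth_fun A f" and c: "c \<in> A" "q \<in> fst c"
  shows "deriv_along A X f q = frechet_derivative (f \<circ> chart_inv c) (at (snd c q)) (in_chart A c q (X q))"
proof -
  let ?d = "chart_at A q"
  have "((f \<circ> chart_inv c) has_derivative frechet_derivative (f \<circ> chart_inv c) (at (snd c q))) (at (snd c q))"
    by (rule smooth_on_imp_has_derivative[OF smooth_funD[OF f c(1)]]) (use c in auto)
  then have "((\<lambda>x. (f \<circ> chart_inv c) ((snd c \<circ> chart_inv ?d) x)) has_derivative
      (\<lambda>v. frechet_derivative (f \<circ> chart_inv c) (at (snd c q)) (trd ?d c (snd ?d q) v))) (at (snd ?d q))"
    by (intro has_derivative_compose[OF trd_has_derivative[OF chart_at_in c(1) in_chart_at c(2)]])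
      (simp add: comp_def)
  then have "((f \<circ> chart_inv ?d) has_derivative
      (\<lambda>v. frechet_derivative (f \<circ> chart_inv c) (at (snd c q)) (trd ?d c (snd ?d q) v))) (at (snd ?d q))"
    by (rule has_derivative_transform_within_open[OF _ chart_image_open[OF chart_at_in open_dom[OF c(1)]]])
      (use c in auto)
  from frechet_derivative_at[OF this] show ?thesis
    by (simp add: deriv_along_def in_chart_eq fun_eq_iff)
qed

lemma smooth_fun_deriv_along:
  assumes f: "smooth_fun A f" and X: "X \<in> VF A"
  shows "smooth_fun A (deriv_along A X f)"
  unfolding smooth_fun_def
proof
  fix c assume c: "c \<in> A"
  have "smooth_on (img c) (\<lambda>x. frechet_derivative (f \<circ> chart_inv c) (at x) (local_rep A c X x))"
    by (intro smooth_on_frechet_field open_img c smooth_funD f VFD X)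
  then show "smooth_on (img c) (deriv_along A X f \<circ> chart_inv c)"
    by (rule smooth_on_cong[OF open_img[OF c]]) (use c in \<open>auto simp: deriv_along_chart[OF f c]\<close>)
qed

lemma chart_at_has_derivative:
  assumes "smooth_fun A f"
  shows "((f \<circ> chart_inv (chart_at A q)) has_derivative (\<lambda>v. deriv_along A (\<lambda>_. v) f q))
    (at (snd (chart_at A q) q))"
  unfolding deriv_along_def
  by (rule smooth_on_imp_has_derivative[OF smooth_funD[OF assms chart_at_in]]) auto

lemma deriv_along_pointwise: "X q = v \<Longrightarrow> deriv_along A X f q = deriv_along A (\<lambda>_. v) f q"
  by (simp add: deriv_along_def)

lemma deriv_along_eqI:
  assumes "((f \<circ> chart_inv (chart_at A q)) has_derivative D) (at (snd (chart_at A q) q))"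
  shows "deriv_along A X f q = D (X q)"
  using frechet_derivative_at[OF assms] by (simp add: deriv_along_def)

lemma deriv_along_add:
  assumes "smooth_fun A f" "smooth_fun A h"
  shows "deriv_along A X (\<lambda>q. f q + h q) q = deriv_along A X f q + deriv_along A X h q"
proof -
  have "((\<lambda>x. (f \<circ> chart_inv (chart_at A q)) x + (h \<circ> chart_inv (chart_at A q)) x) has_derivative
      (\<lambda>v. deriv_along A (\<lambda>_. v) f q + deriv_along A (\<lambda>_. v) h q)) (at (snd (chart_at A q) q))"
    by (intro has_derivative_add chart_at_has_derivative assms)
  then have "(((\<lambda>q. f q + h q) \<circ> chart_inv (chart_at A q)) has_derivative
      (\<lambda>v. deriv_along A (\<lambda>_. v) f q + deriv_along A (\<lambda>_. v) h q)) (at (snd (chart_at A q) q))"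
    by (simp add: comp_def chart_inv_apply[OF chart_at_in in_chart_at] add.commute)
  from deriv_along_eqI[OF this, of X] show ?thesis
    by (simp only: deriv_along_pointwise[of X q "X q", OF refl])
qed

lemma deriv_along_mult:
  assumes "smooth_fun A f" "smooth_fun A h"
  shows "deriv_along A X (\<lambda>q. f q * h q) q = deriv_along A X f q * h q + f q * deriv_along A X h q"
proof -
  have "((\<lambda>x. (f \<circ> chart_inv (chart_at A q)) x * (h \<circ> chart_inv (chart_at A q)) x) has_derivative
      (\<lambda>v. (f \<circ> chart_inv (chart_at A q)) (snd (chart_at A q) q) * deriv_along A (\<lambda>_. v) h q +
        deriv_along A (\<lambda>_. v) f q * (h \<circ> chart_inv (chart_at A q)) (snd (chart_at A q) q))) (at (snd (chart_at A q) q))"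
    by (intro has_derivative_mult chart_at_has_derivative assms)
  then have "(((\<lambda>q. f q * h q) \<circ> chart_inv (chart_at A q)) has_derivative
      (\<lambda>v. deriv_along A (\<lambda>_. v) f q * h q + f q * deriv_along A (\<lambda>_. v) h q)) (at (snd (chart_at A q) q))"
    by (simp add: comp_def chart_inv_apply[OF chart_at_in in_chart_at] add.commute)
  from deriv_along_eqI[OF this, of X] show ?thesis
    by (simp only: deriv_along_pointwise[of X q "X q", OF refl])
qed

lemma deriv_along_linear:
  assumes "smooth_fun A f" shows "linear (\<lambda>v. deriv_along A (\<lambda>_. v) f q)"
  using chart_at_has_derivative[OF assms] has_derivative_linear by blast

lemma deriv_along_field_add:
  assumes "smooth_fun A f"
  shows "deriv_along A (\<lambda>q. X q + Y q) f q = deriv_along A X f q + deriv_along A Y f q"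
  using linear_add[OF deriv_along_linear[OF assms]] by (simp add: deriv_along_def)

lemma deriv_along_field_diff:
  assumes "smooth_fun A f"
  shows "deriv_along A (\<lambda>q. X q - Y q) f q = deriv_along A X f q - deriv_along A Y f q"
  using linear_diff[OF deriv_along_linear[OF assms]] by (simp add: deriv_along_def)

lemma deriv_along_field_scale:
  assumes "smooth_fun A f"
  shows "deriv_along A (\<lambda>q. h q *\<^sub>R X q) f q = h q * deriv_along A X f q"
  using linear_scale[OF deriv_along_linear[OF assms]] by (simp add: deriv_along_def)

text \<open>Cut-off coordinates are smooth on all of M, and near \<open>q\<close> their derivatives
  along a field read off its components. A field can thus be studied through its action on
  functions, where no choice of charts interferes.\<close>

lemma coordinate_functions:
  assumes c: "c \<in> A" "q \<in> fst c"
  obtains N and F :: "complex^'m \<Rightarrow> 'a \<Rightarrow> real" where "open N" "q \<in> N" "N \<subseteq> fst c" "\<And>b. smooth_fun A (F b)"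
    "\<And>X b q'. q' \<in> N \<Longrightarrow> deriv_along A X (F b) q' = in_chart A c q' (X q') \<bullet> b"
proof -
  obtain \<rho> r where \<rho>: "cutoff c \<rho>" "r > 0" "ball (snd c q) r \<subseteq> img c" "\<And>x. x \<in> ball (snd c q) r \<Longrightarrow> \<rho> x = 1"
    using cutoff_exists[OF c] by metis
  define N where "N = fst c \<inter> snd c -` ball (snd c q) r"
  define F where "F b = ext_fun c \<rho> (\<lambda>x. x \<bullet> b)" for b
  show thesis
  proof (rule that)
    show "open N" unfolding N_def by (intro chart_preimage_open c open_ball)
    show "q \<in> N" "N \<subseteq> fst c" using c \<rho> by (auto simp: N_def)
    show sm: "smooth_fun A (F b)" for b
      unfolding F_def
      by (intro smooth_fun_ext_fun c \<rho> smooth_on_linear bounded_linear_inner_left open_img)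
    show "deriv_along A X (F b) q' = in_chart A c q' (X q') \<bullet> b" if "q' \<in> N" for X b q'
    proof -
      have q': "q' \<in> fst c" "snd c q' \<in> ball (snd c q) r" using that by (auto simp: N_def)
      have "((\<lambda>x. x \<bullet> b) has_derivative (\<lambda>x. x \<bullet> b)) (at (snd c q'))"
        by (rule bounded_linear_imp_has_derivative[OF bounded_linear_inner_left])
      then have "((F b \<circ> chart_inv c) has_derivative (\<lambda>x. x \<bullet> b)) (at (snd c q'))"
        by (rule has_derivative_transform_within_open[OF _ open_ball q'(2)])
          (use \<rho> c in \<open>auto simp: F_def ext_fun_def subset_iff\<close>)
      from frechet_derivative_at[OF this, symmetric] show ?thesis
        by (simp add: deriv_along_chart[OF sm c(1) q'(1)])
    qed
  qed
qed

lemma vector_eqI_deriv_along: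
  assumes "\<And>f. smooth_fun A f \<Longrightarrow> deriv_along A X f q = deriv_along A Y f q"
  shows "X q = Y q"
proof -
  obtain N F where N: "q \<in> N" "\<And>b. smooth_fun A (F b)"
    "\<And>X b q'. q' \<in> N \<Longrightarrow> deriv_along A X (F b) q' = in_chart A (chart_at A q) q' (X q') \<bullet> b"
    using coordinate_functions[OF chart_at_in in_chart_at] by metis
  have "X q \<bullet> b = Y q \<bullet> b" for b
    using N(3)[OF N(1), of X b] N(3)[OF N(1), of Y b] assms[OF N(2)[of b]] by simp
  then show ?thesis by (simp add: euclidean_eq_iff[of "X q"])
qed

text \<open>The components are the derivatives of the coordinate functions. The criterion is meant
  for the Lie bracket, whose definition refers to another chosen chart at each point.\<close>

lemma VF_if_deriv_along_smooth:
  assumes "\<And>f. smooth_fun A f \<Longrightarrow> smooth_fun A (deriv_along A X f)"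
  shows "X \<in> VF A"
proof (rule VFI)
  fix q
  let ?c = "chart_at A q"
  obtain N F where N: "open N" "q \<in> N" "N \<subseteq> fst ?c" "\<And>b. smooth_fun A (F b)"
    "\<And>X b q'. q' \<in> N \<Longrightarrow> deriv_along A X (F b) q' = in_chart A ?c q' (X q') \<bullet> b"
    using coordinate_functions[OF chart_at_in in_chart_at] by metis
  have o: "open (snd ?c ` N)" using chart_image_open[OF chart_at_in N(1), of q] N(3) by (simp add: Int_absorb1)
  have "smooth_on (snd ?c ` N) (\<lambda>x. local_rep A ?c X x \<bullet> b)" for b
  proof -
    have "smooth_on (snd ?c ` N) (deriv_along A X (F b) \<circ> chart_inv ?c)"
      by (rule smooth_on_subset[OF smooth_funD[OF assms[OF N(4)] chart_at_in]]) (use N(3) in auto)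
    then show ?thesis
      by (rule smooth_on_cong[OF o])
        (use N(3,5) in \<open>auto simp: subset_iff chart_inv_apply[OF chart_at_in] local_rep_chart[OF chart_at_in]\<close>)
  qed
  then have "smooth_on (snd ?c ` N) (local_rep A ?c X)"
    by (rule smooth_on_componentwise[OF o])
  then show "\<exists>c U. c \<in> A \<and> open U \<and> q \<in> U \<and> U \<subseteq> fst c \<and> smooth_on (snd c ` U) (local_rep A c X)"
    using N chart_at_in by blast
qed

text \<open>In a chart the second-order parts of X(Yf) and Y(Xf) agree by symmetry, and the
  first-order parts are the bracket. Later identities for brackets are all checked on functions by
  means of this formula.\<close>

lemma deriv_along_lie_bracket:
  assumes f: "smooth_fun A f" and X: "X \<in> VF A" and Y: "Y \<in> VF A"
  shows "deriv_along A (lie_bracket A X Y) f q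
    = deriv_along A X (deriv_along A Y f) q - deriv_along A Y (deriv_along A X f) q"
proof -
  let ?c = "chart_at A q"
  let ?x = "snd ?c q" and ?F = "f \<circ> chart_inv ?c"
  have x: "?x \<in> img ?c" by simp
  have F: "smooth_on (img ?c) ?F" by (rule smooth_funD[OF f chart_at_in])
  note sm = VFD[OF _ chart_at_in]
  have second: "deriv_along A X (deriv_along A Y f) q =
      frechet_derivative (\<lambda>y. frechet_derivative ?F (at y) (Y q)) (at ?x) (X q)
      + frechet_derivative ?F (at ?x) (frechet_derivative (local_rep A ?c Y) (at ?x) (X q))"
    if X: "X \<in> VF A" and Y: "Y \<in> VF A" for X Y
  proof -
    \<comment> \<open>At points near \<open>q\<close>, \<open>deriv_along\<close> refers to the
      charts chosen there; it has to be rewritten in the fixed chart \<open>?c\<close> before it is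
      differentiated.\<close>
    have "frechet_derivative (deriv_along A Y f \<circ> chart_inv ?c) (at ?x)
        = frechet_derivative (\<lambda>y. frechet_derivative ?F (at y) (local_rep A ?c Y y)) (at ?x)"
      by (rule frechet_derivative_cong_open[OF _ open_img[OF chart_at_in] x])
        (auto intro!: smooth_on_imp_differentiable[OF smooth_funD[OF smooth_fun_deriv_along[OF f Y] chart_at_in]]
          simp: deriv_along_chart[OF f chart_at_in] local_rep_img[OF chart_at_in])
    then show ?thesis
      unfolding deriv_along_def[of A X]
      by (simp add: frechet_derivative_along_field[OF open_img[OF chart_at_in] F sm[OF Y] x])
  qed
  have lin: "linear (frechet_derivative ?F (at ?x))"
    by (rule linear_frechet_derivative[OF smooth_on_imp_differentiable[OF F x]])
  have "frechet_derivative (\<lambda>y. frechet_derivative ?F (at y) (Y q)) (at ?x) (X q)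
      = frechet_derivative (\<lambda>y. frechet_derivative ?F (at y) (X q)) (at ?x) (Y q)"
    by (rule second_derivative_symmetric[OF open_img[OF chart_at_in] F x])
  then show ?thesis
    unfolding second[OF X Y] second[OF Y X]
    by (simp add: deriv_along_def lie_bracket_def Let_def linear_diff[OF lin])
qed

lemma VF_lie_bracket:
  assumes "X \<in> VF A" "Y \<in> VF A" shows "lie_bracket A X Y \<in> VF A"
proof (rule VF_if_deriv_along_smooth)
  fix f assume f: "smooth_fun A f"
  have "deriv_along A (lie_bracket A X Y) f
    = (\<lambda>q. deriv_along A X (deriv_along A Y f) q - deriv_along A Y (deriv_along A X f) q)"
    by (rule ext) (rule deriv_along_lie_bracket[OF f assms])
  then show "smooth_fun A (deriv_along A (lie_bracket A X Y) f)"
    by (simp add: smooth_fun_diff smooth_fun_deriv_along f assms)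
qed

lemma lie_bracket_commute: "lie_bracket A X Y q = - lie_bracket A Y X q"
  by (simp add: lie_bracket_def Let_def)

lemma lie_bracket_add_left:
  assumes "X \<in> VF A" "X' \<in> VF A" "Y \<in> VF A"
  shows "lie_bracket A (\<lambda>q. X q + X' q) Y q = lie_bracket A X Y q + lie_bracket A X' Y q"
proof -
  have "lie_bracket A (\<lambda>q. X q + X' q) Y q = (\<lambda>q. lie_bracket A X Y q + lie_bracket A X' Y q) q"
  proof (rule vector_eqI_deriv_along)
    fix f assume f: "smooth_fun A f"
    have e: "deriv_along A (\<lambda>q. X q + X' q) f = (\<lambda>q. deriv_along A X f q + deriv_along A X' f q)"
      by (rule ext) (rule deriv_along_field_add[OF f])
    show "deriv_along A (lie_bracket A (\<lambda>q. X q + X' q) Y) f q =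
        deriv_along A (\<lambda>q. lie_bracket A X Y q + lie_bracket A X' Y q) f q"
      by (simp add: deriv_along_lie_bracket f assms VF_add deriv_along_field_add smooth_fun_deriv_along e
          deriv_along_add)
  qed
  then show ?thesis .
qed

lemma lie_bracket_scale_left:
  assumes "X \<in> VF A" "Y \<in> VF A" and h: "smooth_fun A h"
  shows "lie_bracket A (\<lambda>q. h q *\<^sub>R X q) Y q = h q *\<^sub>R lie_bracket A X Y q - deriv_along A Y h q *\<^sub>R X q"
proof -
  have "lie_bracket A (\<lambda>q. h q *\<^sub>R X q) Y q = (\<lambda>q. h q *\<^sub>R lie_bracket A X Y q - deriv_along A Y h q *\<^sub>R X q) q"
  proof (rule vector_eqI_deriv_along)
    fix f assume f: "smooth_fun A f"
    have e: "deriv_along A (\<lambda>q. h q *\<^sub>R X q) f = (\<lambda>q. h q * deriv_along A X f q)"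
      by (rule ext) (rule deriv_along_field_scale[OF f])
    show "deriv_along A (lie_bracket A (\<lambda>q. h q *\<^sub>R X q) Y) f q =
        deriv_along A (\<lambda>q. h q *\<^sub>R lie_bracket A X Y q - deriv_along A Y h q *\<^sub>R X q) f q"
      by (simp add: deriv_along_lie_bracket f h assms VF_scale deriv_along_field_diff deriv_along_field_scale
          smooth_fun_deriv_along e deriv_along_mult algebra_simps)
  qed
  then show ?thesis .
qed

end

section \<open>Torsion and curvature of a Hermitian connection\<close>

locale hermitian_connection_manifold = complex_manifold A
  for A :: "('a::{t2_space,second_countable_topology}, 'm::finite) chart set" +
  fixes g :: "('a, 'm) metric" and nabla :: "('a, 'm) connection"
  assumes metric: "hermitian_metric A g"
    and connection: "hermitian_connection A g nabla"
begin

lemma g_bilinear: "bilinear (g q)"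
  and g_sym: "g q u v = g q v u"
  and g_pos: "u \<noteq> 0 \<Longrightarrow> g q u u > 0"
  and g_JJ: "g q (J u) (J v) = g q u v"
  and smooth_fun_g: "X \<in> VF A \<Longrightarrow> Y \<in> VF A \<Longrightarrow> smooth_fun A (\<lambda>q. g q (X q) (Y q))"
  using metric unfolding hermitian_metric_def by blast+

lemmas g_add_left = bilinear_ladd[OF g_bilinear]
  and g_add_right = bilinear_radd[OF g_bilinear]
  and g_diff_left = bilinear_lsub[OF g_bilinear]
  and g_diff_right = bilinear_rsub[OF g_bilinear]
  and g_scale_left = bilinear_lmul[OF g_bilinear]
  and g_scale_right = bilinear_rmul[OF g_bilinear]
  and g_minus_left = bilinear_lneg[OF g_bilinear]
  and g_minus_right = bilinear_rneg[OF g_bilinear]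
  and g_zero_left = bilinear_lzero[OF g_bilinear]

lemma J_J [simp]: "J (J v) = - v"
  by (simp add: J_def vec_eq_iff)

lemma J_linear: "linear (J :: complex^'m \<Rightarrow> complex^'m)"
  by (rule linearI) (simp_all add: J_def vec_eq_iff algebra_simps)

lemma g_J_left: "g q (J u) v = - g q u (J v)"
  using g_JJ[of q u "J v"] by (simp add: g_minus_right)

lemma affine: "affine_connection A nabla"
  using connection unfolding hermitian_connection_def by blast

lemma VF_nabla: "X \<in> VF A \<Longrightarrow> Y \<in> VF A \<Longrightarrow> nabla X Y \<in> VF A"
  and nabla_add_left: "X \<in> VF A \<Longrightarrow> X' \<in> VF A \<Longrightarrow> Y \<in> VF A \<Longrightarrow>
    nabla (\<lambda>q. X q + X' q) Y = (\<lambda>q. nabla X Y q + nabla X' Y q)"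
  and nabla_scale_left: "smooth_fun A f \<Longrightarrow> X \<in> VF A \<Longrightarrow> Y \<in> VF A \<Longrightarrow>
    nabla (\<lambda>q. f q *\<^sub>R X q) Y = (\<lambda>q. f q *\<^sub>R nabla X Y q)"
  and nabla_add_right: "X \<in> VF A \<Longrightarrow> Y \<in> VF A \<Longrightarrow> Y' \<in> VF A \<Longrightarrow>
    nabla X (\<lambda>q. Y q + Y' q) = (\<lambda>q. nabla X Y q + nabla X Y' q)"
  and nabla_scale_right: "smooth_fun A f \<Longrightarrow> X \<in> VF A \<Longrightarrow> Y \<in> VF A \<Longrightarrow>
    nabla X (\<lambda>q. f q *\<^sub>R Y q) = (\<lambda>q. deriv_along A X f q *\<^sub>R Y q + f q *\<^sub>R nabla X Y q)"
  using affine unfolding affine_connection_def fun_eq_iff by blast+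

lemma deriv_along_g:
  "X \<in> VF A \<Longrightarrow> Y \<in> VF A \<Longrightarrow> Z \<in> VF A \<Longrightarrow>
    deriv_along A X (\<lambda>q. g q (Y q) (Z q)) q = g q (nabla X Y q) (Z q) + g q (Y q) (nabla X Z q)"
  and nabla_J: "X \<in> VF A \<Longrightarrow> Y \<in> VF A \<Longrightarrow> nabla X (\<lambda>q. J (Y q)) = (\<lambda>q. J (nabla X Y q))"
  using connection unfolding hermitian_connection_def fun_eq_iff by blast+

lemma nabla_pointwise:
  assumes "X \<in> VF A" "X' \<in> VF A" "Y \<in> VF A" "X q = X' q"
  shows "nabla X Y q = nabla X' Y q"
  by (rule tensorial[where p = q and L = "\<lambda>X. nabla X Y q"])
    (use assms in \<open>auto simp: nabla_add_left nabla_scale_left\<close>)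

lemma nabla_at_eq: "X \<in> VF A \<Longrightarrow> Y \<in> VF A \<Longrightarrow> nabla_at A nabla q (X q) Y = nabla X Y q"
  unfolding nabla_at_def by (rule the_equality) (use nabla_pointwise in blast)+

lemma nabla_minus_left:
  "X \<in> VF A \<Longrightarrow> Y \<in> VF A \<Longrightarrow> nabla (\<lambda>q. - X q) Y = (\<lambda>q. - nabla X Y q)"
  using nabla_scale_left[OF smooth_fun_const[of "-1"], of X Y] by simp

lemma nabla_diff_left:
  assumes "X \<in> VF A" "X' \<in> VF A" "Y \<in> VF A"
  shows "nabla (\<lambda>q. X q - X' q) Y = (\<lambda>q. nabla X Y q - nabla X' Y q)"
  using nabla_add_left[OF assms(1) VF_scale[OF smooth_fun_const[of "-1"] assms(2)] assms(3)]
    nabla_minus_left[OF assms(2,3)] by simp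

lemma VF_torsion:
  assumes "X \<in> VF A" "Y \<in> VF A" shows "torsion A nabla X Y \<in> VF A"
proof -
  have "(\<lambda>q. nabla X Y q - nabla Y X q - lie_bracket A X Y q) \<in> VF A"
    by (intro VF_diff VF_nabla VF_lie_bracket assms)
  then show ?thesis by (simp add: torsion_def[abs_def])
qed

lemma torsion_commute: "torsion A nabla X Y q = - torsion A nabla Y X q"
  using lie_bracket_commute[of X Y q] by (simp add: torsion_def)

lemma torsion_add_left:
  "X \<in> VF A \<Longrightarrow> X' \<in> VF A \<Longrightarrow> Y \<in> VF A \<Longrightarrow>
    torsion A nabla (\<lambda>q. X q + X' q) Y q = torsion A nabla X Y q + torsion A nabla X' Y q"
  by (simp add: torsion_def nabla_add_left nabla_add_right lie_bracket_add_left)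

lemma torsion_scale_left:
  "X \<in> VF A \<Longrightarrow> Y \<in> VF A \<Longrightarrow> smooth_fun A f \<Longrightarrow>
    torsion A nabla (\<lambda>q. f q *\<^sub>R X q) Y q = f q *\<^sub>R torsion A nabla X Y q"
  by (simp add: torsion_def nabla_scale_left nabla_scale_right lie_bracket_scale_left algebra_simps)

lemma torsion_pointwise_left:
  assumes "X \<in> VF A" "X' \<in> VF A" "Y \<in> VF A" "X q = X' q"
  shows "torsion A nabla X Y q = torsion A nabla X' Y q"
  by (rule tensorial[where p = q and L = "\<lambda>X. torsion A nabla X Y q"])
    (use assms in \<open>auto simp: torsion_add_left torsion_scale_left\<close>)

lemma torsion_pointwise:
  assumes "X \<in> VF A" "X' \<in> VF A" "Y \<in> VF A" "Y' \<in> VF A" "X q = X' q" "Y q = Y' q"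
  shows "torsion A nabla X Y q = torsion A nabla X' Y' q"
  using torsion_pointwise_left[OF assms(1,2,3,5)] torsion_pointwise_left[OF assms(3,4,2,6)]
    torsion_commute[of X'] by metis

definition through :: "'a \<Rightarrow> complex^'m \<Rightarrow> ('a, 'm) vfield" where
  "through q v = (SOME X. X \<in> VF A \<and> X q = v)"

lemma VF_of_through [simp]: "through q v \<in> VF A" and through_apply [simp]: "through q v q = v"
proof -
  have "\<exists>X. X \<in> VF A \<and> X q = v" using VF_through by metis
  from someI_ex[OF this] show "through q v \<in> VF A" "through q v q = v"
    by (auto simp: through_def)
qed

definition torsion_at :: "'a \<Rightarrow> complex^'m \<Rightarrow> complex^'m \<Rightarrow> complex^'m" where
  "torsion_at q u v = torsion A nabla (through q u) (through q v) q"

lemma torsion_at_eq: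
  "X \<in> VF A \<Longrightarrow> Y \<in> VF A \<Longrightarrow> torsion A nabla X Y q = torsion_at q (X q) (Y q)"
  unfolding torsion_at_def by (rule torsion_pointwise) auto

lemma torsion_at_commute: "torsion_at q u v = - torsion_at q v u"
  unfolding torsion_at_def by (rule torsion_commute)

lemma torsion_at_bilinear: "bilinear (torsion_at q)"
proof -
  have "linear (\<lambda>u. torsion_at q u v)" for v
  proof (rule linearI)
    fix u u' :: "complex^'m" and r :: real
    have "torsion_at q (u + u') v = torsion A nabla (\<lambda>x. through q u x + through q u' x) (through q v) q"
      using torsion_at_eq[OF VF_add[of "through q u" "through q u'"], of "through q v" q] by simp
    then show "torsion_at q (u + u') v = torsion_at q u v + torsion_at q u' v"
      by (simp add: torsion_add_left torsion_at_def)
    have "torsion_at q (r *\<^sub>R u) v = torsion A nabla (\<lambda>x. r *\<^sub>R through q u x) (through q v) q"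
      using torsion_at_eq[OF VF_scale[OF smooth_fun_const[of r], of "through q u"], of "through q v" q] by simp
    then show "torsion_at q (r *\<^sub>R u) v = r *\<^sub>R torsion_at q u v"
      by (simp add: torsion_scale_left[OF _ _ smooth_fun_const[of r]] torsion_at_def)
  qed
  moreover from linear_compose_neg[OF this] have "linear (torsion_at q v)" for v
    by (subst arg_cong[where f = linear, OF ext, OF torsion_at_commute])
  ultimately show ?thesis by (simp add: bilinear_def)
qed

section \<open>The curvature tensor and its symmetries\<close>

lemma curvature_commute:
  assumes "X \<in> VF A" "Y \<in> VF A" "Z \<in> VF A"
  shows "curvature A nabla X Y Z q = - curvature A nabla Y X Z q"
proof -
  have "lie_bracket A X Y = (\<lambda>q. - lie_bracket A Y X q)" by (rule ext) (rule lie_bracket_commute)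
  then show ?thesis
    by (simp add: curvature_def nabla_minus_left VF_lie_bracket assms)
qed

lemma curvature_pointwise_left:
  assumes "X \<in> VF A" "X' \<in> VF A" "Y \<in> VF A" "Z \<in> VF A" "X q = X' q"
  shows "curvature A nabla X Y Z q = curvature A nabla X' Y Z q"
proof (rule tensorial[where p = q and L = "\<lambda>X. curvature A nabla X Y Z q"])
  fix X X' assume X: "X \<in> VF A" "X' \<in> VF A"
  have "lie_bracket A (\<lambda>q. X q + X' q) Y = (\<lambda>q. lie_bracket A X Y q + lie_bracket A X' Y q)"
    by (rule ext) (simp add: lie_bracket_add_left X assms)
  then show "curvature A nabla (\<lambda>q. X q + X' q) Y Z q = curvature A nabla X Y Z q + curvature A nabla X' Y Z q"
    using X assms by (simp add: curvature_def nabla_add_left nabla_add_right VF_nabla VF_lie_bracket)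
next
  fix f X assume f: "smooth_fun A f" and X: "X \<in> VF A"
  have "lie_bracket A (\<lambda>q. f q *\<^sub>R X q) Y = (\<lambda>q. f q *\<^sub>R lie_bracket A X Y q - deriv_along A Y f q *\<^sub>R X q)"
    by (rule ext) (simp add: lie_bracket_scale_left f X assms)
  then show "curvature A nabla (\<lambda>q. f q *\<^sub>R X q) Y Z q = f q *\<^sub>R curvature A nabla X Y Z q"
    using X f assms
    by (simp add: curvature_def nabla_scale_left nabla_scale_right nabla_diff_left VF_nabla VF_lie_bracket
        VF_scale smooth_fun_deriv_along algebra_simps)
qed (use assms in auto)

lemma curvature_add_right:
  assumes "X \<in> VF A" "Y \<in> VF A" "Z \<in> VF A" "Z' \<in> VF A"
  shows "curvature A nabla X Y (\<lambda>q. Z q + Z' q) q = curvature A nabla X Y Z q + curvature A nabla X Y Z' q"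
  using assms by (simp add: curvature_def nabla_add_right VF_nabla VF_lie_bracket)

text \<open>All derivatives of \<open>f\<close> cancel: the first-order ones in pairs, the
  second-order ones because [X,Y] acts on \<open>f\<close> as the commutator of X and Y.\<close>

lemma curvature_scale_right:
  assumes "X \<in> VF A" "Y \<in> VF A" "Z \<in> VF A" "smooth_fun A f"
  shows "curvature A nabla X Y (\<lambda>q. f q *\<^sub>R Z q) q = f q *\<^sub>R curvature A nabla X Y Z q"
  using assms
  by (simp add: curvature_def nabla_scale_right nabla_add_right VF_nabla VF_lie_bracket VF_scale
      smooth_fun_deriv_along deriv_along_lie_bracket algebra_simps)

lemma curvature_pointwise_right:
  assumes "X \<in> VF A" "Y \<in> VF A" "Z \<in> VF A" "Z' \<in> VF A" "Z q = Z' q"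
  shows "curvature A nabla X Y Z q = curvature A nabla X Y Z' q"
  by (rule tensorial[where p = q and L = "\<lambda>Z. curvature A nabla X Y Z q"])
    (use assms in \<open>auto simp: curvature_add_right curvature_scale_right\<close>)

lemma curvature_pointwise:
  assumes VF: "X \<in> VF A" "Y \<in> VF A" "Z \<in> VF A" "X' \<in> VF A" "Y' \<in> VF A" "Z' \<in> VF A"
    and eq: "X q = X' q" "Y q = Y' q" "Z q = Z' q"
  shows "curvature A nabla X Y Z q = curvature A nabla X' Y' Z' q"
proof -
  have "curvature A nabla X Y Z q = curvature A nabla X' Y Z q"
    by (rule curvature_pointwise_left) (use assms in auto)
  also have "\<dots> = - curvature A nabla Y X' Z q" by (rule curvature_commute) (use assms in auto)
  also have "\<dots> = - curvature A nabla Y' X' Z q"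
    using curvature_pointwise_left[of Y Y' X' Z q] assms by simp
  also have "\<dots> = curvature A nabla X' Y' Z q"
    using curvature_commute[of Y' X' Z q] assms by simp
  also have "\<dots> = curvature A nabla X' Y' Z' q"
    by (rule curvature_pointwise_right) (use assms in auto)
  finally show ?thesis .
qed

lemma curvature_at_eq:
  assumes "X \<in> VF A" "Y \<in> VF A" "Z \<in> VF A"
  shows "curvature_at A nabla q (X q) (Y q) (Z q) = curvature A nabla X Y Z q"
  unfolding curvature_at_def
proof (rule the_equality)
  show "\<forall>X'\<in>VF A. \<forall>Y'\<in>VF A. \<forall>Z'\<in>VF A. X' q = X q \<longrightarrow> Y' q = Y q \<longrightarrow> Z' q = Z q \<longrightarrow>
      curvature A nabla X' Y' Z' q = curvature A nabla X Y Z q"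
    using curvature_pointwise assms by blast
qed (use assms in blast)

lemma curvature_at_through:
  "Z \<in> VF A \<Longrightarrow> curvature_at A nabla q u v (Z q) = curvature A nabla (through q u) (through q v) Z q"
  using curvature_at_eq[of "through q u" "through q v" Z q] by simp

lemma curvature_at_linear: "linear (curvature_at A nabla q u v)"
proof (rule linearI)
  fix w w' :: "complex^'m" and r :: real
  show "curvature_at A nabla q u v (w + w') = curvature_at A nabla q u v w + curvature_at A nabla q u v w'"
    using curvature_at_through[OF VF_add[of "through q w" "through q w'"], of q u v]
      curvature_at_through[of "through q w" q u v] curvature_at_through[of "through q w'" q u v]
    by (simp add: curvature_add_right)
  show "curvature_at A nabla q u v (r *\<^sub>R w) = r *\<^sub>R curvature_at A nabla q u v w"
    using curvature_at_through[OF VF_scale[OF smooth_fun_const[of r], of "through q w"], of q u v]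
      curvature_at_through[of "through q w" q u v]
    by (simp add: curvature_scale_right[OF _ _ _ smooth_fun_const[of r]])
qed

lemma curvature_at_J: "curvature_at A nabla q u v (J w) = J (curvature_at A nabla q u v w)"
  using curvature_at_through[OF VF_J[of "through q w"], of q u v]
    curvature_at_through[of "through q w" q u v]
  by (simp add: curvature_def nabla_J VF_nabla VF_lie_bracket linear_diff[OF J_linear])

text \<open>[X,Y] acts on the function g(Z,W) as the commutator of X and Y. Expanding both sides by
  metric compatibility, the mixed products of first covariant derivatives cancel.\<close>

lemma curvature_skew:
  assumes "X \<in> VF A" "Y \<in> VF A" "Z \<in> VF A" "W \<in> VF A"
  shows "g q (curvature A nabla X Y Z q) (W q) = - g q (Z q) (curvature A nabla X Y W q)"
proof -
  let ?a = "\<lambda>q. g q (Z q) (W q)"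
  have second: "deriv_along A X (deriv_along A Y ?a) q
      = g q (nabla X (nabla Y Z) q) (W q) + g q (nabla Y Z q) (nabla X W q)
      + (g q (nabla X Z q) (nabla Y W q) + g q (Z q) (nabla X (nabla Y W) q))"
    if "X \<in> VF A" "Y \<in> VF A" for X Y
  proof -
    have "deriv_along A Y ?a = (\<lambda>q. g q (nabla Y Z q) (W q) + g q (Z q) (nabla Y W q))"
      by (rule ext) (simp add: deriv_along_g that assms)
    then show ?thesis
      by (simp add: deriv_along_add smooth_fun_g deriv_along_g that assms VF_nabla)
  qed
  have "deriv_along A (lie_bracket A X Y) ?a q
      = deriv_along A X (deriv_along A Y ?a) q - deriv_along A Y (deriv_along A X ?a) q"
    by (rule deriv_along_lie_bracket) (use assms in \<open>auto simp: smooth_fun_g\<close>)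
  then have "g q (nabla (lie_bracket A X Y) Z q) (W q) + g q (Z q) (nabla (lie_bracket A X Y) W q)
      = deriv_along A X (deriv_along A Y ?a) q - deriv_along A Y (deriv_along A X ?a) q"
    by (simp add: deriv_along_g VF_lie_bracket assms)
  then show ?thesis
    unfolding second[OF assms(1,2)] second[OF assms(2,1)]
    by (simp add: curvature_def g_diff_left g_diff_right)
qed

lemma curvature_at_skew: "g q (curvature_at A nabla q u v w) z = - g q w (curvature_at A nabla q u v z)"
  using curvature_skew[of "through q u" "through q v" "through q w" "through q z" q]
    curvature_at_through[of "through q w" q u v] curvature_at_through[of "through q z" q u v]
  by simp

text \<open>Zero torsion turns every bracket into a difference of covariant derivatives. As the
  metric and J are parallel, so is the fundamental form, and its skew symmetry makes the terms
  cancel in pairs.\<close>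

lemma kaehler_if_torsion_free:
  assumes "\<And>q u v. torsion_at q u v = 0"
  shows "kaehler A g"
  unfolding kaehler_def
proof (intro ballI allI)
  fix X Y Z q assume VF: "X \<in> VF A" "Y \<in> VF A" "Z \<in> VF A"
  have bracket: "lie_bracket A X Y q = nabla X Y q - nabla Y X q" if "X \<in> VF A" "Y \<in> VF A" for X Y
    using torsion_at_eq[OF that, of q] assms by (simp add: torsion_def)
  have der: "deriv_along A X (fundamental_form g Y Z) q
      = g q (J (nabla X Y q)) (Z q) + g q (J (Y q)) (nabla X Z q)"
    if "X \<in> VF A" "Y \<in> VF A" "Z \<in> VF A" for X Y Z
    using deriv_along_g[OF that(1) VF_J[OF that(2)] that(3), of q] nabla_J[OF that(1,2)]
    by (simp add: fundamental_form_def[abs_def])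
  have skew: "g q (J u) v = - g q (J v) u" for u v
    using g_J_left[of q u v] g_sym by metis
  show "ext_deriv2 A (fundamental_form g) X Y Z q = 0"
    using VF skew[of "Y q" "nabla X Z q"] skew[of "X q" "nabla Y Z q"] skew[of "X q" "nabla Z Y q"]
    by (simp add: ext_deriv2_def der fundamental_form_def bracket linear_diff[OF J_linear] g_diff_left)
qed

end

locale parallel_torsion_manifold = hermitian_connection_manifold A g nabla
  for A :: "('a::{t2_space,second_countable_topology}, 'm::finite) chart set" and g nabla +
  assumes parallel: "parallel_torsion A nabla"
begin

lemma nabla_torsion:
  assumes "X \<in> VF A" "Y \<in> VF A" "Z \<in> VF A"
  shows "nabla X (torsion A nabla Y Z) = (\<lambda>q. torsion A nabla (nabla X Y) Z q + torsion A nabla Y (nabla X Z) q)"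
proof
  fix q show "nabla X (torsion A nabla Y Z) q = torsion A nabla (nabla X Y) Z q + torsion A nabla Y (nabla X Z) q"
  proof -
    have "nabla X (torsion A nabla Y Z) q - torsion A nabla (nabla X Y) Z q - torsion A nabla Y (nabla X Z) q = 0"
      using parallel assms unfolding parallel_torsion_def by blast
    then show ?thesis by (simp add: algebra_simps)
  qed
qed

text \<open>For a parallel T the Leibniz rule holds twice in succession; the mixed terms are
  symmetric in X and Y and drop out of the commutator. So curvature acts on T as a derivation that
  kills it.\<close>

lemma curvature_torsion:
  assumes "X \<in> VF A" "Y \<in> VF A" "Z \<in> VF A" "W \<in> VF A"
  shows "curvature A nabla X Y (torsion A nabla Z W) q
    = torsion_at q (curvature A nabla X Y Z q) (W q) + torsion_at q (Z q) (curvature A nabla X Y W q)"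
proof -
  have "nabla X (nabla Y (torsion A nabla Z W)) q
      = torsion_at q (nabla X (nabla Y Z) q) (W q) + torsion_at q (nabla Y Z q) (nabla X W q)
      + (torsion_at q (nabla X Z q) (nabla Y W q) + torsion_at q (Z q) (nabla X (nabla Y W) q))"
    if "X \<in> VF A" "Y \<in> VF A" for X Y
  proof -
    have "nabla X (nabla Y (torsion A nabla Z W)) q
      = torsion A nabla (nabla X (nabla Y Z)) W q + torsion A nabla (nabla Y Z) (nabla X W) q
      + (torsion A nabla (nabla X Z) (nabla Y W) q + torsion A nabla Z (nabla X (nabla Y W)) q)"
      by (simp add: nabla_torsion that assms VF_nabla nabla_add_right VF_torsion)
    then show ?thesis by (simp add: torsion_at_eq that assms VF_nabla)
  qed
  then show ?thesis
    by (simp add: curvature_def assms nabla_torsion VF_lie_bracket torsion_at_eq VF_nabla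
        bilinear_lsub[OF torsion_at_bilinear] bilinear_rsub[OF torsion_at_bilinear])
qed

lemma curvature_at_torsion_at:
  "curvature_at A nabla q u v (torsion_at q w z)
    = torsion_at q (curvature_at A nabla q u v w) z + torsion_at q w (curvature_at A nabla q u v z)"
  using curvature_torsion[of "through q u" "through q v" "through q w" "through q z" q]
    curvature_at_through[of "through q w" q u v] curvature_at_through[of "through q z" q u v]
    curvature_at_through[OF VF_torsion[of "through q w" "through q z"], of q u v]
    torsion_at_eq[of "through q w" "through q z" q]
  by simp

end

section \<open>Parallel fields along curves\<close>

text \<open>Banach's fixed point theorem for the Picard operator. The Lipschitz constant 1/2 on an
  interval of length 1 makes the operator itself a contraction; it is achieved later by transporting
  only along short segments.\<close>

lemma linear_ode_exists:
  fixes B :: "real \<Rightarrow> 'b::euclidean_space \<Rightarrow> 'b"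
  assumes cont: "\<And>u. continuous_on {0..1} u \<Longrightarrow> continuous_on {0..1} (\<lambda>s. B s (u s))"
    and contraction: "\<And>s v w. s \<in> {0..1} \<Longrightarrow> norm (B s v - B s w) \<le> 1 / 2 * norm (v - w)"
  obtains u where "u 0 = u0" "\<And>s. s \<in> {0..1} \<Longrightarrow> (u has_vector_derivative B s (u s)) (at s within {0..1})"
proof -
  \<comment> \<open>The complete space of bounded continuous functions consists of functions on the
    whole line; \<open>clamp\<close> extends functions from the unit interval by constants.\<close>
  define clamp where "clamp s = max 0 (min 1 s)" for s :: real
  have clamp01: "clamp s \<in> {0..1}" for s by (simp add: clamp_def)
  have clamp_id: "clamp s = s" if "s \<in> {0..1}" for s using that by (simp add: clamp_def)
  have cclamp: "continuous_on S clamp" for S unfolding clamp_def by (intro continuous_intros)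
  define F where "F u s = u0 + integral {0..clamp s} (\<lambda>r. B r (u r))" for u s
  have cont': "continuous_on {0..1} (\<lambda>s. B s (apply_bcontfun u s))" for u
    by (rule cont) (rule continuous_on_apply_bcontfun)
  have F_bcontfun: "F (apply_bcontfun u) \<in> bcontfun" for u
  proof -
    let ?h = "\<lambda>s. u0 + integral {0..s} (\<lambda>r. B r (apply_bcontfun u r))"
    have h: "continuous_on {0..1} ?h"
      by (intro continuous_intros indefinite_integral_continuous_1 integrable_continuous_interval cont')
    have "continuous_on UNIV (\<lambda>s. ?h (clamp s))"
      by (rule continuous_on_compose2[OF h cclamp]) (use clamp01 in auto)
    moreover have "bounded (?h ` {0..1})"
      by (intro compact_imp_bounded compact_continuous_image h) simp
    then have "bounded (range (\<lambda>s. ?h (clamp s)))"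
      by (rule bounded_subset) (use clamp01 in auto)
    ultimately show ?thesis by (simp add: bcontfun_def F_def[abs_def])
  qed
  define G where "G u = Bcontfun (F (apply_bcontfun u))" for u
  have G: "apply_bcontfun (G u) = F (apply_bcontfun u)" for u
    by (simp add: G_def Bcontfun_inverse F_bcontfun)
  have "dist (G u) (G v) \<le> 1 / 2 * dist u v" for u v
  proof (rule dist_bound)
    fix s
    let ?i = "\<lambda>u r. B r (apply_bcontfun u r)"
    have int: "?i u integrable_on {0..clamp s}" for u
      by (rule integrable_continuous_interval, rule continuous_on_subset[OF cont']) (use clamp01 in auto)
    have "norm (integral {0..clamp s} (\<lambda>r. ?i u r - ?i v r)) \<le> (1 / 2 * dist u v) * (clamp s - 0)"
    proof (rule integral_bound)
      show "continuous_on {0..clamp s} (\<lambda>r. ?i u r - ?i v r)"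
        by (rule continuous_on_subset[OF continuous_on_diff[OF cont' cont']]) (use clamp01 in auto)
      show "norm (?i u r - ?i v r) \<le> 1 / 2 * dist u v" if "r \<in> {0..clamp s}" for r
      proof -
        have "norm (?i u r - ?i v r) \<le> 1 / 2 * dist (apply_bcontfun u r) (apply_bcontfun v r)"
          using contraction[of r] that clamp01[of s] by (auto simp: dist_norm)
        also have "\<dots> \<le> 1 / 2 * dist u v" using dist_bounded[of u r v] by simp
        finally show ?thesis .
      qed
    qed (use clamp01 in auto)
    also have "\<dots> \<le> (1 / 2 * dist u v) * 1" using clamp01[of s] by (intro mult_left_mono) auto
    finally show "dist (apply_bcontfun (G u) s) (apply_bcontfun (G v) s) \<le> 1 / 2 * dist u v"
      by (simp add: G F_def dist_norm integral_diff[OF int int])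
  qed
  then have "\<exists>!u. G u = u"
    using banach_fix_type[of "1 / 2" G] by simp
  then obtain u where u: "G u = u" by blast
  have fix_eq: "apply_bcontfun u s = u0 + integral {0..s} (\<lambda>r. B r (apply_bcontfun u r))" if "s \<in> {0..1}" for s
    using G[of u] u clamp_id[OF that] by (metis F_def)
  show thesis
  proof (rule that)
    show "apply_bcontfun u 0 = u0" using fix_eq[of 0] by simp
    show "(apply_bcontfun u has_vector_derivative B s (apply_bcontfun u s)) (at s within {0..1})"
      if s: "s \<in> {0..1}" for s
    proof (rule has_vector_derivative_transform[OF s])
      show "((\<lambda>s. u0 + integral {0..s} (\<lambda>r. B r (apply_bcontfun u r))) has_vector_derivative
          B s (apply_bcontfun u s)) (at s within {0..1})"
        using integral_has_vector_derivative[OF cont' s]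
        by (auto intro!: derivative_eq_intros)
    qed (rule fix_eq)
  qed
qed

context hermitian_connection_manifold
begin

text \<open>\<open>X\<close> is a vector field whose value at the point \<gamma>(t) is the velocity
  of the curve there. Testing on functions avoids charts, and differentiating within
  \<open>I\<close> covers the endpoints.\<close>

definition tangent_field :: "(real \<Rightarrow> 'a) \<Rightarrow> real set \<Rightarrow> real \<Rightarrow> ('a, 'm) vfield \<Rightarrow> bool" where
  "tangent_field \<gamma> I t X \<longleftrightarrow> X \<in> VF A \<and>
    (\<forall>h. smooth_fun A h \<longrightarrow> ((\<lambda>s. h (\<gamma> s)) has_real_derivative deriv_along A X h (\<gamma> t)) (at t within I))"

text \<open>The covariant derivative of \<open>V\<close> along \<open>\<gamma>\<close> vanishes at \<open>t\<close>, expressed by the Leibniz rule for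
  the pairing with a family \<open>\<Psi>\<close> of covectors along \<open>\<gamma>\<close> whose covariant derivative at \<open>t\<close> is \<open>\<delta>\<close>.\<close>

definition weakly_parallel ::
  "(real \<Rightarrow> 'a) \<Rightarrow> real set \<Rightarrow> real \<Rightarrow> ('a, 'm) vfield \<Rightarrow> (real \<Rightarrow> complex^'m) \<Rightarrow> bool" where
  "weakly_parallel \<gamma> I t X V \<longleftrightarrow> (\<forall>\<Psi> \<delta>. (\<forall>s. linear (\<Psi> s)) \<longrightarrow> linear \<delta> \<longrightarrow>
     (\<forall>U\<in>VF A. ((\<lambda>s. \<Psi> s (U (\<gamma> s)) :: real) has_real_derivative \<delta> (U (\<gamma> t)) + \<Psi> t (nabla X U (\<gamma> t))) (at t within I)) \<longrightarrow>
     ((\<lambda>s. \<Psi> s (V s)) has_real_derivative \<delta> (V t)) (at t within I))"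

text \<open>The link from expansions in vector fields to the test by covectors. It serves both the
  given parallel fields of the holonomy group and the solutions of the transport equation.\<close>

lemma weakly_parallelI:
  assumes fin: "finite K" and E: "\<And>i. i \<in> K \<Longrightarrow> E i \<in> VF A" and N: "open N" "t \<in> N" "t \<in> I"
    and V: "\<And>s. s \<in> N \<inter> I \<Longrightarrow> V s = (\<Sum>i\<in>K. f i s *\<^sub>R E i (\<gamma> s))"
    and f: "\<And>i. i \<in> K \<Longrightarrow> (f i has_real_derivative f' i) (at t within I)"
    and zero: "(\<Sum>i\<in>K. f' i *\<^sub>R E i (\<gamma> t) + f i t *\<^sub>R nabla X (E i) (\<gamma> t)) = 0"
  shows "weakly_parallel \<gamma> I t X V"
  unfolding weakly_parallel_def
proof (intro allI impI)
  fix \<Psi> :: "real \<Rightarrow> complex^'m \<Rightarrow> real" and \<delta>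
  assume \<Psi>: "\<forall>s. linear (\<Psi> s)" and \<delta>: "linear \<delta>"
    and U: "\<forall>U\<in>VF A. ((\<lambda>s. \<Psi> s (U (\<gamma> s))) has_real_derivative \<delta> (U (\<gamma> t)) + \<Psi> t (nabla X U (\<gamma> t))) (at t within I)"
  have lin: "linear (\<Psi> s)" for s using \<Psi> by blast
  have "((\<lambda>s. \<Sum>i\<in>K. f i s * \<Psi> s (E i (\<gamma> s))) has_real_derivative
      (\<Sum>i\<in>K. f' i * \<Psi> t (E i (\<gamma> t)) + (\<delta> (E i (\<gamma> t)) + \<Psi> t (nabla X (E i) (\<gamma> t))) * f i t)) (at t within I)"
    by (intro DERIV_sum DERIV_mult f U[rule_format] E)
  also have "(\<Sum>i\<in>K. f' i * \<Psi> t (E i (\<gamma> t)) + (\<delta> (E i (\<gamma> t)) + \<Psi> t (nabla X (E i) (\<gamma> t))) * f i t)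
      = \<Psi> t (\<Sum>i\<in>K. f' i *\<^sub>R E i (\<gamma> t) + f i t *\<^sub>R nabla X (E i) (\<gamma> t)) + \<delta> (\<Sum>i\<in>K. f i t *\<^sub>R E i (\<gamma> t))"
    by (simp add: linear_sum[OF lin] linear_add[OF lin] linear_scale[OF lin] linear_sum[OF \<delta>]
        linear_scale[OF \<delta>] sum.distrib[symmetric] algebra_simps)
  also have "\<dots> = \<delta> (V t)" using N V[of t] by (simp add: zero linear_0[OF lin])
  finally have D: "((\<lambda>s. \<Sum>i\<in>K. f i s * \<Psi> s (E i (\<gamma> s))) has_real_derivative \<delta> (V t)) (at t within I)" .
  obtain d where d: "d > 0" "ball t d \<subseteq> N" using N openE by blast
  show "((\<lambda>s. \<Psi> s (V s)) has_real_derivative \<delta> (V t)) (at t within I)"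
  proof (rule has_field_derivative_transform_within[OF D d(1) N(3)])
    fix s assume "s \<in> I" "dist s t < d"
    then have "V s = (\<Sum>i\<in>K. f i s *\<^sub>R E i (\<gamma> s))" using d by (intro V) (auto simp: dist_commute)
    then show "(\<Sum>i\<in>K. f i s * \<Psi> s (E i (\<gamma> s))) = \<Psi> s (V s)"
      by (simp add: linear_sum[OF lin] linear_scale[OF lin])
  qed
qed

lemma weakly_parallelD:
  assumes "weakly_parallel \<gamma> I t X V" "\<And>s. linear (\<Psi> s)" "linear \<delta>"
    "\<And>U. U \<in> VF A \<Longrightarrow> ((\<lambda>s. \<Psi> s (U (\<gamma> s)) :: real) has_real_derivative \<delta> (U (\<gamma> t)) + \<Psi> t (nabla X U (\<gamma> t))) (at t within I)"
  shows "((\<lambda>s. \<Psi> s (V s)) has_real_derivative \<delta> (V t)) (at t within I)"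
  using assms unfolding weakly_parallel_def by blast

lemma weakly_parallel_add:
  assumes "weakly_parallel \<gamma> I t X V" "weakly_parallel \<gamma> I t X W"
  shows "weakly_parallel \<gamma> I t X (\<lambda>s. V s + W s)"
  unfolding weakly_parallel_def
proof (intro allI impI)
  fix \<Psi> :: "real \<Rightarrow> complex^'m \<Rightarrow> real" and \<delta>
  assume \<Psi>: "\<forall>s. linear (\<Psi> s)" and \<delta>: "linear \<delta>"
    and U: "\<forall>U\<in>VF A. ((\<lambda>s. \<Psi> s (U (\<gamma> s))) has_real_derivative \<delta> (U (\<gamma> t)) + \<Psi> t (nabla X U (\<gamma> t))) (at t within I)"
  have "((\<lambda>s. \<Psi> s (V s) + \<Psi> s (W s)) has_real_derivative \<delta> (V t) + \<delta> (W t)) (at t within I)"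
    using assms \<Psi> \<delta> U unfolding weakly_parallel_def by (intro DERIV_add) simp_all
  then show "((\<lambda>s. \<Psi> s (V s + W s)) has_real_derivative \<delta> (V t + W t)) (at t within I)"
    using \<Psi> by (simp add: linear_add \<delta>)
qed

lemma weakly_parallel_scale:
  assumes "weakly_parallel \<gamma> I t X V"
  shows "weakly_parallel \<gamma> I t X (\<lambda>s. r *\<^sub>R V s)"
  unfolding weakly_parallel_def
proof (intro allI impI)
  fix \<Psi> :: "real \<Rightarrow> complex^'m \<Rightarrow> real" and \<delta>
  assume \<Psi>: "\<forall>s. linear (\<Psi> s)" and \<delta>: "linear \<delta>"
    and U: "\<forall>U\<in>VF A. ((\<lambda>s. \<Psi> s (U (\<gamma> s))) has_real_derivative \<delta> (U (\<gamma> t)) + \<Psi> t (nabla X U (\<gamma> t))) (at t within I)"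
  have "((\<lambda>s. r * \<Psi> s (V s)) has_real_derivative r * \<delta> (V t)) (at t within I)"
    using assms \<Psi> \<delta> U unfolding weakly_parallel_def by (intro DERIV_cmult) simp
  then show "((\<lambda>s. \<Psi> s (r *\<^sub>R V s)) has_real_derivative \<delta> (r *\<^sub>R V t)) (at t within I)"
    using \<Psi> by (simp add: linear_scale \<delta>)
qed

text \<open>J is absorbed into the covectors: the family \<open>\<Psi> \<circ> J\<close> satisfies
  the Leibniz rule because J is parallel on vector fields.\<close>

lemma weakly_parallel_J:
  assumes "weakly_parallel \<gamma> I t X V" "X \<in> VF A"
  shows "weakly_parallel \<gamma> I t X (\<lambda>s. J (V s))"
  unfolding weakly_parallel_def
proof (intro allI impI)
  fix \<Psi> :: "real \<Rightarrow> complex^'m \<Rightarrow> real" and \<delta>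
  assume \<Psi>: "\<forall>s. linear (\<Psi> s)" and \<delta>: "linear \<delta>"
    and U: "\<forall>U\<in>VF A. ((\<lambda>s. \<Psi> s (U (\<gamma> s))) has_real_derivative \<delta> (U (\<gamma> t)) + \<Psi> t (nabla X U (\<gamma> t))) (at t within I)"
  show "((\<lambda>s. \<Psi> s (J (V s))) has_real_derivative \<delta> (J (V t))) (at t within I)"
  proof (rule weakly_parallelD[OF assms(1), where \<Psi> = "\<lambda>s v. \<Psi> s (J v)" and \<delta> = "\<lambda>v. \<delta> (J v)"])
    show "linear (\<lambda>v. \<Psi> s (J v))" for s
      using linear_compose[OF J_linear \<Psi>[rule_format, of s]] by (simp add: comp_def)
    show "linear (\<lambda>v. \<delta> (J v))" using linear_compose[OF J_linear \<delta>] by (simp add: comp_def)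
    show "((\<lambda>s. \<Psi> s (J (U (\<gamma> s)))) has_real_derivative \<delta> (J (U (\<gamma> t))) + \<Psi> t (J (nabla X U (\<gamma> t)))) (at t within I)"
      if "U \<in> VF A" for U
      using U[rule_format, OF VF_J[OF that]] nabla_J[OF assms(2) that] by simp
  qed
qed

text \<open>The arguments are treated one after the other. With a vector field \<open>Z\<close> in
  the second slot, the parallelism of \<open>V\<close> is tested by the covectors g(-,Z); the result
  says that the covectors g(V,-) are parallel, and these test \<open>W\<close>.\<close>

lemma has_derivative_g_parallel:
  assumes X: "tangent_field \<gamma> I t X"
    and V: "weakly_parallel \<gamma> I t X V" and W: "weakly_parallel \<gamma> I t X W"
  shows "((\<lambda>s. g (\<gamma> s) (V s) (W s)) has_real_derivative 0) (at t within I)"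
proof -
  have XVF: "X \<in> VF A" using X by (simp add: tangent_field_def)
  have lin: "linear (\<lambda>v. g q v w)" "linear (\<lambda>w. g q v w)" for q v w
    using g_bilinear[of q] by (auto simp: bilinear_def)
  have VZ: "((\<lambda>s. g (\<gamma> s) (V s) (Z (\<gamma> s))) has_real_derivative g (\<gamma> t) (V t) (nabla X Z (\<gamma> t))) (at t within I)"
    if Z: "Z \<in> VF A" for Z
  proof (rule weakly_parallelD[OF V, where \<Psi> = "\<lambda>s v. g (\<gamma> s) v (Z (\<gamma> s))" and \<delta> = "\<lambda>v. g (\<gamma> t) v (nabla X Z (\<gamma> t))"])
    show "((\<lambda>s. g (\<gamma> s) (U (\<gamma> s)) (Z (\<gamma> s))) has_real_derivative
        g (\<gamma> t) (U (\<gamma> t)) (nabla X Z (\<gamma> t)) + g (\<gamma> t) (nabla X U (\<gamma> t)) (Z (\<gamma> t))) (at t within I)"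
      if "U \<in> VF A" for U
      using X smooth_fun_g[OF that Z] deriv_along_g[OF XVF that Z, of "\<gamma> t"]
      by (auto simp: tangent_field_def add.commute)
  qed (rule lin)+
  show ?thesis
    by (rule weakly_parallelD[OF W, where \<Psi> = "\<lambda>s w. g (\<gamma> s) (V s) w" and \<delta> = "\<lambda>w. 0"])
      (auto simp: lin VZ module_hom_zero)
qed

lemma velocity_tangent_field:
  assumes ab: "a < b" and arc: "smooth_arc A a b \<gamma>" and t: "t \<in> {a..b}"
    and X: "X \<in> VF A" "X (\<gamma> t) = velocity A {a..b} \<gamma> t"
  shows "tangent_field \<gamma> {a..b} t X"
proof -
  obtain I \<delta> where I: "open I" "{a..b} \<subseteq> I" "smooth_curve_on A I \<delta>" "\<And>s. s \<in> {a..b} \<Longrightarrow> \<gamma> s = \<delta> s"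
    using arc unfolding smooth_arc_def by blast
  let ?c = "chart_at A (\<gamma> t)"
  \<comment> \<open>The extension \<open>\<delta>\<close> is smooth on an open set containing the
    closed interval, so a two-sided derivative is available even at its endpoints.\<close>
  let ?S = "I \<inter> \<delta> -` fst ?c"
  have o: "open ?S"
    using I open_dom[OF chart_at_in] by (auto intro: continuous_open_preimage simp: smooth_curve_on_def)
  have tS: "t \<in> ?S" using I t by (metis Int_iff in_chart_at subsetD vimageI)
  have "smooth_on ?S (snd ?c \<circ> \<delta>)" using I(3) chart_at_in unfolding smooth_curve_on_def by blast
  from smooth_on_imp_differentiable[OF this tS]
  obtain w where "((snd ?c \<circ> \<delta>) has_vector_derivative w) (at t)"
    using vector_derivative_works by blast
  then have "((snd ?c \<circ> \<delta>) has_vector_derivative w) (at t within {a..b})"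
    by (rule has_vector_derivative_at_within)
  then have w: "((snd ?c \<circ> \<gamma>) has_vector_derivative w) (at t within {a..b})"
    by (rule has_vector_derivative_transform[OF t, rotated]) (simp add: I)
  have vel: "velocity A {a..b} \<gamma> t = w"
    unfolding velocity_def using vector_derivative_within_closed_interval[OF ab t w] .
  obtain d where d: "d > 0" "ball t d \<subseteq> ?S" using o tS openE by blast
  have "((\<lambda>s. h (\<gamma> s)) has_real_derivative deriv_along A X h (\<gamma> t)) (at t within {a..b})"
    if h: "smooth_fun A h" for h
  proof -
    have "((\<lambda>s. (h \<circ> chart_inv ?c) ((snd ?c \<circ> \<gamma>) s)) has_derivative
        (\<lambda>x. deriv_along A (\<lambda>_. x *\<^sub>R w) h (\<gamma> t))) (at t within {a..b})"
      by (rule has_derivative_compose[OF w[unfolded has_vector_derivative_def]])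
        (use chart_at_has_derivative[OF h, of "\<gamma> t"] in \<open>simp add: comp_def\<close>)
    then have "((\<lambda>s. (h \<circ> chart_inv ?c) ((snd ?c \<circ> \<gamma>) s)) has_real_derivative deriv_along A X h (\<gamma> t)) (at t within {a..b})"
      using linear_scale[OF deriv_along_linear[OF h]] X(2) vel
      by (simp add: has_field_derivative_def deriv_along_pointwise[of X "\<gamma> t" w] mult_commute_abs)
    then show ?thesis
    proof (rule has_field_derivative_transform_within[OF _ d(1) t])
      fix s assume s: "s \<in> {a..b}" "dist s t < d"
      then have "\<gamma> s \<in> fst ?c" using d I(4) by (auto simp: dist_commute subset_iff)
      then show "(h \<circ> chart_inv ?c) ((snd ?c \<circ> \<gamma>) s) = h (\<gamma> s)"
        by (simp add: chart_inv_apply[OF chart_at_in])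
    qed
  qed
  then show ?thesis using X by (simp add: tangent_field_def)
qed

lemma has_cov_deriv_imp_weakly_parallel:
  assumes cov: "has_cov_deriv A nabla I \<gamma> V 0 t" and t: "t \<in> I"
    and X: "X \<in> VF A" "X (\<gamma> t) = velocity A I \<gamma> t"
  shows "weakly_parallel \<gamma> I t X V"
proof -
  obtain k :: nat and E f f' N where E: "\<forall>i<k. E i \<in> VF A" and N: "open N" "t \<in> N"
    and V: "\<forall>s\<in>N \<inter> I. V s = (\<Sum>i<k. f i s *\<^sub>R E i (\<gamma> s))"
    and f: "\<forall>i<k. (f i has_real_derivative f' i) (at t within I)"
    and zero: "0 = (\<Sum>i<k. f' i *\<^sub>R E i (\<gamma> t) + f i t *\<^sub>R nabla_at A nabla (\<gamma> t) (velocity A I \<gamma> t) (E i))"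
    using cov unfolding has_cov_deriv_def by blast
  have "nabla_at A nabla (\<gamma> t) (velocity A I \<gamma> t) (E i) = nabla X (E i) (\<gamma> t)" if "i < k" for i
    using nabla_at_eq[OF X(1), of "E i" "\<gamma> t"] E that X(2) by simp
  then have "(\<Sum>i<k. f' i *\<^sub>R E i (\<gamma> t) + f i t *\<^sub>R nabla X (E i) (\<gamma> t)) = 0"
    using zero by simp
  then show ?thesis
    by (intro weakly_parallelI[where K = "{..<k}" and E = E and f = f and f' = f' and N = N]) (use E N V f t in auto)
qed

end

context parallel_torsion_manifold
begin

text \<open>The same two-stage test as for the metric, with covectors \<Psi>(T(-,Z)). The
  parallelism of T supplies their Leibniz rule, where the derivative of \<open>Z\<close> contributes
  a second term to \<open>\<delta>\<close>.\<close>

lemma weakly_parallel_torsion: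
  assumes "weakly_parallel \<gamma> I t X V" "weakly_parallel \<gamma> I t X W" "X \<in> VF A"
  shows "weakly_parallel \<gamma> I t X (\<lambda>s. torsion_at (\<gamma> s) (V s) (W s))"
  unfolding weakly_parallel_def
proof (intro allI impI)
  fix \<Psi> :: "real \<Rightarrow> complex^'m \<Rightarrow> real" and \<delta>
  assume \<Psi>: "\<forall>s. linear (\<Psi> s)" and \<delta>: "linear \<delta>"
    and U: "\<forall>U\<in>VF A. ((\<lambda>s. \<Psi> s (U (\<gamma> s))) has_real_derivative \<delta> (U (\<gamma> t)) + \<Psi> t (nabla X U (\<gamma> t))) (at t within I)"
  have lin: "linear (\<Psi> s)" for s using \<Psi> by blast
  have l1: "linear (\<lambda>u. L (torsion_at q u v))" and l2: "linear (\<lambda>u. L (torsion_at q v u))"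
    if "linear L" for L :: "complex^'m \<Rightarrow> real" and q v
    using linear_compose[OF _ that] torsion_at_bilinear[of q] by (auto simp: bilinear_def comp_def)
  have VZ: "((\<lambda>s. \<Psi> s (torsion_at (\<gamma> s) (V s) (Z (\<gamma> s)))) has_real_derivative
      \<delta> (torsion_at (\<gamma> t) (V t) (Z (\<gamma> t))) + \<Psi> t (torsion_at (\<gamma> t) (V t) (nabla X Z (\<gamma> t)))) (at t within I)"
    if Z: "Z \<in> VF A" for Z
  proof (rule weakly_parallelD[OF assms(1), where \<Psi> = "\<lambda>s v. \<Psi> s (torsion_at (\<gamma> s) v (Z (\<gamma> s)))"
      and \<delta> = "\<lambda>v. \<delta> (torsion_at (\<gamma> t) v (Z (\<gamma> t))) + \<Psi> t (torsion_at (\<gamma> t) v (nabla X Z (\<gamma> t)))"])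
    fix U' assume U': "U' \<in> VF A"
    have eq: "torsion A nabla U' Z = (\<lambda>q. torsion_at q (U' q) (Z q))"
      by (rule ext) (rule torsion_at_eq[OF U' Z])
    have "((\<lambda>s. \<Psi> s (torsion_at (\<gamma> s) (U' (\<gamma> s)) (Z (\<gamma> s)))) has_real_derivative
        \<delta> (torsion_at (\<gamma> t) (U' (\<gamma> t)) (Z (\<gamma> t))) + \<Psi> t (nabla X (torsion A nabla U' Z) (\<gamma> t))) (at t within I)"
      using U[rule_format, OF VF_torsion[OF U' Z]] by (simp add: eq)
    then show "((\<lambda>s. \<Psi> s (torsion_at (\<gamma> s) (U' (\<gamma> s)) (Z (\<gamma> s)))) has_real_derivative
        \<delta> (torsion_at (\<gamma> t) (U' (\<gamma> t)) (Z (\<gamma> t))) + \<Psi> t (torsion_at (\<gamma> t) (U' (\<gamma> t)) (nabla X Z (\<gamma> t)))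
        + \<Psi> t (torsion_at (\<gamma> t) (nabla X U' (\<gamma> t)) (Z (\<gamma> t)))) (at t within I)"
      by (simp add: nabla_torsion[OF assms(3) U' Z] torsion_at_eq VF_nabla assms(3) U' Z linear_add[OF lin] algebra_simps)
  qed (intro l1 linear_compose_add \<delta> lin)+
  show "((\<lambda>s. \<Psi> s (torsion_at (\<gamma> s) (V s) (W s))) has_real_derivative \<delta> (torsion_at (\<gamma> t) (V t) (W t))) (at t within I)"
    by (rule weakly_parallelD[OF assms(2), where \<Psi> = "\<lambda>s w. \<Psi> s (torsion_at (\<gamma> s) (V s) w)"
        and \<delta> = "\<lambda>w. \<delta> (torsion_at (\<gamma> t) (V t) w)"])
      (intro l2 \<delta> lin VZ)+
qed

text \<open>An isomorphism between tangent spaces with metric, J and torsion. This is all that is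
  retained of parallel transport.\<close>

definition torsion_isometry :: "'a \<Rightarrow> 'a \<Rightarrow> (complex^'m \<Rightarrow> complex^'m) \<Rightarrow> bool" where
  "torsion_isometry q q' P \<longleftrightarrow> linear P \<and> (\<forall>u v. g q' (P u) (P v) = g q u v) \<and> (\<forall>u. P (J u) = J (P u)) \<and>
     (\<forall>u v. P (torsion_at q u v) = torsion_at q' (P u) (P v))"

text \<open>The metric is conserved along parallel fields, so such a field is determined at the end
  by its initial value. Sums, real multiples, J and T of parallel fields are again parallel;
  comparing them with the field that starts at the same vector shows that \<open>P\<close> respects
  each operation.\<close>

lemma torsion_isometry_transport:
  fixes \<tau> :: "nat \<Rightarrow> real"
  assumes \<tau>: "\<tau> 0 = 0" "\<tau> n = 1" "\<And>k. k < n \<Longrightarrow> \<tau> k < \<tau> (Suc k)"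
    and X: "\<And>k t. k < n \<Longrightarrow> t \<in> {\<tau> k..\<tau> (Suc k)} \<Longrightarrow> tangent_field \<gamma> {\<tau> k..\<tau> (Suc k)} t (X k t)"
    and P: "\<And>u. \<exists>V. V 0 = u \<and> V 1 = P u \<and>
      (\<forall>k<n. \<forall>t\<in>{\<tau> k..\<tau> (Suc k)}. weakly_parallel \<gamma> {\<tau> k..\<tau> (Suc k)} t (X k t) V)"
  shows "torsion_isometry (\<gamma> 0) (\<gamma> 1) P"
proof -
  define F where "F = {V. \<forall>k<n. \<forall>t\<in>{\<tau> k..\<tau> (Suc k)}. weakly_parallel \<gamma> {\<tau> k..\<tau> (Suc k)} t (X k t) V}"
  \<comment> \<open>Adjacent closed pieces share their breakpoint, where the field has a single
    value; constancy on each piece therefore chains up from 0 to 1.\<close>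
  have conserved: "g (\<gamma> 1) (V 1) (W 1) = g (\<gamma> 0) (V 0) (W 0)" if "V \<in> F" "W \<in> F" for V W
  proof -
    have "k \<le> n \<Longrightarrow> g (\<gamma> (\<tau> k)) (V (\<tau> k)) (W (\<tau> k)) = g (\<gamma> 0) (V 0) (W 0)" for k
    proof (induction k)
      case 0
      then show ?case by (simp add: \<tau>)
    next
      case (Suc k)
      have "((\<lambda>s. g (\<gamma> s) (V s) (W s)) has_real_derivative 0) (at t within {\<tau> k..\<tau> (Suc k)})"
        if "t \<in> {\<tau> k..\<tau> (Suc k)}" for t
        using \<open>V \<in> F\<close> \<open>W \<in> F\<close> Suc.prems that
        by (intro has_derivative_g_parallel[where X = "X k t"] X) (auto simp: F_def)
      then obtain c where "\<And>t. t \<in> {\<tau> k..\<tau> (Suc k)} \<Longrightarrow> g (\<gamma> t) (V t) (W t) = c"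
        using has_field_derivative_zero_constant[of "{\<tau> k..\<tau> (Suc k)}" "\<lambda>s. g (\<gamma> s) (V s) (W s)"] by auto
      then show ?case using Suc \<tau>(3)[of k] by simp
    qed
    from this[of n] show ?thesis by (simp add: \<tau>)
  qed
  have unique: "V 1 = W 1" if VW: "V \<in> F" "W \<in> F" "V 0 = W 0" for V W
  proof -
    have "g (\<gamma> 1) (V 1 - W 1) (V 1 - W 1) = 0"
      using VW conserved[of V V] conserved[of V W] conserved[of W V] conserved[of W W]
      by (simp add: g_diff_left g_diff_right)
    then show ?thesis using g_pos[of "V 1 - W 1" "\<gamma> 1"] by fastforce
  qed
  have XVF: "X k t \<in> VF A" if "k < n" "t \<in> {\<tau> k..\<tau> (Suc k)}" for k t
    using X[OF that] by (simp add: tangent_field_def)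
  have closed: "(\<lambda>s. V s + W s) \<in> F" "(\<lambda>s. r *\<^sub>R V s) \<in> F" "(\<lambda>s. J (V s)) \<in> F"
      "(\<lambda>s. torsion_at (\<gamma> s) (V s) (W s)) \<in> F" if "V \<in> F" "W \<in> F" for V W r
    using that XVF unfolding F_def
    by (simp_all add: weakly_parallel_add weakly_parallel_scale weakly_parallel_J weakly_parallel_torsion)
  obtain V where V: "\<And>u. V u \<in> F" "\<And>u. V u 0 = u" "\<And>u. V u 1 = P u"
    using P unfolding F_def by (simp add: Bex_def) metis
  have "linear P"
  proof (rule linearI)
    show "P (u + v) = P u + P v" for u v
      using unique[OF V(1)[of "u + v"] closed(1)[OF V(1)[of u] V(1)[of v]]] by (simp add: V)
    show "P (r *\<^sub>R u) = r *\<^sub>R P u" for r u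
      using unique[OF V(1)[of "r *\<^sub>R u"] closed(2)[OF V(1)[of u] V(1)[of u]]] by (simp add: V)
  qed
  moreover have "g (\<gamma> 1) (P u) (P v) = g (\<gamma> 0) u v" for u v
    using conserved[OF V(1)[of u] V(1)[of v]] by (simp add: V)
  moreover have "P (J u) = J (P u)" for u
    using unique[OF V(1)[of "J u"] closed(3)[OF V(1)[of u] V(1)[of u]]] by (simp add: V)
  moreover have "P (torsion_at (\<gamma> 0) u v) = torsion_at (\<gamma> 1) (P u) (P v)" for u v
    using unique[OF V(1)[of "torsion_at (\<gamma> 0) u v"] closed(4)[OF V(1)[of u] V(1)[of v]]] by (simp add: V)
  ultimately show ?thesis by (simp add: torsion_isometry_def)
qed

lemma torsion_isometry_holonomy:
  assumes "P \<in> restricted_holonomy A nabla q"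
  shows "torsion_isometry q q P"
proof -
  obtain \<gamma> where \<gamma>: "pathstart \<gamma> = q" "pathfinish \<gamma> = q" "parallel_transport A nabla \<gamma> P"
    using assms unfolding restricted_holonomy_def by blast
  obtain n and \<tau> :: "nat \<Rightarrow> real" where \<tau>: "\<tau> 0 = 0" "\<tau> n = 1"
      "\<And>k. k < n \<Longrightarrow> \<tau> k < \<tau> (Suc k) \<and> smooth_arc A (\<tau> k) (\<tau> (Suc k)) \<gamma>"
    and P: "\<And>u. \<exists>V. V 0 = u \<and> V 1 = P u \<and> (\<forall>k<n. parallel_on A nabla {\<tau> k..\<tau> (Suc k)} \<gamma> V)"
    using \<gamma>(3) unfolding parallel_transport_def by metis
  define X where "X k t = through (\<gamma> t) (velocity A {\<tau> k..\<tau> (Suc k)} \<gamma> t)" for k t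
  have "torsion_isometry (\<gamma> 0) (\<gamma> 1) P"
  proof (rule torsion_isometry_transport[where \<tau> = \<tau> and n = n and X = X])
    show "tangent_field \<gamma> {\<tau> k..\<tau> (Suc k)} t (X k t)" if "k < n" "t \<in> {\<tau> k..\<tau> (Suc k)}" for k t
      using \<tau>(3)[OF that(1)] that(2) by (intro velocity_tangent_field) (auto simp: X_def)
    show "\<exists>V. V 0 = u \<and> V 1 = P u \<and>
      (\<forall>k<n. \<forall>t\<in>{\<tau> k..\<tau> (Suc k)}. weakly_parallel \<gamma> {\<tau> k..\<tau> (Suc k)} t (X k t) V)" for u
    proof -
      obtain V where V: "V 0 = u" "V 1 = P u" "\<forall>k<n. parallel_on A nabla {\<tau> k..\<tau> (Suc k)} \<gamma> V"
        using P by blast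
      have "weakly_parallel \<gamma> {\<tau> k..\<tau> (Suc k)} t (X k t) V" if "k < n" "t \<in> {\<tau> k..\<tau> (Suc k)}" for k t
        using V(3) that by (intro has_cov_deriv_imp_weakly_parallel) (auto simp: X_def parallel_on_def)
      then show ?thesis using V by blast
    qed
  qed (use \<tau> in auto)
  then show ?thesis using \<gamma> by (simp add: pathstart_def pathfinish_def)
qed

end

section \<open>Parallel transport and holonomy\<close>

context parallel_torsion_manifold
begin

lemma torsion_isometry_bij:
  assumes "torsion_isometry q q' P" shows "bij P"
proof -
  have lin: "linear P" using assms by (simp add: torsion_isometry_def)
  have "P u = 0 \<Longrightarrow> u = 0" for u
    using assms g_pos[of u q] unfolding torsion_isometry_def by (metis g_zero_left less_irrefl)
  then have "inj P" using lin by (simp add: linear_injective_0)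
  then show ?thesis using lin linear_injective_imp_surjective by (auto simp: bij_def)
qed

lemma torsion_isometry_id: "torsion_isometry q q (\<lambda>u. u)"
  by (simp add: torsion_isometry_def linear_id[unfolded id_def])

lemma torsion_isometry_comp:
  "torsion_isometry q q' P \<Longrightarrow> torsion_isometry q' q'' Q \<Longrightarrow> torsion_isometry q q'' (Q \<circ> P)"
  by (simp add: torsion_isometry_def linear_compose)

lemma torsion_isometry_inv:
  assumes "torsion_isometry q q' P" shows "torsion_isometry q' q (inv P)"
proof -
  note P = assms[unfolded torsion_isometry_def]
  have inj: "inj P" and surj: "surj P" using torsion_isometry_bij[OF assms] by (auto simp: bij_def)
  have PI [simp]: "P (inv P u) = u" for u using surj by (simp add: surj_f_inv_f)
  have eqI: "P u = P v \<Longrightarrow> u = v" for u v using inj by (simp add: inj_eq)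
  show ?thesis
    unfolding torsion_isometry_def
  proof (intro conjI allI)
    show "linear (inv P)"
      by (rule linearI; rule eqI) (use P in \<open>simp_all add: linear_add linear_scale\<close>)
    show "g q (inv P u) (inv P v) = g q' u v" for u v
      using P by (metis PI)
    show "inv P (J u) = J (inv P u)" for u by (rule eqI) (use P in simp)
    show "inv P (torsion_at q' u v) = torsion_at q (inv P u) (inv P v)" for u v
      by (rule eqI) (use P in simp)
  qed
qed

text \<open>Vectors are transported along straight coordinate segments issuing from
  \<open>q\<close>. The equation is solved in components, with segments so short that the
  contraction hypothesis holds.\<close>

lemma nearby_torsion_isometry:
  "\<exists>N. open N \<and> q \<in> N \<and> (\<forall>q'\<in>N. \<exists>P. torsion_isometry q q' P)"
proof -
  define c where "c = chart_at A q"
  have c: "c \<in> A" "q \<in> fst c" by (simp_all add: c_def)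
  define x0 where "x0 = snd c q"
  obtain \<rho> r where \<rho>: "cutoff c \<rho>" "r > 0" "ball x0 r \<subseteq> img c" "\<And>x. x \<in> ball x0 r \<Longrightarrow> \<rho> x = 1"
    using cutoff_exists[OF c] unfolding x0_def by metis
  \<comment> \<open>Near \<open>x0\<close> the field \<open>E b\<close> has constant components
    \<open>b\<close>. The fields for basis vectors form a frame, and \<open>E w\<close> extends the
    velocity of the segment in direction \<open>w\<close>.\<close>
  define E where "E b = ext_field c \<rho> (\<lambda>x. b)" for b
  have E: "E b \<in> VF A" for b
    unfolding E_def by (intro VF_ext_field \<rho> smooth_on_const open_img c)
  have inE: "in_chart A c q' (E b q') = b" if "q' \<in> fst c" "snd c q' \<in> ball x0 r" for q' b
    using \<rho>(4)[OF that(2)] by (simp add: E_def in_chart_ext_field c that)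
  \<comment> \<open>The Christoffel symbols, with the upper index left as a vector.\<close>
  define Chr where "Chr b b' = local_rep A c (nabla (E b) (E b'))" for b b'
  have contChr: "continuous_on (img c) (Chr b b')" for b b'
    unfolding Chr_def by (intro smooth_on_imp_continuous_on VFD VF_nabla E c)
  have half: "cball x0 (r / 2) \<subseteq> ball x0 r" using \<rho>(2) by auto
  have "bounded (\<Union>b\<in>Basis. \<Union>b'\<in>Basis. Chr b b' ` cball x0 (r / 2))"
    by (intro bounded_UN finite_Basis ballI compact_imp_bounded compact_continuous_image
        continuous_on_subset[OF contChr] compact_cball)
      (use half \<rho>(3) in blast)
  then obtain C where C: "C > 0"
      and C': "\<forall>y\<in>\<Union>b\<in>Basis. \<Union>b'\<in>Basis. Chr b b' ` cball x0 (r / 2). norm y \<le> C"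
    unfolding bounded_pos by (elim exE conjE)
  have C_bound: "norm (Chr b b' x) \<le> C" if "b \<in> Basis" "b' \<in> Basis" "x \<in> cball x0 (r / 2)" for b b' x
    by (rule C'[rule_format], rule UN_I[OF that(1)], rule UN_I[OF that(2)], rule imageI[OF that(3)])
  define D where "D = real DIM(complex^'m)"
  have D: "D > 0" by (simp add: D_def)
  \<comment> \<open>Parallel transport in direction \<open>w\<close> is the equation u' = B w x u.
    The bound for \<open>B\<close> adds one estimate for each of the D^2 pairs of basis
    vectors.\<close>
  define B where "B w x v = - (\<Sum>b'\<in>Basis. \<Sum>b\<in>Basis. ((w \<bullet> b) * (v \<bullet> b')) *\<^sub>R Chr b b' x)" for w x v
  have Bdiff: "B w x v - B w x v' = B w x (v - v')" for w x v v'
    by (simp add: B_def inner_diff_left algebra_simps sum_subtractf)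
  have Bnorm: "norm (B w x v) \<le> D * (D * (norm w * norm v * C))" if x: "x \<in> cball x0 (r / 2)" for w x v
  proof -
    have "norm (((w \<bullet> b) * (v \<bullet> b')) *\<^sub>R Chr b b' x) \<le> norm w * norm v * C"
      if "b \<in> Basis" "b' \<in> Basis" for b b'
      using C_bound that x by (simp add: abs_mult) (intro mult_mono Basis_le_norm mult_nonneg_nonneg; simp)
    then show ?thesis
      unfolding B_def norm_minus_cancel D_def by (intro sum_norm_bound)
  qed
  \<comment> \<open>The first bound keeps the segment in the compact ball where \<open>C\<close>
    bounds the Christoffel symbols; the second makes the Lipschitz constant D^2 C |w| at most
    1/2.\<close>
  define \<epsilon> where "\<epsilon> = min (r / 2) (1 / (2 * D * D * C))"
  have \<epsilon>: "\<epsilon> > 0" using D C \<rho>(2) by (simp add: \<epsilon>_def)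
  have "\<exists>P. torsion_isometry q q' P" if q': "q' \<in> fst c" "snd c q' \<in> ball x0 \<epsilon>" for q'
  proof -
    define w where "w = snd c q' - x0"
    define \<gamma> where "\<gamma> s = chart_inv c (x0 + s *\<^sub>R w)" for s
    have wn: "norm w < \<epsilon>" using q'(2) by (simp add: w_def dist_norm norm_minus_commute)
    have line: "x0 + s *\<^sub>R w \<in> cball x0 (r / 2)" if "s \<in> {0..1}" for s
    proof -
      have "\<bar>s\<bar> * norm w \<le> 1 * (r / 2)"
        using that wn by (intro mult_mono) (auto simp: \<epsilon>_def)
      then show ?thesis by (simp add: dist_norm)
    qed
    have line_ball: "x0 + s *\<^sub>R w \<in> ball x0 r" if "s \<in> {0..1}" for s using line[OF that] half by blast
    have line_img: "x0 + s *\<^sub>R w \<in> img c" if "s \<in> {0..1}" for s using line_ball[OF that] \<rho>(3) by blast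
    have \<gamma>: "\<gamma> s \<in> fst c" "snd c (\<gamma> s) = x0 + s *\<^sub>R w" if "s \<in> {0..1}" for s
      unfolding \<gamma>_def using line_img[OF that] c(1) by (auto simp: chart_inv_in_dom)
    have \<gamma>0: "\<gamma> 0 = q" using c by (simp add: \<gamma>_def x0_def)
    have \<gamma>1: "\<gamma> 1 = q'" using c q' by (simp add: \<gamma>_def w_def)
    have contract: "norm (B w (x0 + s *\<^sub>R w) v - B w (x0 + s *\<^sub>R w) v') \<le> 1 / 2 * norm (v - v')"
      if s: "s \<in> {0..1}" for s v v'
    proof -
      have "norm w * (D * D * C) \<le> 1 / (2 * D * D * C) * (D * D * C)"
        using wn D C by (intro mult_right_mono) (auto simp: \<epsilon>_def)
      also have "\<dots> = 1 / 2" using D C by simp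
      finally have "norm w * (D * D * C) * norm (v - v') \<le> 1 / 2 * norm (v - v')"
        by (rule mult_right_mono) simp
      then show ?thesis
        unfolding Bdiff using Bnorm[OF line[OF s], of w "v - v'"] by (simp add: mult_ac)
    qed
    have cont: "continuous_on {0..1} (\<lambda>s. B w (x0 + s *\<^sub>R w) (u s))" if "continuous_on {0..1} u" for u
      unfolding B_def
      by (intro continuous_intros that continuous_on_compose2[OF contChr]) (use line_img in auto)
    have "\<exists>u. u 0 = u0 \<and> (\<forall>s\<in>{0..1}. (u has_vector_derivative B w (x0 + s *\<^sub>R w) (u s)) (at s within {0..1}))" for u0
      using linear_ode_exists[of "\<lambda>s. B w (x0 + s *\<^sub>R w)" u0, OF cont contract] by metis
    then obtain u where u: "\<And>u0. u u0 0 = u0"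
      "\<And>u0 s. s \<in> {0..1} \<Longrightarrow> (u u0 has_vector_derivative B w (x0 + s *\<^sub>R w) (u u0 s)) (at s within {0..1})"
      by metis
    \<comment> \<open>\<open>u u0\<close> holds components in the chart \<open>c\<close>; the
      combination with the fields \<open>E b\<close> turns them into tangent vectors with respect to
      the charts chosen along the curve.\<close>
    define V where "V u0 s = (\<Sum>b\<in>Basis. (u u0 s \<bullet> b) *\<^sub>R E b (\<gamma> s))" for u0 s
    have tangent: "tangent_field \<gamma> {0..1} t (E w)" if t: "t \<in> {0..1}" for t
      unfolding tangent_field_def
    proof (intro conjI allI impI E)
      fix h assume h: "smooth_fun A h"
      have "((\<lambda>s. (h \<circ> chart_inv c) (x0 + s *\<^sub>R w)) has_real_derivative
          frechet_derivative (h \<circ> chart_inv c) (at (x0 + t *\<^sub>R w)) w) (at t)"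
        by (rule has_real_derivative_compose_line, rule smooth_on_imp_has_derivative[OF smooth_funD[OF h c(1)]])
          (rule line_img[OF t])
      moreover have "deriv_along A (E w) h (\<gamma> t) = frechet_derivative (h \<circ> chart_inv c) (at (x0 + t *\<^sub>R w)) w"
        using deriv_along_chart[OF h c(1) \<gamma>(1)[OF t]] inE[OF \<gamma>(1)[OF t]] \<gamma>(2)[OF t] line_ball[OF t] by simp
      ultimately show "((\<lambda>s. h (\<gamma> s)) has_real_derivative deriv_along A (E w) h (\<gamma> t)) (at t within {0..1})"
        by (simp add: \<gamma>_def comp_def has_field_derivative_at_within)
    qed
    have parallelV: "weakly_parallel \<gamma> {0..1} t (E w) (V u0)" if t: "t \<in> {0..1}" for t u0
    proof (rule weakly_parallelI[where K = Basis and E = E and N = UNIV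
          and f = "\<lambda>b s. u u0 s \<bullet> b" and f' = "\<lambda>b. B w (x0 + t *\<^sub>R w) (u u0 t) \<bullet> b"])
      show "((\<lambda>s. u u0 s \<bullet> b) has_real_derivative B w (x0 + t *\<^sub>R w) (u u0 t) \<bullet> b) (at t within {0..1})" for b
        using bounded_linear.has_vector_derivative[OF bounded_linear_inner_left u(2)[OF t]]
        by (simp add: has_real_derivative_iff_has_vector_derivative)
      note lin = in_chart_linear[OF c(1) \<gamma>(1)[OF t]]
      have inEt: "in_chart A c (\<gamma> t) (E b (\<gamma> t)) = b" for b
        using inE[OF \<gamma>(1)[OF t]] \<gamma>(2)[OF t] line_ball[OF t] by simp
      have "E w (\<gamma> t) = (\<Sum>b\<in>Basis. (w \<bullet> b) *\<^sub>R E b (\<gamma> t))"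
        by (rule in_chart_inj[OF c(1) \<gamma>(1)[OF t]])
          (simp add: linear_sum[OF lin] linear_scale[OF lin] inEt euclidean_representation)
      \<comment> \<open>The covariant derivative depends only on the value of the direction at the
        point, so the direction may be replaced by the combination of basis fields, which brings in
        the Christoffel symbols.\<close>
      then have "nabla (E w) (E b') (\<gamma> t) = nabla (\<lambda>q. \<Sum>b\<in>Basis. (w \<bullet> b) *\<^sub>R E b q) (E b') (\<gamma> t)" for b'
        by (intro nabla_pointwise E sum_VF VF_scale smooth_fun_const) auto
      also have "nabla (\<lambda>q. \<Sum>b\<in>Basis. (w \<bullet> b) *\<^sub>R E b q) (E b') (\<gamma> t)
          = (\<Sum>b\<in>Basis. nabla (\<lambda>q. (w \<bullet> b) *\<^sub>R E b q) (E b') (\<gamma> t))" for b'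
        by (rule tensorial_sum[where L = "\<lambda>X. nabla X (E b') (\<gamma> t)" and p = "\<gamma> t"])
          (auto simp: nabla_add_left nabla_scale_left E intro!: VF_scale smooth_fun_const)
      finally have nab: "in_chart A c (\<gamma> t) (nabla (E w) (E b') (\<gamma> t)) = (\<Sum>b\<in>Basis. (w \<bullet> b) *\<^sub>R Chr b b' (x0 + t *\<^sub>R w))" for b'
        using local_rep_chart[OF c(1) \<gamma>(1)[OF t]] \<gamma>(2)[OF t]
        by (simp add: nabla_scale_left[OF smooth_fun_const] E linear_sum[OF lin] linear_scale[OF lin] Chr_def)
      have "in_chart A c (\<gamma> t) (\<Sum>b'\<in>Basis. (B w (x0 + t *\<^sub>R w) (u u0 t) \<bullet> b') *\<^sub>R E b' (\<gamma> t)
          + (u u0 t \<bullet> b') *\<^sub>R nabla (E w) (E b') (\<gamma> t))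
        = B w (x0 + t *\<^sub>R w) (u u0 t) + (\<Sum>b'\<in>Basis. (u u0 t \<bullet> b') *\<^sub>R (\<Sum>b\<in>Basis. (w \<bullet> b) *\<^sub>R Chr b b' (x0 + t *\<^sub>R w)))"
        by (simp add: linear_sum[OF lin] linear_add[OF lin] linear_scale[OF lin] inEt nab sum.distrib euclidean_representation)
      also have "\<dots> = 0" by (simp add: B_def scaleR_sum_right mult.commute)
      also have "0 = in_chart A c (\<gamma> t) 0" by (simp add: c \<gamma>[OF t])
      finally show "(\<Sum>b'\<in>Basis. (B w (x0 + t *\<^sub>R w) (u u0 t) \<bullet> b') *\<^sub>R E b' (\<gamma> t)
          + (u u0 t \<bullet> b') *\<^sub>R nabla (E w) (E b') (\<gamma> t)) = 0"
        by (rule in_chart_inj[OF c(1) \<gamma>(1)[OF t]])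
    qed (use t E in \<open>auto simp: V_def\<close>)
    have E0: "E b (\<gamma> 0) = b" for b
      using inE[OF c(2), of b] \<rho>(2) in_chart_at_self[of q "E b q"] by (simp add: \<gamma>0 x0_def c_def)
    have V0: "V u0 0 = u0" for u0 by (simp add: V_def E0 u(1) euclidean_representation)
    have "torsion_isometry (\<gamma> 0) (\<gamma> 1) (\<lambda>u0. V u0 1)"
    proof (rule torsion_isometry_transport[where \<tau> = real and n = 1 and X = "\<lambda>_ _. E w"])
      show "\<exists>W. W 0 = u0 \<and> W 1 = V u0 1 \<and>
          (\<forall>k<1. \<forall>t\<in>{real k..real (Suc k)}. weakly_parallel \<gamma> {real k..real (Suc k)} t (E w) W)" for u0
        by (rule exI[of _ "V u0"]) (simp add: V0 parallelV)
    qed (use tangent in auto)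
    then show ?thesis using \<gamma>0 \<gamma>1 by auto
  qed
  moreover have "open (fst c \<inter> snd c -` ball x0 \<epsilon>)" by (intro chart_preimage_open c open_ball)
  moreover have "q \<in> fst c \<inter> snd c -` ball x0 \<epsilon>" using c \<epsilon> by (simp add: x0_def)
  ultimately show ?thesis by blast
qed

text \<open>The points that can be reached from \<open>p\<close> form an open set by composition
  with nearby isometries, and so do the remaining points, by composition with their inverses. No
  curve to a distant point needs to be chosen.\<close>

lemma torsion_isometry_exists:
  assumes conn: "connected (UNIV :: 'a set)"
  shows "\<exists>P. torsion_isometry p q P"
proof -
  define S where "S = {q. \<exists>P. torsion_isometry p q P}"
  have "open S"
  proof (subst open_subopen, rule ballI)
    fix q assume "q \<in> S"
    then obtain P where P: "torsion_isometry p q P" by (auto simp: S_def)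
    obtain N where N: "open N" "q \<in> N" "\<And>q'. q' \<in> N \<Longrightarrow> \<exists>P. torsion_isometry q q' P"
      using nearby_torsion_isometry[of q] by blast
    then have "N \<subseteq> S" using torsion_isometry_comp[OF P] unfolding S_def by blast
    with N show "\<exists>T. open T \<and> q \<in> T \<and> T \<subseteq> S" by blast
  qed
  moreover have "open (- S)"
  proof (subst open_subopen, rule ballI)
    fix q assume q: "q \<in> - S"
    obtain N where N: "open N" "q \<in> N" "\<And>q'. q' \<in> N \<Longrightarrow> \<exists>P. torsion_isometry q q' P"
      using nearby_torsion_isometry[of q] by blast
    have "N \<subseteq> - S"
    proof
      fix q' assume "q' \<in> N"
      then obtain Q where Q: "torsion_isometry q q' Q" using N by blast
      show "q' \<in> - S"
      proof
        assume "q' \<in> S"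
        then obtain P where "torsion_isometry p q' P" by (auto simp: S_def)
        from torsion_isometry_comp[OF this torsion_isometry_inv[OF Q]] q show False by (auto simp: S_def)
      qed
    qed
    with N show "\<exists>T. open T \<and> q \<in> T \<and> T \<subseteq> - S" by blast
  qed
  moreover have "p \<in> S" using torsion_isometry_id by (auto simp: S_def)
  ultimately have "S = UNIV"
    using conn connected_clopen[of UNIV] by (auto simp: closed_def)
  then show ?thesis by (auto simp: S_def)
qed

end

context hermitian_connection_manifold
begin

lemma vector_scalar_eq: "a *s v = Re a *\<^sub>R v + Im a *\<^sub>R J v" for v :: "complex^'m"
  by (simp add: J_def vec_eq_iff complex_eq_iff)

lemma g_self_J: "g q v (J v) = 0"
  using g_J_left[of q v v] g_sym[of q v "J v"] by simp

text \<open>Hermitian orthonormality in real terms, by induction over a set of indices. A dimension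
  count supplies a nonzero vector orthogonal to those already found and to their images under J;
  only its length has to be adjusted.\<close>

lemma partial_unitary_frame:
  fixes F :: "'m set"
  assumes "finite F"
  shows "\<exists>a. \<forall>i\<in>F. \<forall>j\<in>F. g q (a i) (a j) = (if i = j then 1 else 0) \<and> g q (a i) (J (a j)) = 0"
  using assms
proof (induction F)
  case (insert k F)
  then obtain a where a: "\<And>i j. i \<in> F \<Longrightarrow> j \<in> F \<Longrightarrow>
      g q (a i) (a j) = (if i = j then 1 else 0) \<and> g q (a i) (J (a j)) = 0"
    by blast
  define L :: "complex^'m \<Rightarrow> complex^'m" where
    "L v = (\<chi> j. if j \<in> F then Complex (g q v (a j)) (g q v (J (a j))) else 0)" for v
  have lin: "linear L"
    by (rule linearI) (auto simp: L_def vec_eq_iff complex_eq_iff g_add_left g_scale_left)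
  \<comment> \<open>The values of \<open>L\<close> miss the new coordinate \<open>k\<close>, so
    \<open>L\<close> is not surjective, hence not injective; its kernel is the orthogonal
    complement.\<close>
  have "L v $ k = 0" for v using insert.hyps by (simp add: L_def)
  then have "L v \<noteq> axis k 1" for v by (metis axis_nth zero_neq_one)
  then have "\<not> surj L" by (metis surjD)
  then have "\<not> inj L" using linear_injective_imp_surjective[OF lin] by blast
  then obtain v where v: "v \<noteq> 0" "L v = 0" using lin by (auto simp: linear_injective_0)
  have vF: "g q v (a j) = 0" "g q v (J (a j)) = 0" if "j \<in> F" for j
    using v(2) that by (auto simp: L_def vec_eq_iff complex_eq_iff dest!: spec[of _ j])
  define x where "x = (1 / sqrt (g q v v)) *\<^sub>R v"
  have x1: "g q x x = 1"
    using g_pos[OF v(1), of q] by (simp add: x_def g_scale_left g_scale_right real_sqrt_mult[symmetric] divide_simps)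
  have xF: "g q x (a j) = 0" "g q x (J (a j)) = 0" "g q (a j) x = 0" "g q (a j) (J x) = 0" if "j \<in> F" for j
    using vF[OF that] g_sym[of q "a j"] g_J_left[of q x "a j"] by (auto simp: x_def g_scale_left g_scale_right)
  show ?case
    by (rule exI[of _ "a(k := x)"]) (use insert.hyps a x1 xF g_self_J in auto)
qed simp

lemma T10_eq: "T10 = range (\<lambda>u. (u, - J u) :: 'm ctangent)"
proof -
  have "(u, w) \<in> T10 \<longleftrightarrow> w = - J u" for u w :: "complex^'m"
    by (auto simp: T10_def cscale_def linear_neg[OF J_linear])
  then show ?thesis by auto
qed

text \<open>In u - iJu the real and the imaginary part contribute equally, whence the factor 2. It
  is the source of every factor sqrt 2 between unitary frames of \<open>T10\<close> and orthonormal
  tangent vectors.\<close>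

lemma metricC_frame:
  "metricC g q (u, - J u) (conjugate (v, - J v)) = Complex (2 * g q u v) (2 * g q u (J v))"
  by (simp add: metricC_def conjugate_def g_minus_left g_minus_right g_JJ g_J_left)

lemma unitary_frame_exists: "\<exists>e. unitary_frame g q e"
proof -
  obtain a :: "'m \<Rightarrow> complex^'m" where a: "\<And>i j. g q (a i) (a j) = (if i = j then 1 else 0)" "\<And>i j. g q (a i) (J (a j)) = 0"
    using partial_unitary_frame[OF finite_class.finite_UNIV, of q] by auto
  define b where "b i = (1 / sqrt 2) *\<^sub>R a i" for i
  have gb: "g q (b i) (b j) = (if i = j then 1 / 2 else 0)" "g q (b i) (J (b j)) = 0" for i j
    by (auto simp: b_def g_scale_left g_scale_right a linear_scale[OF J_linear])
  have "unitary_frame g q (\<lambda>i. (b i, - J (b i)))"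
    unfolding unitary_frame_def
    by (auto simp: T10_eq metricC_frame gb complex_eq_iff)
  then show ?thesis by blast
qed

text \<open>\<open>U\<close> identifies C^m, with its real inner product and multiplication by i,
  with the tangent space at \<open>q\<close>; it carries the standard basis to the rescaled real
  parts of the frame.\<close>

lemma unitary_frame_isometry:
  assumes "unitary_frame g q e"
  defines "U \<equiv> \<lambda>z. \<Sum>i\<in>UNIV. z $ i *s (sqrt 2 *\<^sub>R fst (e i))"
  shows "linear U" and "U (\<i> *s z) = J (U z)" and "g q (U z) (U w) = inner z w"
    and "bij U" and "U (axis j 1) = sqrt 2 *\<^sub>R fst (e j)" and "e j = (fst (e j), - J (fst (e j)))"
proof -
  have e: "e j = (fst (e j), - J (fst (e j)))" for j
    using assms(1) unfolding unitary_frame_def T10_eq by (metis (no_types, lifting) fst_conv imageE)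
  then show "e j = (fst (e j), - J (fst (e j)))" .
  define x where "x i = sqrt 2 *\<^sub>R fst (e i)" for i
  have Ux: "U z = (\<Sum>i\<in>UNIV. z $ i *s x i)" for z by (simp add: U_def x_def)
  have cf: "Complex (2 * g q (fst (e i)) (fst (e j))) (2 * g q (fst (e i)) (J (fst (e j)))) = (if i = j then 1 else 0)" for i j
    using assms(1) metricC_frame[of q "fst (e i)" "fst (e j)"] e unfolding unitary_frame_def by metis
  have ge: "2 * g q (fst (e i)) (fst (e j)) = (if i = j then 1 else 0)" "g q (fst (e i)) (J (fst (e j))) = 0" for i j
    using arg_cong[OF cf[of i j], of Re] arg_cong[OF cf[of i j], of Im] by (auto split: if_splits)
  have sq: "sqrt 2 * (sqrt 2 * r) = 2 * r" for r :: real by (simp add: mult.assoc[symmetric])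
  have gx: "g q (x i) (x j) = (if i = j then 1 else 0)" "g q (x i) (J (x j)) = 0" for i j
    using ge[of i j] by (auto simp: sq x_def g_scale_left g_scale_right linear_scale[OF J_linear] split: if_splits)
  show lin: "linear U"
    by (rule linearI) (simp_all add: Ux sum.distrib[symmetric] scaleR_sum_right vector_scalar_eq algebra_simps)
  show "U (\<i> *s z) = J (U z)"
    by (simp add: Ux linear_sum[OF J_linear]) (simp add: J_def vector_smult_assoc)
  have gz: "g q (a *s x i) (b *s x j) = (if i = j then inner a b else 0)" for a b i j
    by (auto simp: vector_scalar_eq g_add_left g_add_right g_scale_left g_scale_right gx g_JJ g_J_left g_minus_right inner_complex_def)
  have lg: "linear (\<lambda>u. g q u v)" "linear (\<lambda>v. g q u v)" for u v
    using g_bilinear[of q] by (auto simp: bilinear_def)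
  show iso: "g q (U z) (U w) = inner z w" for z w
    by (simp add: Ux linear_sum[OF lg(1)] linear_sum[OF lg(2)] gz inner_vec_def)
  have "inj U"
    unfolding linear_injective_0[OF lin] by (metis g_zero_left inner_eq_zero_iff iso)
  then show "bij U" using linear_injective_imp_surjective[OF lin] by (simp add: bij_def)
  show "U (axis j 1) = sqrt 2 *\<^sub>R fst (e j)"
  proof -
    have "axis j 1 $ i *s x i = (if i = j then x i else 0)" for i by (simp add: axis_def)
    then show ?thesis by (simp add: Ux) (simp add: x_def)
  qed
qed

text \<open>The curvature operator is skew, so each summand has real part zero. What remains is the
  real trace pairing with J that the linear algebra requires.\<close>

lemma chern_ricci_frame:
  assumes "unitary_frame g q e" and e: "e = (SOME e. unitary_frame g q e)"
  shows "chern_ricci A g nabla q u v =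
    \<i> * complex_of_real (\<Sum>j\<in>UNIV. 2 * g q (curvature_at A nabla q u v (fst (e j))) (J (fst (e j))))"
proof -
  let ?R = "curvature_at A nabla q u v"
  have "metricC g q (map_prod ?R ?R (e j)) (conjugate (e j)) = \<i> * complex_of_real (2 * g q (?R (fst (e j))) (J (fst (e j))))" for j
  proof -
    let ?a = "fst (e j)"
    have ej: "e j = (?a, - J ?a)" by (rule unitary_frame_isometry(6)[OF assms(1)])
    have "g q (?R ?a) ?a = 0"
      using curvature_at_skew[of q u v ?a ?a] g_sym[of q ?a] by simp
    moreover have "map_prod ?R ?R (e j) = (?R ?a, - J (?R ?a))"
      by (subst ej) (simp add: linear_neg[OF curvature_at_linear] curvature_at_J)
    ultimately show ?thesis
      using metricC_frame[of q "?R ?a" ?a] ej by (simp add: complex_eq_iff)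
  qed
  then show ?thesis
    by (simp add: chern_ricci_def Let_def e[symmetric] sum_distrib_left)
qed

lemma complex_linearI:
  fixes f :: "complex^'m \<Rightarrow> complex^'m"
  assumes lin: "linear f" and "\<And>z. f (\<i> *s z) = \<i> *s f z"
  shows "Vector_Spaces.linear (*s) (*s) f"
proof -
  have "f (a *s z) = a *s f z" for a z
    using assms(2)[of z] unfolding vector_scalar_eq[of a] J_def
    by (simp add: linear_add[OF lin] linear_scale[OF lin])
  then show ?thesis
    by (simp add: Vector_Spaces.linear_iff vec.vector_space_axioms linear_add[OF lin])
qed

end

text \<open>Three points occur: the Ricci curvature is nonzero at \<open>q\<close>, the holonomy is
  irreducible at \<open>p\<close>, and the torsion is to vanish at \<open>x\<close>. Torsion
  isometries connect them.\<close>

lemma (in parallel_torsion_manifold) torsion_free_if_chern_ricci: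
  assumes conn: "connected (UNIV :: 'a set)"
    and irr: "irreducible_on_T10 (restricted_holonomy A nabla p)"
    and ricci: "chern_ricci A g nabla q u v \<noteq> 0"
  shows "torsion_at x a b = 0"
proof -
  let ?R = "curvature_at A nabla q u v"
  define e where "e = (SOME e. unitary_frame g q e)"
  have e: "unitary_frame g q e" unfolding e_def by (rule someI_ex[OF unitary_frame_exists])
  define U where "U z = (\<Sum>i\<in>UNIV. z $ i *s (sqrt 2 *\<^sub>R fst (e i)))" for z
  note U = unitary_frame_isometry(1-5)[OF e, folded U_def]
  obtain Q where Q: "torsion_isometry q p Q" using torsion_isometry_exists[OF conn] by blast
  define V where "V = Q \<circ> U"
  note Q' = Q[unfolded torsion_isometry_def]
  have V: "linear V" "V (\<i> *s z) = J (V z)" "g p (V z) (V w) = inner z w" "bij V" for z w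
    using Q' U torsion_isometry_bij[OF Q] by (simp_all add: V_def linear_compose bij_comp)
  have UI [simp]: "U (inv U z) = z" for z using U(4) by (simp add: bij_is_surj surj_f_inv_f)
  have VI [simp]: "V (inv V z) = z" for z using V(4) by (simp add: bij_is_surj surj_f_inv_f)
  have U_eqI: "U z = U w \<Longrightarrow> z = w" for z w using U(4) by (simp add: bij_is_inj inj_eq)
  have V_eqI: "V z = V w \<Longrightarrow> z = w" for z w using V(4) by (simp add: bij_is_inj inj_eq)
  \<comment> \<open>The torsion at \<open>q\<close> read in C^m through \<open>U\<close>. As
    \<open>Q\<close> preserves torsion, it is also the torsion at \<open>p\<close> read through
    \<open>V\<close>; hence the curvature at \<open>q\<close> and the holonomy at \<open>p\<close>
    act on the same \<open>\<tau>\<close>.\<close>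
  define \<tau> where "\<tau> z w = inv U (torsion_at q (U z) (U w))" for z w
  have U\<tau>: "U (\<tau> z w) = torsion_at q (U z) (U w)" for z w by (simp add: \<tau>_def)
  have V\<tau>: "V (\<tau> z w) = torsion_at p (V z) (V w)" for z w
    using Q' by (simp add: V_def U\<tau>)
  note bil = torsion_at_bilinear[of q]
  have "\<tau> z w = 0" for z w
  proof (rule irreducible_unitary_invariant_bilinear_zero
      [where \<tau> = \<tau> and G = "(\<lambda>P. inv V \<circ> P \<circ> V) ` restricted_holonomy A nabla p" and b = "inv U \<circ> ?R \<circ> U"])
    show "bilinear \<tau>"
      unfolding bilinear_def
      by (intro conjI allI linearI; rule U_eqI)
        (simp_all add: U\<tau> linear_add[OF U(1)] linear_scale[OF U(1)] bilinear_ladd[OF bil] bilinear_radd[OF bil]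
          bilinear_lmul[OF bil] bilinear_rmul[OF bil])
    show "Vector_Spaces.linear (*s) (*s) (inv U \<circ> ?R \<circ> U)"
    proof (rule complex_linearI)
      show "linear (inv U \<circ> ?R \<circ> U)"
        by (rule linearI; rule U_eqI)
          (simp_all add: linear_add[OF U(1)] linear_scale[OF U(1)] linear_add[OF curvature_at_linear] linear_scale[OF curvature_at_linear])
      show "(inv U \<circ> ?R \<circ> U) (\<i> *s z) = \<i> *s (inv U \<circ> ?R \<circ> U) z" for z
        by (rule U_eqI) (simp add: U(2) curvature_at_J)
    qed
    show "inner ((inv U \<circ> ?R \<circ> U) z) w = - inner z ((inv U \<circ> ?R \<circ> U) w)" for z w
      by (simp add: U(3)[symmetric] curvature_at_skew[of q u v "U z" "U w"])
    show "(inv U \<circ> ?R \<circ> U) (\<tau> z w) = \<tau> ((inv U \<circ> ?R \<circ> U) z) w + \<tau> z ((inv U \<circ> ?R \<circ> U) w)" for z w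
      by (rule U_eqI) (simp add: U\<tau> linear_add[OF U(1)] curvature_at_torsion_at)
    \<comment> \<open>The basis vectors correspond to sqrt 2 times the real parts of the frame; the
      two factors produce the 2 of the Ricci formula.\<close>
    have "inner ((inv U \<circ> ?R \<circ> U) (axis j 1)) (\<i> *s axis j 1) = 2 * g q (?R (fst (e j))) (J (fst (e j)))" for j
      by (simp add: U(3)[symmetric] U(2) U(5) linear_scale[OF curvature_at_linear] linear_scale[OF J_linear]
          g_scale_left g_scale_right)
    moreover have "(\<Sum>j\<in>UNIV. 2 * g q (?R (fst (e j))) (J (fst (e j)))) \<noteq> 0"
    proof
      assume "(\<Sum>j\<in>UNIV. 2 * g q (?R (fst (e j))) (J (fst (e j)))) = 0"
      then have "chern_ricci A g nabla q u v = 0"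
        by (simp only: chern_ricci_frame[OF e e_def] of_real_0 mult_zero_right)
      with ricci show False by contradiction
    qed
    ultimately show "(\<Sum>j\<in>UNIV. inner ((inv U \<circ> ?R \<circ> U) (axis j 1)) (\<i> *s axis j 1)) \<noteq> 0"
      by simp
  next
    fix S assume "S \<in> (\<lambda>P. inv V \<circ> P \<circ> V) ` restricted_holonomy A nabla p"
    then obtain P where P: "P \<in> restricted_holonomy A nabla p" and S: "S = inv V \<circ> P \<circ> V" by blast
    note P' = torsion_isometry_holonomy[OF P, unfolded torsion_isometry_def]
    have VS: "V (S z) = P (V z)" for z by (simp add: S)
    have linP: "linear P" using P' by blast
    show "Vector_Spaces.linear (*s) (*s) S"
    proof (rule complex_linearI)
      show "linear S"
        by (rule linearI; rule V_eqI) (simp_all add: VS linear_add[OF V(1)] linear_scale[OF V(1)] linear_add[OF linP] linear_scale[OF linP])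
      show "S (\<i> *s z) = \<i> *s S z" for z
        by (rule V_eqI) (use P' in \<open>simp add: VS V(2)\<close>)
    qed
    show "inner (S z) (S w) = inner z w" for z w using P' by (simp add: V(3)[symmetric] VS)
    show "S (\<tau> z w) = \<tau> (S z) (S w)" for z w
      by (rule V_eqI) (use P' in \<open>simp add: VS V\<tau>\<close>)
  next
    fix W assume W: "vec.subspace W"
      and inv: "\<And>S. S \<in> (\<lambda>P. inv V \<circ> P \<circ> V) ` restricted_holonomy A nabla p \<Longrightarrow> S ` W \<subseteq> W"
    \<comment> \<open>\<open>I\<close> is the complex linear isomorphism from C^m to the
      (1,0)-vectors at \<open>p\<close>; it translates invariant subspaces of C^m into those to
      which irreducibility refers.\<close>
    define I where "I z = (V z, - J (V z))" for z
    have Iadd: "I z + I w = I (z + w)" for z w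
      by (simp add: I_def linear_add[OF V(1)] linear_add[OF J_linear])
    have Vs: "V (c *s z) = c *s V z" for c z
      using V(2)[of z] by (simp add: vector_scalar_eq[of c] linear_add[OF V(1)] linear_scale[OF V(1)] J_def)
    have Iscale: "cscale c (I z) = I (c *s z)" for c z
      by (simp add: I_def cscale_def Vs vector_scalar_eq[of c "V _"] linear_add[OF J_linear] linear_scale[OF J_linear])
    have I0: "I 0 = 0" by (simp add: I_def linear_0[OF V(1)] linear_0[OF J_linear] zero_prod_def)
    have "complex_subspace (I ` W)"
      unfolding complex_subspace_def
      using W I0 by (auto simp: Iadd Iscale vec.subspace_0 vec.subspace_add vec.subspace_scale intro!: imageI)
    moreover have "I ` W \<subseteq> T10" by (auto simp: I_def T10_eq)
    moreover have "map_prod P P ` (I ` W) \<subseteq> I ` W" if P: "P \<in> restricted_holonomy A nabla p" for P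
    proof -
      note P' = torsion_isometry_holonomy[OF P, unfolded torsion_isometry_def]
      have "map_prod P P (I z) = I (inv V (P (V z)))" for z
        using P' by (simp add: I_def linear_neg)
      moreover have "inv V (P (V z)) \<in> W" if "z \<in> W" for z
        using inv[of "inv V \<circ> P \<circ> V"] P that by auto
      ultimately show ?thesis by (simp add: image_image image_subset_iff)
    qed
    ultimately have "I ` W = {0} \<or> I ` W = T10"
      using irr[unfolded irreducible_on_T10_def, THEN spec[of _ "I ` W"]] by simp
    then show "W = {0} \<or> W = UNIV"
    proof
      assume "I ` W = {0}"
      then have "z = 0" if "z \<in> W" for z
        using that V_eqI[of z 0] by (auto simp: I_def zero_prod_def linear_0[OF V(1)])
      then show ?thesis using vec.subspace_0[OF W] by auto
    next
      assume *: "I ` W = T10"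
      have "z \<in> W" for z
      proof -
        have "I z \<in> I ` W" unfolding * by (auto simp: I_def T10_eq)
        then show ?thesis using V_eqI by (auto simp: I_def)
      qed
      then show ?thesis by auto
    qed
  qed
  then have Tq: "torsion_at q c d = 0" for c d
    using U\<tau>[of "inv U c" "inv U d"] by (simp add: linear_0[OF U(1)])
  \<comment> \<open>An isometry from \<open>x\<close> to \<open>q\<close> carries the torsion at
    \<open>x\<close> to zero, and it is injective.\<close>
  obtain P where P: "torsion_isometry x q P" using torsion_isometry_exists[OF conn] by blast
  then have "P (torsion_at x a b) = P 0"
    using Tq by (simp add: torsion_isometry_def linear_0)
  then show ?thesis using torsion_isometry_bij[OF P] by (simp add: bij_is_inj inj_eq)
qed

theorem theorem1p2:
  fixes A :: "('a::{t2_space,second_countable_topology}, 'm::finite) chart set"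
    and g :: "('a, 'm) metric"
    and nabla :: "('a, 'm) connection"
    and p :: 'a
  assumes "complex_atlas A"
    and "connected (UNIV :: 'a set)"
    and "hermitian_metric A g"
    and "hermitian_connection A g nabla"
    and "irreducible_on_T10 (restricted_holonomy A nabla p)"
    and "parallel_torsion A nabla"
  shows "((\<exists>q u v. chern_ricci A g nabla q u v \<noteq> 0) \<longrightarrow> kaehler A g) \<and>
         (\<not> kaehler A g \<longrightarrow> (\<forall>q u v. chern_ricci A g nabla q u v = 0))"
proof -
  interpret parallel_torsion_manifold A g nabla
    by unfold_locales (fact assms)+
  have "kaehler A g" if "chern_ricci A g nabla q u v \<noteq> 0" for q u v
    using torsion_free_if_chern_ricci[OF assms(2,5) that] by (rule kaehler_if_torsion_free)
  then show ?thesis by blast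
qed

end
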